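(* Let $R$ be a Noetherian ring of Krull dimension one with a unique minimal prime ideal $\mathfrak p$, and assume that $D=R/\mathfrak p$ is a principal ideal domain. Then the following are equivalent: (i) $R$ is iso-Artinian; (ii) $R$ is generically reduced, i.e. $R_{\mathfrak p}$ is a field; (iii) $\mathfrak pR_{\mathfrak p}=0$; (iv) $\mathfrak p$ has finite length (as an $R$-module); (v) $\mathfrak p/\mathfrak p^2$ is a torsion $D$-module; (vi) $\operatorname{rank}_D(\mathfrak p/\mathfrak p^2)=0$; (vii) there exists $s\in R\setminus\mathfrak p$ with $s\mathfrak p=0$.
   Context: All rings are commutative with identity and all modules are unital. A commutative ring $R$ is called iso-Artinian if for every descending chain of ideals $I_1\supseteq I_2\supseteq I_3\supseteq\cdots$ of $R$ there exists $n_0$ such that $I_n\cong I_{n_0}$ as $R$-modules for every $n\ge n_0$. For a module $M$ over an integral domain $D$ with fraction field $K$, $\operatorname{rank}_D M=\dim_K(M\otimes_D K)$. *)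

theory Defs
  imports "HOL-Algebra.Algebra" "Jordan_Normal_Form.Missing_VectorSpace"
    "HOL-Library.Extended_Nat" "HOL-Library.Poly_Mapping"
begin

text \<open>
  Module homomorphisms, vector spaces and \<open>submodule\<close> (with argument order ring, subset, module)
  are those of the theories underlying \<^theory>\<open>Jordan_Normal_Form.Missing_VectorSpace\<close>.
  A module record extends a ring record, but the locale \<^locale>\<open>module\<close> puts no condition on the
  fields \<open>mult\<close> and \<open>one\<close>; where no multiplication is meant they are left \<open>undefined\<close>.
\<close>

section \<open>Prime ideals and Krull dimension\<close>

definition minimal_primeideal :: "'a set \<Rightarrow> ('a, 'm) ring_scheme \<Rightarrow> bool" where
  "minimal_primeideal p R \<longleftrightarrow>
     primeideal p R \<and> (\<forall>q. primeideal q R \<and> q \<subseteq> p \<longrightarrow> q = p)"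

text \<open>The dimension of the zero ring is 0 here, the supremum of the empty set in \<^typ>\<open>enat\<close>.\<close>

definition krull_dim :: "('a, 'm) ring_scheme \<Rightarrow> enat" where
  "krull_dim R = Sup {enat n | n. \<exists>P :: nat \<Rightarrow> 'a set.
     (\<forall>i\<le>n. primeideal (P i) R) \<and> (\<forall>i<n. P i \<subset> P (Suc i))}"


section \<open>Modules\<close>

definition ring_as_module :: "('a \<Rightarrow> 'b) \<Rightarrow> ('b, 'm) ring_scheme \<Rightarrow> ('a, 'b) module" where
  "ring_as_module \<phi> S =
     \<lparr>carrier = carrier S, monoid.mult = monoid.mult S, one = one S,
      ring.zero = ring.zero S, ring.add = ring.add S,
      module.smult = (\<lambda>r x. \<phi> r \<otimes>\<^bsub>S\<^esub> x)\<rparr>"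
  \<comment> \<open>\<open>S\<close> as a module over \<open>R\<close> along a ring homomorphism \<open>\<phi>\<close> from \<open>R\<close> to \<open>S\<close>\<close>

definition ideal_as_module :: "('a, 'm) ring_scheme \<Rightarrow> 'a set \<Rightarrow> ('a, 'a) module" where
  "ideal_as_module R I = (ring_as_module id R)\<lparr>carrier := I\<rparr>"

definition module_isomorphic ::
  "('a, 'm) ring_scheme \<Rightarrow> ('a, 'b, 'n) module_scheme \<Rightarrow> ('a, 'c, 'k) module_scheme \<Rightarrow> bool" where
  "module_isomorphic R M N \<longleftrightarrow> (\<exists>f \<in> module_hom R M N. bij_betw f (carrier M) (carrier N))"

definition module_length :: "('a, 'm) ring_scheme \<Rightarrow> ('a, 'b, 'n) module_scheme \<Rightarrow> enat" where
  "module_length R M = Sup {enat n | n. \<exists>N :: nat \<Rightarrow> 'b set.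
     (\<forall>i\<le>n. submodule R (N i) M) \<and> (\<forall>i<n. N i \<subset> N (Suc i))}"

definition finite_length :: "('a, 'm) ring_scheme \<Rightarrow> ('a, 'b, 'n) module_scheme \<Rightarrow> bool" where
  "finite_length R M \<longleftrightarrow> module_length R M < \<infinity>"

definition torsion_module :: "('a, 'm) ring_scheme \<Rightarrow> ('a, 'b, 'n) module_scheme \<Rightarrow> bool" where
  "torsion_module D M \<longleftrightarrow>
     (\<forall>x \<in> carrier M. \<exists>d \<in> carrier D - {\<zero>\<^bsub>D\<^esub>}. d \<odot>\<^bsub>M\<^esub> x = \<zero>\<^bsub>M\<^esub>)"

definition iso_artinian :: "('a, 'm) ring_scheme \<Rightarrow> bool" where
  "iso_artinian R \<longleftrightarrow>
     (\<forall>I :: nat \<Rightarrow> 'a set.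
        (\<forall>n. ideal (I n) R) \<and> (\<forall>n. I (Suc n) \<subseteq> I n) \<longrightarrow>
        (\<exists>n0. \<forall>n\<ge>n0. module_isomorphic R (ideal_as_module R (I n)) (ideal_as_module R (I n0))))"

text \<open>
  The module \<open>I/I\<^sup>2\<close> over \<open>R/I\<close>. Scalars are cosets of \<open>I\<close> and vectors are cosets of \<open>I\<^sup>2\<close>
  contained in \<open>I\<close>; \<^const>\<open>rcoset_mult\<close> takes the union of the cosets \<open>I\<^sup>2 + a x\<close> over all
  representatives, which is a single coset because \<open>I I\<close> and \<open>R I\<^sup>2\<close> are contained in \<open>I\<^sup>2\<close>.
\<close>

definition conormal_module :: "('a, 'm) ring_scheme \<Rightarrow> 'a set \<Rightarrow> ('a set, 'a set) module" where
  "conormal_module R I =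
     \<lparr>carrier = a_rcosets\<^bsub>R\<lparr>carrier := I\<rparr>\<^esub> (I \<cdot>\<^bsub>R\<^esub> I), monoid.mult = undefined, one = undefined,
      ring.zero = I \<cdot>\<^bsub>R\<^esub> I, ring.add = set_add R, module.smult = rcoset_mult R (I \<cdot>\<^bsub>R\<^esub> I)\<rparr>"


section \<open>Localization\<close>

definition fraction_rel ::
  "('a, 'm) ring_scheme \<Rightarrow> 'a set \<Rightarrow> (('a \<times> 'a) \<times> ('a \<times> 'a)) set" where
  "fraction_rel R S =
     {((a, s), (b, t)) | a s b t. a \<in> carrier R \<and> s \<in> S \<and> b \<in> carrier R \<and> t \<in> S \<and>
        (\<exists>u \<in> S. u \<otimes>\<^bsub>R\<^esub> (t \<otimes>\<^bsub>R\<^esub> a) = u \<otimes>\<^bsub>R\<^esub> (s \<otimes>\<^bsub>R\<^esub> b))}"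

definition fraction :: "('a, 'm) ring_scheme \<Rightarrow> 'a set \<Rightarrow> 'a \<Rightarrow> 'a \<Rightarrow> ('a \<times> 'a) set" where
  "fraction R S a s = fraction_rel R S `` {(a, s)}"

text \<open>
  As for \<^const>\<open>rcoset_mult\<close>, the operations on classes are unions over all representatives.
  The set \<open>S\<close> is meant to be multiplicatively closed and to contain 1.
\<close>

definition localization :: "('a, 'm) ring_scheme \<Rightarrow> 'a set \<Rightarrow> ('a \<times> 'a) set ring" where
  "localization R S =
     \<lparr>carrier = (carrier R \<times> S) // fraction_rel R S,
      monoid.mult = (\<lambda>A B. \<Union>x\<in>A. \<Union>y\<in>B.
        fraction R S (fst x \<otimes>\<^bsub>R\<^esub> fst y) (snd x \<otimes>\<^bsub>R\<^esub> snd y)),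
      one = fraction R S \<one>\<^bsub>R\<^esub> \<one>\<^bsub>R\<^esub>,
      ring.zero = fraction R S \<zero>\<^bsub>R\<^esub> \<one>\<^bsub>R\<^esub>,
      ring.add = (\<lambda>A B. \<Union>x\<in>A. \<Union>y\<in>B.
        fraction R S ((snd y \<otimes>\<^bsub>R\<^esub> fst x) \<oplus>\<^bsub>R\<^esub> (snd x \<otimes>\<^bsub>R\<^esub> fst y)) (snd x \<otimes>\<^bsub>R\<^esub> snd y))\<rparr>"

definition localization_map :: "('a, 'm) ring_scheme \<Rightarrow> 'a set \<Rightarrow> 'a \<Rightarrow> ('a \<times> 'a) set" where
  "localization_map R S a = fraction R S a \<one>\<^bsub>R\<^esub>"

definition localization_at :: "('a, 'm) ring_scheme \<Rightarrow> 'a set \<Rightarrow> ('a \<times> 'a) set ring" where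
  "localization_at R p = localization R (carrier R - p)"

definition localized_ideal :: "('a, 'm) ring_scheme \<Rightarrow> 'a set \<Rightarrow> 'a set \<Rightarrow> ('a \<times> 'a) set set" where
  "localized_ideal R I p =
     Idl\<^bsub>localization_at R p\<^esub> (localization_map R (carrier R - p) ` I)"
  \<comment> \<open>\<open>I R\<^sub>p\<close>, the ideal of \<open>R\<^sub>p\<close> generated by the image of \<open>I\<close>\<close>

definition fraction_field :: "('a, 'm) ring_scheme \<Rightarrow> ('a \<times> 'a) set ring" where
  "fraction_field D = localization D (carrier D - {\<zero>\<^bsub>D\<^esub>})"

definition fraction_field_map :: "('a, 'm) ring_scheme \<Rightarrow> 'a \<Rightarrow> ('a \<times> 'a) set" where
  "fraction_field_map D = localization_map D (carrier D - {\<zero>\<^bsub>D\<^esub>})"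


section \<open>Tensor product and rank\<close>

text \<open>
  The tensor product of \<open>M\<close> and \<open>N\<close> is the free abelian group on pairs modulo the usual bilinear
  relations. \<^const>\<open>free_Abelian_group\<close> is written multiplicatively as a group record, while its
  elements are added and subtracted by the operations of the type.
\<close>

definition tensor_relations ::
  "('d, 'm) ring_scheme \<Rightarrow> ('d, 'b, 'n) module_scheme \<Rightarrow> ('d, 'c, 'k) module_scheme \<Rightarrow>
     (('b \<times> 'c) \<Rightarrow>\<^sub>0 int) set" where
  "tensor_relations D M N =
     {frag_of (x \<oplus>\<^bsub>M\<^esub> y, z) - frag_of (x, z) - frag_of (y, z) | x y z.
        x \<in> carrier M \<and> y \<in> carrier M \<and> z \<in> carrier N} \<union>
     {frag_of (x, y \<oplus>\<^bsub>N\<^esub> z) - frag_of (x, y) - frag_of (x, z) | x y z.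
        x \<in> carrier M \<and> y \<in> carrier N \<and> z \<in> carrier N} \<union>
     {frag_of (d \<odot>\<^bsub>M\<^esub> x, z) - frag_of (x, d \<odot>\<^bsub>N\<^esub> z) | d x z.
        d \<in> carrier D \<and> x \<in> carrier M \<and> z \<in> carrier N}"

definition tensor_kernel ::
  "('d, 'm) ring_scheme \<Rightarrow> ('d, 'b, 'n) module_scheme \<Rightarrow> ('d, 'c, 'k) module_scheme \<Rightarrow>
     (('b \<times> 'c) \<Rightarrow>\<^sub>0 int) set" where
  "tensor_kernel D M N =
     generate (free_Abelian_group (carrier M \<times> carrier N)) (tensor_relations D M N)"

text \<open>
  \<open>M \<otimes>\<^sub>D K\<close> as a \<open>K\<close>-module, for a ring homomorphism \<open>\<phi>\<close> from \<open>D\<close> to \<open>K\<close>. A scalar \<open>k\<close> acts by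
  \<open>x \<otimes> z \<mapsto> x \<otimes> k z\<close>, extended linearly to the free group and then passed to cosets.
\<close>

definition base_change ::
  "('d, 'm) ring_scheme \<Rightarrow> ('d \<Rightarrow> 'c) \<Rightarrow> ('c, 'k) ring_scheme \<Rightarrow> ('d, 'b, 'n) module_scheme \<Rightarrow>
     ('c, (('b \<times> 'c) \<Rightarrow>\<^sub>0 int) set) module" where
  "base_change D \<phi> K M =
     (let F = free_Abelian_group (carrier M \<times> carrier K);
          T = tensor_kernel D M (ring_as_module \<phi> K)
      in \<lparr>carrier = rcosets\<^bsub>F\<^esub> T, monoid.mult = undefined, one = undefined,
          ring.zero = T, ring.add = set_mult F,
          module.smult = (\<lambda>k A. \<Union>c\<in>A. T #>\<^bsub>F\<^esub> frag_extend (\<lambda>(x, z). frag_of (x, k \<otimes>\<^bsub>K\<^esub> z)) c)\<rparr>)"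

definition vs_dim :: "('k, 'm) ring_scheme \<Rightarrow> ('k, 'b, 'n) module_scheme \<Rightarrow> enat" where
  "vs_dim K V = (if vectorspace.fin_dim K V then enat (vectorspace.dim K V) else \<infinity>)"

definition module_rank :: "('d, 'm) ring_scheme \<Rightarrow> ('d, 'b, 'n) module_scheme \<Rightarrow> enat" where
  "module_rank D M =
     vs_dim (fraction_field D) (base_change D (fraction_field_map D) (fraction_field D) M)"

end

theory Submission
  imports Defs
begin

text \<open>
  Every condition is compared with the existence of an element \<open>s\<close> outside \<open>p\<close> with \<open>s p = 0\<close>. Because
  of the dimension, \<open>p\<close> is contained in every prime ideal and all other primes are maximal. Because \<open>R\<close> is
  Noetherian, for ideals \<open>I \<subset> P\<close> there is an \<open>x \<in> P - I\<close> whose colon ideal \<open>(I : x)\<close> is prime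
  (\<open>ex_associated_prime\<close>), and statements can be proved by inspecting a maximal counterexample.

  Finite length. If \<open>s p = 0\<close> and \<open>M \<subset> p\<close>, a prime \<open>(M : x)\<close> with \<open>x \<in> p\<close> contains \<open>s\<close>, hence is maximal.
  So \<open>M + (x)\<close> covers \<open>M\<close>, and a maximal \<open>M\<close> of finite length is all of \<open>p\<close>
  (\<open>chains_bounded_if_p_killed\<close>). Conversely, let \<open>t\<close> be neither zero nor a unit modulo \<open>p\<close>. If
  the chain of the ideals \<open>(t\<^sup>k x)\<close> stabilizes, some \<open>(1 - r t) t\<^sup>k\<close> kills \<open>x\<close>, and \<open>p\<close> is finitely
  generated (\<open>p_killed_if_chains_bounded\<close>).

  The conormal module. By finite generation, \<open>p/p\<^sup>2\<close> is torsion over \<open>R/p\<close> exactly if \<open>s p \<subseteq> p\<^sup>2\<close> for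
  some \<open>s\<close> outside \<open>p\<close>. This already gives some \<open>s'\<close> outside \<open>p\<close> with \<open>s' p = 0\<close>
  (\<open>p_killed_if_killed_mod_square\<close>). A torsion element vanishes in \<open>p/p\<^sup>2 \<otimes>\<^sub>D K\<close>. Conversely, the tensor
  product maps to the local ring at \<open>p\<close> modulo the extension of \<open>p\<^sup>2\<close>, where only torsion elements vanish
  (\<open>torsion_if_rank_zero\<close>).

  The iso-Artinian property. Applied to the ideals \<open>p + (t\<^sup>k)\<close>, it gives
  \<open>t\<^sup>n p \<subseteq> p\<^sup>2 + t\<^sup>n\<^sup>+\<^sup>1 p\<close> for some \<open>n\<close>, and Nakayama's lemma makes \<open>p/p\<^sup>2\<close> torsion
  (\<open>p_killed_mod_square_if_iso_artinian\<close>). Conversely, let \<open>p\<close> have finite length. The members of a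
  descending chain of ideals that never enters \<open>p\<close> eventually have the form \<open>L + (a\<^sub>k)\<close> with
  a fixed ideal \<open>L \<subseteq> p\<close>, since \<open>R/p\<close> is a principal ideal domain. Two late members differ by a factor \<open>c\<close>
  in the generator. Fitting's lemma splits off the part of \<open>L\<close> on which \<open>c\<close> is nilpotent, and an
  isomorphism is obtained from the identity there and multiplication by \<open>c\<close> on a complement
  (\<open>iso_artinian_if_chains_bounded\<close>).

  The conditions on the local ring at \<open>p\<close> translate directly, as \<open>x/1 = 0\<close> means that \<open>x\<close> is killed by an
  element outside \<open>p\<close>.
\<close>

section \<open>Colon ideals in Noetherian rings\<close>

text \<open>
  Colons are formed with arbitrary sets: \<open>colon I {x}\<close> is the annihilator of the class of \<open>x\<close> in
  \<open>R/I\<close>, and \<open>colon I p\<close> is the usual ideal quotient \<open>(I : p)\<close>.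
\<close>

definition (in ring) colon :: "'a set \<Rightarrow> 'a set \<Rightarrow> 'a set" where
  "colon I B = {r. r \<in> carrier R \<and> (\<forall>x\<in>B. r \<otimes> x \<in> I)}"

definition (in ring) adjoin :: "'a set \<Rightarrow> 'a \<Rightarrow> 'a set" where
  "adjoin I x = {m \<oplus> r \<otimes> x | m r. m \<in> I \<and> r \<in> carrier R}"

lemma
  fixes R (structure)
  assumes "ideal I R"
  shows ideal_subset: "I \<subseteq> carrier R"
    and ideal_carr: "\<And>a. a \<in> I \<Longrightarrow> a \<in> carrier R"
    and ideal_zero: "\<zero> \<in> I"
    and ideal_add: "\<And>a b. a \<in> I \<Longrightarrow> b \<in> I \<Longrightarrow> a \<oplus> b \<in> I"
    and ideal_minus: "\<And>a b. a \<in> I \<Longrightarrow> b \<in> I \<Longrightarrow> a \<ominus> b \<in> I"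
    and ideal_smult: "\<And>r a. r \<in> carrier R \<Longrightarrow> a \<in> I \<Longrightarrow> r \<otimes> a \<in> I"
    and ideal_smult': "\<And>r a. r \<in> carrier R \<Longrightarrow> a \<in> I \<Longrightarrow> a \<otimes> r \<in> I"
proof -
  interpret ideal I R by fact
  show "I \<subseteq> carrier R" using a_subset .
  show "\<zero> \<in> I" by simp
  show "a \<oplus> b \<in> I" "a \<ominus> b \<in> I" if "a \<in> I" "b \<in> I" for a b using that by (simp_all add: a_minus_def)
  show "r \<otimes> a \<in> I" "a \<otimes> r \<in> I" if "r \<in> carrier R" "a \<in> I" for a r
    using that by (auto intro: I_l_closed I_r_closed)
  show "a \<in> carrier R" if "a \<in> I" for a using that by simp
qed

text \<open>
  In a ring with 1, closure under negation comes from multiplying by \<open>-1\<close>.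
\<close>

lemma (in cring) cring_idealI:
  assumes "I \<subseteq> carrier R" "\<zero> \<in> I" "\<And>a b. a \<in> I \<Longrightarrow> b \<in> I \<Longrightarrow> a \<oplus> b \<in> I"
    and "\<And>r a. r \<in> carrier R \<Longrightarrow> a \<in> I \<Longrightarrow> r \<otimes> a \<in> I"
  shows "ideal I R"
proof (rule idealI)
  show "ring R" by unfold_locales
  have "\<ominus> a \<in> I" if "a \<in> I" for a
  proof -
    have "\<ominus> a = (\<ominus> \<one>) \<otimes> a" using that assms(1) by (simp add: l_minus subset_iff)
    then show ?thesis using assms(4) that by simp
  qed
  then show "subgroup I (add_monoid R)"
    using assms by (intro add.subgroupI) (auto simp: a_inv_def)
  show "r \<otimes> a \<in> I" "a \<otimes> r \<in> I" if "a \<in> I" "r \<in> carrier R" for a r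
    using assms(4)[OF that(2,1)] m_comm[of a r] that assms(1) by auto
qed

lemma (in cring) colon_ideal:
  assumes "ideal I R" "B \<subseteq> carrier R"
  shows "ideal (colon I B) R"
proof -
  interpret I: ideal I R by fact
  show ?thesis
    using assms(2) by (intro cring_idealI) (auto simp: colon_def l_distr m_assoc subset_iff I.I_l_closed)
qed

lemma (in cring) adjoin_ideal:
  assumes "ideal I R" and [simp]: "x \<in> carrier R"
  shows "ideal (adjoin I x) R" "I \<subseteq> adjoin I x" "x \<in> adjoin I x"
proof -
  interpret I: ideal I R by fact
  have memI: "m \<oplus> r \<otimes> x \<in> adjoin I x" if "m \<in> I" "r \<in> carrier R" for m r
    using that by (auto simp: adjoin_def)
  show *: "I \<subseteq> adjoin I x"
  proof
    fix y assume "y \<in> I"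
    then show "y \<in> adjoin I x" using memI[of y \<zero>] by simp
  qed
  show "x \<in> adjoin I x"
    using memI[of \<zero> \<one>] by simp
  show "ideal (adjoin I x) R"
  proof (rule cring_idealI)
    show "adjoin I x \<subseteq> carrier R" by (auto simp: adjoin_def)
    show "\<zero> \<in> adjoin I x" using * by auto
    fix a assume "a \<in> adjoin I x"
    then obtain m r where a: "m \<in> I" "r \<in> carrier R" "a = m \<oplus> r \<otimes> x" by (auto simp: adjoin_def)
    have [simp]: "m \<in> carrier R" using a by simp
    show "t \<otimes> a \<in> adjoin I x" if "t \<in> carrier R" for t
    proof -
      have "t \<otimes> a = t \<otimes> m \<oplus> (t \<otimes> r) \<otimes> x" using that a by (simp add: r_distr m_assoc)
      then show ?thesis using memI that a by (simp add: I.I_l_closed)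
    qed
    fix b assume "b \<in> adjoin I x"
    then obtain n s where b: "n \<in> I" "s \<in> carrier R" "b = n \<oplus> s \<otimes> x" by (auto simp: adjoin_def)
    have [simp]: "n \<in> carrier R" using b by simp
    have "a \<oplus> b = (m \<oplus> n) \<oplus> (r \<oplus> s) \<otimes> x"
      using a(2) b(2) assms(2) \<open>m \<in> carrier R\<close> \<open>n \<in> carrier R\<close> unfolding a(3) b(3) by algebra
    then show "a \<oplus> b \<in> adjoin I x" using memI a b by simp
  qed
qed

lemma (in cring) adjoin_subset:
  assumes "ideal J R" "I \<subseteq> J" "x \<in> J"
  shows "adjoin I x \<subseteq> J"
proof -
  interpret J: ideal J R by fact
  show ?thesis using assms(2,3) by (auto simp: adjoin_def J.I_l_closed)
qed

text \<open>
  The quotient of \<open>I + (x)\<close> by \<open>I\<close> is cyclic with annihilator \<open>(I : x)\<close>. So it is a simple module as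
  soon as that annihilator is a maximal ideal.
\<close>

lemma (in cring) cover_of_maximal_colon:
  assumes I: "ideal I R" and x: "x \<in> carrier R" and max: "maximalideal (colon I {x}) R"
    and J: "ideal J R" "I \<subseteq> J" "J \<subseteq> adjoin I x"
  shows "J = I \<or> J = adjoin I x"
proof -
  have "ideal (colon J {x}) R" using colon_ideal J(1) x by simp
  moreover have "colon I {x} \<subseteq> colon J {x}" "colon J {x} \<subseteq> carrier R"
    using J(2) by (auto simp: colon_def)
  ultimately consider "colon J {x} = colon I {x}" | "colon J {x} = carrier R"
    using maximalideal.I_maximal[OF max] by blast
  then show ?thesis
  proof cases
    case 1
    have "y \<in> I" if "y \<in> J" for y
    proof -
      obtain m r where y: "m \<in> I" "r \<in> carrier R" "y = m \<oplus> r \<otimes> x"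
        using J(3) \<open>y \<in> J\<close> unfolding adjoin_def by blast
      have m: "m \<in> carrier R" using ideal_carr[OF I] y(1) .
      have "y \<ominus> m = r \<otimes> x" unfolding y(3) using x y(2) m by algebra
      then have "r \<otimes> x \<in> J" using ideal_minus[OF J(1)] that y(1) J(2) by (metis subsetD)
      then have "r \<in> colon J {x}" using y(2) by (simp add: colon_def)
      then have "r \<otimes> x \<in> I" unfolding 1 by (simp add: colon_def)
      then show ?thesis using y ideal_add[OF I] by simp
    qed
    then show ?thesis using J(2) by blast
  next
    case 2
    then have "\<one> \<in> colon J {x}" by simp
    then have "x \<in> J" using x by (simp add: colon_def)
    then show ?thesis using adjoin_subset[OF J(1)] J by blast
  qed
qed

locale noetherian_cring = cring R + noetherian_ring R for R (structure)

context noetherian_cring begin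

text \<open>
  Noetherian induction, in the form in which it is used throughout: to refute a counterexample, take a
  maximal one.
\<close>

lemma ex_maximal_ideal_in:
  assumes "F \<noteq> {}" "\<And>I. I \<in> F \<Longrightarrow> ideal I R"
  obtains M where "M \<in> F" "\<And>J. J \<in> F \<Longrightarrow> M \<subseteq> J \<Longrightarrow> J = M"
proof -
  have "\<exists>M\<in>F. \<forall>J\<in>F. M \<subseteq> J \<longrightarrow> J = M"
  proof (rule subset_Zorn_nonempty[OF assms(1)])
    fix C assume C: "C \<noteq> {}" "subset.chain F C"
    then have "subset.chain {I. ideal I R} C"
      using assms(2) by (auto simp: pred_on.chain_def)
    then have "\<Union>C \<in> C" using ideal_chain_is_trivial C by blast
    then show "\<Union>C \<in> F" using C(2) by (auto simp: pred_on.chain_def)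
  qed
  then show thesis using that by blast
qed

text \<open>
  The module \<open>P/I\<close> is nonzero and so has an associated prime. It is found as a maximal element among
  the annihilators \<open>(I : x)\<close> of nonzero classes: if \<open>a b\<close> kills \<open>x\<close> and \<open>b\<close> does not, then
  \<open>(I : b x)\<close> contains \<open>(I : x)\<close>, hence equals it, and it contains \<open>a\<close>.
\<close>

lemma ex_associated_prime:
  assumes "ideal I R" "ideal P R" "I \<subset> P"
  obtains x where "x \<in> P" "x \<notin> I" "primeideal (colon I {x}) R"
proof -
  have "(\<lambda>x. colon I {x}) ` (P - I) \<noteq> {}" using assms(3) by blast
  moreover have "ideal J R" if "J \<in> (\<lambda>x. colon I {x}) ` (P - I)" for J
    using that colon_ideal[OF assms(1)] ideal_carr[OF assms(2)] by auto
  ultimately obtain M where "M \<in> (\<lambda>x. colon I {x}) ` (P - I)"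
    and M: "\<And>J. J \<in> (\<lambda>x. colon I {x}) ` (P - I) \<Longrightarrow> M \<subseteq> J \<Longrightarrow> J = M"
    using ex_maximal_ideal_in by metis
  then obtain x where x: "x \<in> P" "x \<notin> I" "M = colon I {x}" by blast
  then have xc[simp]: "x \<in> carrier R" using ideal_carr[OF assms(2)] by auto
  have "primeideal (colon I {x}) R"
  proof (rule primeidealI)
    show "ideal (colon I {x}) R" using colon_ideal assms(1) by simp
    show "cring R" by unfold_locales
    show "carrier R \<noteq> colon I {x}"
    proof
      assume "carrier R = colon I {x}"
      then have "\<one> \<in> colon I {x}" by blast
      then show False using x(2) by (simp add: colon_def)
    qed
    fix a b assume ab: "a \<in> carrier R" "b \<in> carrier R" "a \<otimes> b \<in> colon I {x}"
    show "a \<in> colon I {x} \<or> b \<in> colon I {x}"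
    proof (rule disjCI)
      assume "b \<notin> colon I {x}"
      then have bx: "b \<otimes> x \<in> P - I" using ab x ideal_smult[OF assms(2)] by (simp add: colon_def)
      have "colon I {x} \<subseteq> colon I {b \<otimes> x}"
      proof
        fix r assume r: "r \<in> colon I {x}"
        then have "r \<in> carrier R" "b \<otimes> (r \<otimes> x) \<in> I"
          using ab ideal_smult[OF assms(1)] by (auto simp: colon_def)
        moreover have "b \<otimes> (r \<otimes> x) = r \<otimes> (b \<otimes> x)"
          using \<open>r \<in> carrier R\<close> ab(2) by (simp add: m_lcomm)
        ultimately show "r \<in> colon I {b \<otimes> x}" by (simp add: colon_def)
      qed
      then have "colon I {b \<otimes> x} = colon I {x}" using M bx x(3) by blast
      moreover have "a \<in> colon I {b \<otimes> x}" using ab by (simp add: colon_def m_assoc)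
      ultimately show "a \<in> colon I {x}" by simp
    qed
  qed
  with x that show thesis by blast
qed

text \<open>
  Nakayama's lemma for \<open>B \<subseteq> s B + Q\<close>, with a multiplier of the form \<open>1 - r s\<close>. Noetherian
  induction replaces determinants. Let \<open>M\<close> be a maximal counterexample containing \<open>Q\<close> and let
  \<open>y\<close> be in \<open>B\<close> but not in \<open>M\<close>. By maximality some \<open>e = 1 - r s\<close> maps \<open>B\<close> into \<open>M + (y)\<close>. Writing
  \<open>y\<close> as \<open>s c\<close> with \<open>c \<in> B\<close>, and \<open>e c\<close> as \<open>t y\<close>, both modulo \<open>M\<close>, gives \<open>e y = s t y\<close>, so
  \<open>e - s t\<close> kills \<open>y\<close> modulo \<open>M\<close>. The product \<open>(e - s t) e\<close> then maps \<open>B\<close> into \<open>M\<close>, and it again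
  has the form \<open>1 - q s\<close>.
\<close>

lemma nakayama_multiplier:
  assumes "ideal B R" "ideal Q R" and s[simp]: "s \<in> carrier R"
    and gen: "\<And>b. b \<in> B \<Longrightarrow> \<exists>c\<in>B. b \<ominus> s \<otimes> c \<in> Q"
  shows "\<exists>r\<in>carrier R. \<forall>b\<in>B. (\<one> \<ominus> r \<otimes> s) \<otimes> b \<in> Q"
proof (rule ccontr)
  define F where "F = {J. ideal J R \<and> Q \<subseteq> J \<and> \<not> (\<exists>r\<in>carrier R. \<forall>b\<in>B. (\<one> \<ominus> r \<otimes> s) \<otimes> b \<in> J)}"
  assume "\<not> ?thesis"
  then have "Q \<in> F" using assms(2) by (simp add: F_def)
  then have "F \<noteq> {}" by blast
  moreover have "ideal J R" if "J \<in> F" for J using that by (simp add: F_def)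
  ultimately obtain M where "M \<in> F" and max: "\<And>J. J \<in> F \<Longrightarrow> M \<subseteq> J \<Longrightarrow> J = M"
    using ex_maximal_ideal_in by blast
  then have M: "ideal M R" "Q \<subseteq> M"
    and bad: "\<And>r. r \<in> carrier R \<Longrightarrow> \<exists>b\<in>B. (\<one> \<ominus> r \<otimes> s) \<otimes> b \<notin> M"
    by (auto simp: F_def)
  obtain y where y: "y \<in> B" "y \<notin> M"
    using bad[of \<zero>] ideal_carr[OF assms(1)] by (auto simp: a_minus_def)
  have yc[simp]: "y \<in> carrier R" using y ideal_carr[OF assms(1)] by simp
  let ?J = "adjoin M y"
  have "?J \<notin> F" using max[of ?J] adjoin_ideal[OF M(1) yc] y(2) by blast
  then obtain r where r[simp]: "r \<in> carrier R" and rJ: "\<And>b. b \<in> B \<Longrightarrow> (\<one> \<ominus> r \<otimes> s) \<otimes> b \<in> ?J"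
    using adjoin_ideal[OF M(1) yc] M(2) by (auto simp: F_def)
  obtain c where c: "c \<in> B" "y \<ominus> s \<otimes> c \<in> M" using gen[OF y(1)] M(2) by blast
  obtain m t where m: "m \<in> M" and t[simp]: "t \<in> carrier R"
    and ec: "(\<one> \<ominus> r \<otimes> s) \<otimes> c = m \<oplus> t \<otimes> y"
    using rJ[OF c(1)] by (auto simp: adjoin_def)
  have [simp]: "c \<in> carrier R" "m \<in> carrier R" using c m ideal_carr[OF assms(1)] ideal_carr[OF M(1)] by auto
  define e where "e = \<one> \<ominus> r \<otimes> s"
  \<comment> \<open>\<open>e'\<close> kills \<open>y\<close> modulo \<open>M\<close>\<close>
  define e' where "e' = e \<ominus> s \<otimes> t"
  have e[simp]: "e \<in> carrier R" "e' \<in> carrier R" by (simp_all add: e_def e'_def)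
  have e'_eq: "e' = \<one> \<ominus> (r \<oplus> t) \<otimes> s"
    unfolding e'_def e_def using s r t by algebra
  have e'y: "e' \<otimes> y \<in> M"
  proof -
    have "e' \<otimes> y = e \<otimes> (y \<ominus> s \<otimes> c) \<oplus> s \<otimes> (e \<otimes> c \<ominus> t \<otimes> y)"
      unfolding e'_def using s t yc e(1) \<open>c \<in> carrier R\<close> by algebra
    also have "e \<otimes> c \<ominus> t \<otimes> y = m"
      unfolding e_def ec using t yc \<open>m \<in> carrier R\<close> by algebra
    finally show ?thesis using c(2) m by (simp add: ideal_smult[OF M(1)] ideal_add[OF M(1)])
  qed
  \<comment> \<open>chosen such that \<open>(1 - (r + t) s) (1 - r s) = 1 - q s\<close>\<close>
  define q where "q = (r \<oplus> t) \<oplus> r \<ominus> (r \<oplus> t) \<otimes> r \<otimes> s"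
  have q: "q \<in> carrier R" by (simp add: q_def)
  have rt: "r \<oplus> t \<in> carrier R" by simp
  have e'e: "e' \<otimes> e = \<one> \<ominus> q \<otimes> s"
    unfolding q_def e'_eq e_def using s r rt by algebra
  obtain b where b: "b \<in> B" "(\<one> \<ominus> q \<otimes> s) \<otimes> b \<notin> M" using bad[OF q] by blast
  obtain m' t' where m': "m' \<in> M" and t'[simp]: "t' \<in> carrier R"
    and eb: "e \<otimes> b = m' \<oplus> t' \<otimes> y"
    using rJ[OF b(1)] by (auto simp: adjoin_def e_def)
  have [simp]: "b \<in> carrier R" "m' \<in> carrier R" using b m' ideal_carr[OF assms(1)] ideal_carr[OF M(1)] by auto
  have "(\<one> \<ominus> q \<otimes> s) \<otimes> b = e' \<otimes> (e \<otimes> b)"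
    by (simp add: e'e[symmetric] m_assoc)
  also have "\<dots> = e' \<otimes> m' \<oplus> t' \<otimes> (e' \<otimes> y)"
    unfolding eb using e t' yc \<open>m' \<in> carrier R\<close> by algebra
  also have "\<dots> \<in> M" using m' e'y by (simp add: ideal_smult[OF M(1)] ideal_add[OF M(1)])
  finally show False using b(2) by simp
qed

text \<open>
  An ideal is finitely generated, and the product of multipliers for its generators works for all of
  it. The product stays outside \<open>p\<close> because \<open>p\<close> is prime.
\<close>

lemma uniform_multiplier:
  assumes "ideal B R" "ideal Q R" "primeideal p R"
    and ex: "\<And>x. x \<in> B \<Longrightarrow> \<exists>s\<in>carrier R - p. s \<otimes> x \<in> Q"
  shows "\<exists>s\<in>carrier R - p. \<forall>x\<in>B. s \<otimes> x \<in> Q"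
proof -
  interpret p: primeideal p R by fact
  obtain A where A: "A \<subseteq> carrier R" "finite A" "B = Idl A"
    using finetely_gen assms(1) by blast
  have "\<exists>s\<in>carrier R - p. \<forall>x\<in>A'. s \<otimes> x \<in> Q" if "A' \<subseteq> A" for A'
    using finite_subset[OF that A(2)] that
  proof (induction A')
    case empty
    then show ?case using p.I_notcarr p.a_subset by auto
  next
    case (insert a A')
    then obtain s where s: "s \<in> carrier R - p" "\<forall>x\<in>A'. s \<otimes> x \<in> Q" by auto
    have "a \<in> B" using insert A genideal_self by blast
    then obtain t where t: "t \<in> carrier R - p" "t \<otimes> a \<in> Q" using ex by blast
    have "t \<otimes> s \<otimes> x \<in> Q" if "x \<in> insert a A'" for x
    proof -
      have x: "x \<in> carrier R" using that insert.prems A(1) by blast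
      have "t \<otimes> s \<otimes> x = t \<otimes> (s \<otimes> x)" "t \<otimes> s \<otimes> x = s \<otimes> (t \<otimes> x)"
        using x s t by (auto simp: m_assoc m_lcomm)
      then show ?thesis using that s t ideal_smult[OF assms(2)] by (metis DiffD1 insertE)
    qed
    moreover have "t \<otimes> s \<in> carrier R - p" using s t p.I_prime by auto
    ultimately show ?case by blast
  qed
  then obtain s where s: "s \<in> carrier R - p" "\<forall>x\<in>A. s \<otimes> x \<in> Q" by blast
  have "A \<subseteq> colon Q {s}" using s A(1) by (auto simp: colon_def m_comm[of _ s] subset_iff)
  moreover have "ideal (colon Q {s}) R" using colon_ideal assms(2) s by simp
  ultimately have "B \<subseteq> colon Q {s}" using A(3) genideal_minimal by simp
  then have "\<forall>x\<in>B. s \<otimes> x \<in> Q" using s by (auto simp: colon_def m_comm[of s])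
  with s show ?thesis by blast
qed

end

section \<open>Ideals with bounded chains\<close>

text \<open>
  The length of \<open>I\<close> as an \<open>R\<close>-module is at most \<open>n\<close>; see \<open>finite_length_ideal_iff\<close>.
\<close>

definition (in ring) chains_bounded :: "'a set \<Rightarrow> nat \<Rightarrow> bool" where
  "chains_bounded I n \<longleftrightarrow> (\<forall>m N. (\<forall>i\<le>m. ideal (N i) R \<and> N i \<subseteq> I) \<and> (\<forall>i<m. N i \<subset> N (Suc i)) \<longrightarrow> m \<le> n)"

lemma strict_chain_mono:
  fixes N :: "nat \<Rightarrow> 'a set"
  assumes "\<And>i. i < m \<Longrightarrow> N i \<subset> N (Suc i)" "i \<le> k" "k \<le> m"
  shows "N i \<subseteq> N k"
  using assms(2,3)
proof (induction k rule: dec_induct)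
  case (step k)
  then show ?case using assms(1)[of k] by auto
qed simp

lemma (in cring) chains_bounded_zero: "chains_bounded {\<zero>} 0"
proof -
  have "m = 0" if N: "\<forall>i\<le>m. ideal (N i) R \<and> N i \<subseteq> {\<zero>}" "\<forall>i<m. N i \<subset> N (Suc i)" for m N
  proof (rule ccontr)
    assume "m \<noteq> 0"
    then have "ideal (N 0) R" "N 0 \<subset> N 1" "N 1 \<subseteq> {\<zero>}" using N by auto
    then show False using ideal_zero by blast
  qed
  then show ?thesis by (auto simp: chains_bounded_def)
qed

text \<open>
  If nothing lies strictly between \<open>I\<close> and \<open>J\<close>, then passing to \<open>J\<close> raises the length by at most one.
  Let \<open>N j\<close> be the first member of a chain in \<open>J\<close> that is not contained in \<open>I\<close>. From there on
  \<open>I + N i = J\<close>, so by the modular law the intersections with \<open>I\<close> are still strictly increasing.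
  Replacing \<open>N i\<close> by \<open>N (i + 1) \<inter> I\<close> from index \<open>j\<close> on therefore gives a chain in \<open>I\<close> that is
  shorter by one.
\<close>

lemma (in cring) chains_bounded_cover:
  assumes I: "ideal I R" "I \<subseteq> J" and J: "ideal J R" and bd: "chains_bounded I n"
    and cover: "\<And>L. ideal L R \<Longrightarrow> I \<subseteq> L \<Longrightarrow> L \<subseteq> J \<Longrightarrow> L = I \<or> L = J"
  shows "chains_bounded J (Suc n)"
  unfolding chains_bounded_def
proof (intro allI impI)
  fix m N
  assume "(\<forall>i\<le>m. ideal (N i) R \<and> N i \<subseteq> J) \<and> (\<forall>i<m. N i \<subset> N (Suc i))"
  then have idl: "\<And>i. i \<le> m \<Longrightarrow> ideal (N i) R" and sub: "\<And>i. i \<le> m \<Longrightarrow> N i \<subseteq> J"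
    and strict: "\<And>i. i < m \<Longrightarrow> N i \<subset> N (Suc i)" by auto
  show "m \<le> Suc n"
  proof (cases "\<exists>j\<le>m. \<not> N j \<subseteq> I")
    case False
    then have "\<forall>i\<le>m. ideal (N i) R \<and> N i \<subseteq> I" "\<forall>i<m. N i \<subset> N (Suc i)" using idl strict by auto
    then have "m \<le> n" using bd unfolding chains_bounded_def by (metis (no_types, lifting))
    then show ?thesis by simp
  next
    case True
    define j where "j = (LEAST j. j \<le> m \<and> \<not> N j \<subseteq> I)"
    have j: "j \<le> m" "\<not> N j \<subseteq> I"
      using LeastI_ex[of "\<lambda>j. j \<le> m \<and> \<not> N j \<subseteq> I"] True by (auto simp: j_def)
    have below: "N i \<subseteq> I" if "i < j" for i
      using not_less_Least[of i "\<lambda>j. j \<le> m \<and> \<not> N j \<subseteq> I"] that j(1) by (auto simp: j_def)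
    \<comment> \<open>the modular law: elements of \<open>N (i + 1)\<close> decompose along \<open>J = I + N i\<close>\<close>
    have step: "N i \<inter> I \<subset> N (Suc i) \<inter> I" if i: "j \<le> i" "i < m" for i
    proof -
      have Ni: "ideal (N i) R" "ideal (N (Suc i)) R" using idl i by auto
      have notI: "\<not> N i \<subseteq> I" using strict_chain_mono[of m N j i] strict i j(2) by auto
      define L where "L = set_add R I (N i)"
      have L: "ideal L R" unfolding L_def using add_ideals I(1) Ni(1) by blast
      have "x \<in> L" if "x \<in> I" for x
      proof -
        have "x = x \<oplus> \<zero>" using ideal_carr[OF I(1) that] by simp
        then show ?thesis using that ideal_zero[OF Ni(1)] unfolding L_def set_add_def' by blast
      qed
      moreover have "x \<in> L" if "x \<in> N i" for x
      proof -
        have "x = \<zero> \<oplus> x" using ideal_carr[OF Ni(1) that] by simp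
        then show ?thesis using that ideal_zero[OF I(1)] unfolding L_def set_add_def' by blast
      qed
      moreover have "L \<subseteq> J"
        using ideal_add[OF J] I(2) sub[of i] i by (auto simp: L_def set_add_def')
      ultimately have JL: "J \<subseteq> L" using cover[OF L] notI by blast
      obtain y where y: "y \<in> N (Suc i)" "y \<notin> N i" using strict[OF i(2)] by blast
      then have "y \<in> L" using JL sub[of "Suc i"] i by auto
      then obtain a b where ab: "a \<in> I" "b \<in> N i" "y = a \<oplus> b" unfolding L_def set_add_def' by blast
      have abc: "a \<in> carrier R" "b \<in> carrier R"
        using ab ideal_carr[OF I(1)] ideal_carr[OF Ni(1)] by auto
      have "a = y \<ominus> b" unfolding ab(3) using abc by algebra
      moreover have "b \<in> N (Suc i)" using ab(2) strict[OF i(2)] by blast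
      ultimately have "a \<in> N (Suc i)" using ideal_minus[OF Ni(2)] y(1) by simp
      moreover have "a \<notin> N i" using y(2) ab ideal_add[OF Ni(1)] by blast
      ultimately show ?thesis using ab(1) strict[OF i(2)] by blast
    qed
    define N' where "N' i = (if i < j then N i else N (Suc i) \<inter> I)" for i
    have "m - 1 \<le> n"
    proof (cases m)
      case (Suc k)
      have "ideal (N' i) R \<and> N' i \<subseteq> I" if "i \<le> k" for i
        using that Suc idl I(1) below i_intersect by (auto simp: N'_def)
      moreover have "N' i \<subset> N' (Suc i)" if i: "i < k" for i
      proof -
        consider "Suc i < j" | "Suc i = j" | "j \<le> i" by linarith
        then show ?thesis
        proof cases
          case 1
          then show ?thesis using strict Suc i by (simp add: N'_def)
        next
          case 2
          then have "N i = N i \<inter> I" using below[of i] by auto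
          moreover have "N i \<inter> I \<subseteq> N (Suc i) \<inter> I" using strict[of i] Suc i by auto
          moreover have "N (Suc i) \<inter> I \<subset> N (Suc (Suc i)) \<inter> I" using step[of "Suc i"] 2 i Suc by simp
          ultimately show ?thesis using 2 by (auto simp: N'_def)
        next
          case 3
          then show ?thesis using step[of "Suc i"] i Suc by (simp add: N'_def)
        qed
      qed
      ultimately have "k \<le> n" using bd unfolding chains_bounded_def by blast
      then show ?thesis using Suc by simp
    qed simp
    then show ?thesis by simp
  qed
qed

text \<open>
  A descending sequence that never stabilizes has strictly descending subsequences, and one of length
  \<open>n + 1\<close>, read backwards, is too long a chain.
\<close>

lemma (in cring) chains_bounded_dcc:
  assumes bd: "chains_bounded I n" and idl: "\<And>k. ideal (J k) R" "\<And>k. J k \<subseteq> I"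
    and dec: "\<And>k. J (Suc k) \<subseteq> J k"
  shows "\<exists>k0. \<forall>k\<ge>k0. J k = J k0"
proof (rule ccontr)
  assume "\<not> ?thesis"
  then have ex: "\<exists>k\<ge>k0. J k \<noteq> J k0" for k0 by blast
  have anti: "J l \<subseteq> J k" if "k \<le> l" for k l
    using lift_Suc_antimono_le[of J, OF dec that] .
  obtain g where g: "\<And>k. k \<le> g k" "\<And>k. J (g k) \<noteq> J k" using ex by metis
  have strict: "J (g k) \<subset> J k" for k using anti[OF g(1)] g(2) by blast
  \<comment> \<open>indices run backwards, so that the chain ascends\<close>
  define N where "N i = J ((g ^^ (Suc n - i)) 0)" for i
  have "N i \<subset> N (Suc i)" if "i < Suc n" for i
  proof -
    have "Suc n - i = Suc (Suc n - Suc i)" using that by simp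
    then have "(g ^^ (Suc n - i)) 0 = g ((g ^^ (Suc n - Suc i)) 0)" by (metis funpow.simps(2) o_apply)
    then show ?thesis using strict by (simp add: N_def)
  qed
  moreover have "ideal (N i) R \<and> N i \<subseteq> I" for i using idl by (simp add: N_def)
  ultimately have "Suc n \<le> n"
    using bd[unfolded chains_bounded_def, rule_format, of "Suc n" N] by blast
  then show False by simp
qed

lemma (in cring) ideal_as_module_is_module:
  assumes I: "ideal I R"
  shows "module R (ideal_as_module R I)"
proof -
  have carr: "x \<in> carrier R" if "x \<in> I" for x using ideal_carr[OF I that] .
  have inv: "\<ominus> x \<in> I" if "x \<in> I" for x
    using ideal_minus[OF I ideal_zero[OF I] that] carr[OF that] by (simp add: a_minus_def)
  note sim = ideal_as_module_def ring_as_module_def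
  have "abelian_group (ideal_as_module R I)"
  proof (rule abelian_groupI)
    fix x assume "x \<in> carrier (ideal_as_module R I)"
    then have "x \<in> I" by (simp add: sim)
    then show "\<exists>y\<in>carrier (ideal_as_module R I). y \<oplus>\<^bsub>ideal_as_module R I\<^esub> x = \<zero>\<^bsub>ideal_as_module R I\<^esub>"
      using inv[of x] carr[of x] by (intro bexI[of _ "\<ominus> x"]) (auto simp: sim l_neg)
  qed (auto simp: ideal_as_module_def ring_as_module_def ideal_zero[OF I] ideal_add[OF I] ideal_carr[OF I] a_ac)
  moreover have "cring R" by unfold_locales
  ultimately show ?thesis
    by (intro moduleI) (auto simp: sim ideal_smult[OF I] carr l_distr r_distr m_assoc)
qed

lemma (in cring) submodule_ideal_as_module_iff:
  assumes I: "ideal I R"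
  shows "submodule R N (ideal_as_module R I) \<longleftrightarrow> ideal N R \<and> N \<subseteq> I"
proof
  assume "submodule R N (ideal_as_module R I)"
  then interpret submodule R N "ideal_as_module R I" .
  have NI: "N \<subseteq> I" using subset by (simp add: ideal_as_module_def)
  have "ideal N R"
  proof (rule cring_idealI)
    show "N \<subseteq> carrier R" using NI ideal_subset[OF I] by blast
    show "\<zero> \<in> N" using zero_closed by (simp add: ideal_as_module_def ring_as_module_def)
    show "a \<oplus> b \<in> N" if "a \<in> N" "b \<in> N" for a b
      using m_closed[OF that] by (simp add: ideal_as_module_def ring_as_module_def)
    show "r \<otimes> a \<in> N" if "r \<in> carrier R" "a \<in> N" for r a
      using smult_closed[OF that] by (simp add: ideal_as_module_def ring_as_module_def)
  qed
  with NI show "ideal N R \<and> N \<subseteq> I" by blast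
next
  assume N: "ideal N R \<and> N \<subseteq> I"
  then show "submodule R N (ideal_as_module R I)"
    using ideal_as_module_is_module[OF I] ideal_zero[of N R] ideal_add[of N R] ideal_smult[of N R]
    by (intro submodule.intro) (auto simp: ideal_as_module_def ring_as_module_def)
qed

lemma (in cring) finite_length_ideal_iff:
  assumes I: "ideal I R"
  shows "finite_length R (ideal_as_module R I) \<longleftrightarrow> (\<exists>n. chains_bounded I n)"
proof -
  define P where "P m \<longleftrightarrow> (\<exists>N. (\<forall>i\<le>m. ideal (N i) R \<and> N i \<subseteq> I) \<and> (\<forall>i<m. N i \<subset> N (Suc i)))" for m
  have "module_length R (ideal_as_module R I) = Sup {enat m | m. P m}"
    unfolding module_length_def submodule_ideal_as_module_iff[OF I] P_def ..
  moreover have "x < \<infinity> \<longleftrightarrow> (\<exists>n. x \<le> enat n)" for x by (cases x) auto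
  moreover have "chains_bounded I n \<longleftrightarrow> Sup {enat m | m. P m} \<le> enat n" for n
  proof -
    have "chains_bounded I n \<longleftrightarrow> (\<forall>m. P m \<longrightarrow> m \<le> n)"
      unfolding chains_bounded_def P_def by blast
    also have "\<dots> \<longleftrightarrow> (\<forall>a\<in>{enat m | m. P m}. a \<le> enat n)" by auto
    finally show ?thesis unfolding Sup_le_iff .
  qed
  ultimately show ?thesis by (simp add: finite_length_def)
qed

section \<open>Multipliers outside the minimal prime\<close>

lemma (in primeideal) pow_notin:
  assumes "s \<in> carrier R - I"
  shows "s [^] (n::nat) \<in> carrier R - I"
proof (induction n)
  case 0
  have "\<one> \<notin> I" using one_imp_carrier I_notcarr by blast
  then show ?case by simp
next
  case (Suc n)
  then show ?case using assms I_prime[of "s [^] n" s] by auto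
qed

text \<open>
  Together with the next lemma: a surjective homomorphism from \<open>I\<close> to \<open>J\<close> maps \<open>Q I\<close> onto \<open>Q J\<close>. This is
  what makes the submodule \<open>Q I\<close> an isomorphism invariant of \<open>I\<close>.
\<close>

lemma (in cring) surj_hom_ideal_prod_preimage:
  assumes I: "ideal I R" and Q: "ideal Q R"
    and f: "f \<in> module_hom R (ideal_as_module R I) (ideal_as_module R J)"
    and surj: "f ` I = J" and z: "z \<in> Q \<cdot> J"
  shows "\<exists>w\<in>Q \<cdot> I. f w = z"
  using z
proof (induction rule: ideal_prod.induct)
  case (prod i j)
  then obtain j0 where j0: "j0 \<in> I" "j = f j0" using surj by blast
  have "f (i \<otimes> j0) = i \<otimes> f j0"
    using f j0 ideal_carr[OF Q prod(1)]
    by (simp add: module_hom_def ideal_as_module_def ring_as_module_def)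
  then show ?case using ideal_prod.prod[OF prod(1) j0(1), of R] j0(2) by blast
next
  case (sum z1 z2)
  then obtain w1 w2 where w: "w1 \<in> Q \<cdot> I" "f w1 = z1" "w2 \<in> Q \<cdot> I" "f w2 = z2" by blast
  have "Q \<cdot> I \<subseteq> I" using ideal_prod_inter[OF Q I] by blast
  then have "f (w1 \<oplus> w2) = z1 \<oplus> z2"
    using f w by (simp add: subset_iff module_hom_def ideal_as_module_def ring_as_module_def)
  then show ?case using ideal_prod.sum[OF w(1,3)] by blast
qed

lemma (in cring) hom_image_ideal_prod:
  assumes I: "ideal I R" and Q: "ideal Q R"
    and f: "f \<in> module_hom R (ideal_as_module R I) (ideal_as_module R J)"
    and z: "z \<in> Q \<cdot> I"
  shows "f z \<in> Q \<cdot> J"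
  using z
proof (induction rule: ideal_prod.induct)
  case (prod i j)
  have "f j \<in> J" "f (i \<otimes> j) = i \<otimes> f j"
    using f prod ideal_carr[OF Q prod(1)]
    by (auto simp: module_hom_def ideal_as_module_def ring_as_module_def)
  then show ?case using ideal_prod.prod[OF prod(1), of "f j" J R] by simp
next
  case (sum z1 z2)
  have "Q \<cdot> I \<subseteq> I" using ideal_prod_inter[OF Q I] by blast
  then have "f (z1 \<oplus> z2) = f z1 \<oplus> f z2"
    using f sum by (simp add: subset_iff module_hom_def ideal_as_module_def ring_as_module_def)
  then show ?case using ideal_prod.sum[OF sum(3,4)] by simp
qed

lemma (in cring) ideal_prod_adjoin_decomp:
  assumes Q: "ideal Q R" and t: "t \<in> carrier R" and z: "z \<in> Q \<cdot> adjoin Q t"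
  shows "\<exists>a\<in>Q \<cdot> Q. \<exists>x\<in>Q. z = a \<oplus> t \<otimes> x"
  using z
proof (induction rule: ideal_prod.induct)
  case (prod i j)
  then obtain m r where j: "m \<in> Q" "r \<in> carrier R" "j = m \<oplus> r \<otimes> t" by (auto simp: adjoin_def)
  have c: "i \<in> carrier R" "m \<in> carrier R" using prod(1) j(1) ideal_carr[OF Q] by auto
  have "i \<otimes> j = i \<otimes> m \<oplus> t \<otimes> (r \<otimes> i)" unfolding j(3) using c t j(2) by algebra
  then show ?case using ideal_prod.prod[OF prod(1) j(1), of R] ideal_smult[OF Q j(2) prod(1)] by blast
next
  case (sum z1 z2)
  then obtain a x b y where *: "a \<in> Q \<cdot> Q" "x \<in> Q" "z1 = a \<oplus> t \<otimes> x" "b \<in> Q \<cdot> Q" "y \<in> Q" "z2 = b \<oplus> t \<otimes> y"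
    by blast
  have c: "a \<in> carrier R" "b \<in> carrier R" "x \<in> carrier R" "y \<in> carrier R"
    using * ideal_carr[OF Q] ideal_prod_in_carrier[OF Q Q] by auto
  have "z1 \<oplus> z2 = (a \<oplus> b) \<oplus> t \<otimes> (x \<oplus> y)" unfolding *(3,6) using c t by algebra
  then show ?case using ideal_prod.sum[OF *(1,4)] ideal_add[OF Q *(2,5)] by blast
qed

text \<open>
  What Krull dimension one with a unique minimal prime \<open>p\<close> provides: \<open>p\<close> is the least prime, all
  other primes are maximal, and \<open>p\<close> itself is not. The last fact is recorded by an element \<open>s\<close> that is
  neither zero nor a unit modulo \<open>p\<close>. Lemma names say that \<open>p\<close> is killed if some element outside \<open>p\<close>
  annihilates \<open>p\<close>.
\<close>

locale one_dim_unique_minimal_prime = noetherian_cring R for R (structure) +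
  fixes p
  assumes p_prime: "primeideal p R"
    and p_least: "primeideal q R \<Longrightarrow> p \<subseteq> q"
    and other_maximal: "primeideal q R \<Longrightarrow> q \<noteq> p \<Longrightarrow> maximalideal q R"
    and ex_nonunit: "\<exists>s\<in>carrier R - p. \<forall>r\<in>carrier R. \<one> \<ominus> r \<otimes> s \<notin> p"
begin

lemma p_ideal: "ideal p R"
  using p_prime by (rule primeideal.axioms(1))

lemma p_carr: "x \<in> p \<Longrightarrow> x \<in> carrier R"
  by (rule ideal_carr[OF p_ideal])

lemma notin_p_mult: "a \<in> carrier R - p \<Longrightarrow> b \<in> carrier R - p \<Longrightarrow> a \<otimes> b \<in> carrier R - p"
  using primeideal.I_prime[OF p_prime] by auto

lemma one_notin_p: "\<one> \<in> carrier R - p"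
  using ideal.one_imp_carrier[OF p_ideal] primeideal.I_notcarr[OF p_prime] by auto

text \<open>
  Let \<open>s\<close> be a nonunit modulo \<open>p\<close>, not in \<open>p\<close>. For \<open>x \<in> p\<close> the ideals \<open>(s\<^sup>k x)\<close> descend inside \<open>p\<close>
  and stabilize, so \<open>s\<^sup>k x = r s\<^sup>k\<^sup>+\<^sup>1 x\<close> for some \<open>k\<close> and \<open>r\<close>. Then \<open>(1 - r s) s\<^sup>k\<close> kills \<open>x\<close>, and it lies
  outside \<open>p\<close>.
\<close>

lemma p_killed_if_chains_bounded:
  assumes bd: "chains_bounded p n"
  shows "\<exists>s\<in>carrier R - p. \<forall>x\<in>p. s \<otimes> x = \<zero>"
proof -
  obtain s where s: "s \<in> carrier R - p" "\<And>r. r \<in> carrier R \<Longrightarrow> \<one> \<ominus> r \<otimes> s \<notin> p"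
    using ex_nonunit by blast
  have sc[simp]: "s \<in> carrier R" using s by simp
  have "\<exists>u\<in>carrier R - p. u \<otimes> x \<in> {\<zero>}" if x: "x \<in> p" for x
  proof -
    have xc[simp]: "x \<in> carrier R" using ideal_carr[OF p_ideal x] .
    define J where "J k = PIdl (s [^] (k::nat) \<otimes> x)" for k
    have mem: "s [^] k \<otimes> x \<in> J k" for k unfolding J_def by (simp add: cgenideal_self)
    have idl: "ideal (J k) R" for k by (simp add: J_def cgenideal_ideal)
    have "J k \<subseteq> p" for k
      unfolding J_def by (intro cgenideal_minimal p_ideal ideal_smult[OF p_ideal] x) simp
    moreover have "J (Suc k) \<subseteq> J k" for k
    proof -
      have "s [^] Suc k \<otimes> x = s \<otimes> (s [^] k \<otimes> x)" by (simp add: m_assoc m_lcomm)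
      then have "s [^] Suc k \<otimes> x \<in> J k" using ideal_smult[OF idl sc mem] by simp
      then show ?thesis unfolding J_def[of "Suc k"] by (rule cgenideal_minimal[OF idl])
    qed
    ultimately obtain k where "J (Suc k) = J k"
      using chains_bounded_dcc[OF bd, of J] idl by (metis le_SucI order_refl)
    then have "s [^] k \<otimes> x \<in> J (Suc k)" using mem[of k] by simp
    then obtain r where r[simp]: "r \<in> carrier R" and eq: "s [^] k \<otimes> x = r \<otimes> (s [^] Suc k \<otimes> x)"
      by (auto simp: J_def cgenideal_def)
    define e where "e = s [^] k"
    have ec[simp]: "e \<in> carrier R" by (simp add: e_def)
    have eq': "e \<otimes> x = r \<otimes> (e \<otimes> s \<otimes> x)" using eq by (simp add: e_def)
    have "((\<one> \<ominus> r \<otimes> s) \<otimes> e) \<otimes> x = e \<otimes> x \<ominus> r \<otimes> (e \<otimes> s \<otimes> x)"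
      using r sc ec xc by algebra
    also have "\<dots> = \<zero>" unfolding eq'[symmetric] by (simp add: r_neg a_minus_def)
    finally have "((\<one> \<ominus> r \<otimes> s) \<otimes> e) \<otimes> x \<in> {\<zero>}" by simp
    moreover have "(\<one> \<ominus> r \<otimes> s) \<otimes> e \<in> carrier R - p"
      unfolding e_def using s(2)[OF r] primeideal.pow_notin[OF p_prime s(1)] by (intro notin_p_mult) auto
    ultimately show ?thesis by blast
  qed
  then have "\<exists>s\<in>carrier R - p. \<forall>x\<in>p. s \<otimes> x \<in> {\<zero>}"
    by (rule uniform_multiplier[OF p_ideal zeroideal p_prime])
  then show ?thesis by blast
qed

text \<open>
  Take \<open>M \<subseteq> p\<close> maximal among the ideals of finite length and suppose that \<open>M \<noteq> p\<close>. An associated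
  prime \<open>(M : x)\<close> of \<open>p/M\<close> contains the element \<open>s\<close> that kills \<open>p\<close>. So it differs from \<open>p\<close>, hence is
  maximal, and \<open>M + (x)\<close> covers \<open>M\<close>. Thus \<open>M + (x)\<close> still has finite length, against the choice of \<open>M\<close>.
\<close>

lemma chains_bounded_if_p_killed:
  assumes s: "s \<in> carrier R - p" "\<And>x. x \<in> p \<Longrightarrow> s \<otimes> x = \<zero>"
  shows "\<exists>n. chains_bounded p n"
proof -
  define F where "F = {I. ideal I R \<and> I \<subseteq> p \<and> (\<exists>n. chains_bounded I n)}"
  have "{\<zero>} \<in> F" using zeroideal chains_bounded_zero ideal_zero[OF p_ideal] by (auto simp: F_def)
  then have "F \<noteq> {}" by blast
  moreover have "ideal J R" if "J \<in> F" for J using that by (simp add: F_def)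
  ultimately obtain M where MF: "M \<in> F" and max: "\<And>J. J \<in> F \<Longrightarrow> M \<subseteq> J \<Longrightarrow> J = M"
    using ex_maximal_ideal_in by blast
  then obtain n where M: "ideal M R" "M \<subseteq> p" "chains_bounded M n" by (auto simp: F_def)
  have "M = p"
  proof (rule ccontr)
    assume "M \<noteq> p"
    then obtain x where x: "x \<in> p" "x \<notin> M" "primeideal (colon M {x}) R"
      using ex_associated_prime[OF M(1) p_ideal] M(2) by blast
    have xc: "x \<in> carrier R" using ideal_carr[OF p_ideal x(1)] .
    have "s \<in> colon M {x}" using s x(1) ideal_zero[OF M(1)] by (simp add: colon_def)
    then have "maximalideal (colon M {x}) R" using other_maximal[OF x(3)] s(1) by blast
    then have "chains_bounded (adjoin M x) (Suc n)"
      using chains_bounded_cover[OF M(1) adjoin_ideal(2,1)[OF M(1) xc] M(3)]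
        cover_of_maximal_colon[OF M(1) xc] by blast
    moreover have "adjoin M x \<subseteq> p" using adjoin_subset[OF p_ideal M(2) x(1)] .
    ultimately have "adjoin M x \<in> F" using adjoin_ideal(1)[OF M(1) xc] by (auto simp: F_def)
    then show False using max adjoin_ideal(2,3)[OF M(1) xc] x(2) by blast
  qed
  then show ?thesis using M(3) by blast
qed

text \<open>
  Let \<open>s p \<subseteq> p\<^sup>2\<close>, let \<open>N\<close> be the ideal of all elements killed from outside \<open>p\<close> and let \<open>A = (N : p)\<close>. If \<open>w p \<subseteq> A\<close>, then
  \<open>w p\<^sup>2 \<subseteq> N\<close>, hence \<open>s w p \<subseteq> N\<close> and \<open>w p \<subseteq> N\<close>; so \<open>(A : p) = A\<close>. Were \<open>A\<close> a proper ideal, some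
  associated prime \<open>(A : x)\<close> of \<open>R/A\<close> would contain the least prime \<open>p\<close>, which puts the class of \<open>x\<close>,
  chosen to be nonzero, into \<open>(A : p)/A = 0\<close>. So \<open>A = R\<close>, which says that \<open>p \<subseteq> N\<close>.
\<close>

lemma p_killed_if_killed_mod_square:
  assumes s: "s \<in> carrier R - p" "\<And>x. x \<in> p \<Longrightarrow> s \<otimes> x \<in> p \<cdot> p"
  shows "\<exists>s\<in>carrier R - p. \<forall>x\<in>p. s \<otimes> x = \<zero>"
proof -
  define N where "N = {x \<in> carrier R. \<exists>u\<in>carrier R - p. u \<otimes> x = \<zero>}"
  have N: "ideal N R"
  proof (rule cring_idealI)
    show "N \<subseteq> carrier R" "\<zero> \<in> N" using one_notin_p by (auto simp: N_def)
    fix a assume "a \<in> N"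
    then obtain u where u: "a \<in> carrier R" "u \<in> carrier R - p" "u \<otimes> a = \<zero>" by (auto simp: N_def)
    show "r \<otimes> a \<in> N" if "r \<in> carrier R" for r
    proof -
      have "u \<otimes> (r \<otimes> a) = r \<otimes> (u \<otimes> a)" using u that by (simp add: m_lcomm)
      then show ?thesis using u that by (auto simp: N_def)
    qed
    fix b assume "b \<in> N"
    then obtain v where v: "b \<in> carrier R" "v \<in> carrier R - p" "v \<otimes> b = \<zero>" by (auto simp: N_def)
    have c: "u \<in> carrier R" "v \<in> carrier R" using u v by auto
    have "(u \<otimes> v) \<otimes> (a \<oplus> b) = v \<otimes> (u \<otimes> a) \<oplus> u \<otimes> (v \<otimes> b)"
      using c u(1) v(1) by algebra
    then have "(u \<otimes> v) \<otimes> (a \<oplus> b) = \<zero>" using u v by simp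
    then show "a \<oplus> b \<in> N" using u v notin_p_mult[OF u(2) v(2)] by (auto simp: N_def)
  qed
  have N_sat: "x \<in> N" if "u \<in> carrier R - p" "u \<otimes> x \<in> N" "x \<in> carrier R" for u x
  proof -
    obtain v where v: "v \<in> carrier R - p" "v \<otimes> (u \<otimes> x) = \<zero>" using \<open>u \<otimes> x \<in> N\<close> by (auto simp: N_def)
    then have "(v \<otimes> u) \<otimes> x = \<zero>" using that by (simp add: m_assoc)
    then show ?thesis using notin_p_mult[OF v(1) that(1)] that(3) by (auto simp: N_def)
  qed
  define A where "A = colon N p"
  have A: "ideal A R" unfolding A_def using colon_ideal[OF N ideal_subset[OF p_ideal]] .
  have A_sat: "w \<in> A" if w: "w \<in> carrier R" "\<And>y. y \<in> p \<Longrightarrow> w \<otimes> y \<in> A" for w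
  proof -
    have prod: "w \<otimes> z \<in> N" if "z \<in> p \<cdot> p" for z
      using that
    proof (induction rule: ideal_prod.induct)
      case (prod i j)
      have "(w \<otimes> i) \<otimes> j \<in> N" using w(2)[OF prod(1)] prod(2) by (simp add: A_def colon_def)
      then show ?case using w(1) prod p_carr by (simp add: m_assoc)
    next
      case (sum z1 z2)
      then have "z1 \<in> carrier R" "z2 \<in> carrier R" using ideal_prod_in_carrier[OF p_ideal p_ideal] by auto
      then show ?case using sum ideal_add[OF N] w(1) by (simp add: r_distr)
    qed
    have "w \<otimes> y \<in> N" if y: "y \<in> p" for y
    proof (rule N_sat[OF s(1)])
      have "s \<otimes> (w \<otimes> y) = w \<otimes> (s \<otimes> y)" using w(1) p_carr[OF y] s(1) by (simp add: m_lcomm)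
      then show "s \<otimes> (w \<otimes> y) \<in> N" using prod[OF s(2)[OF y]] by simp
      show "w \<otimes> y \<in> carrier R" using w(1) p_carr[OF y] by simp
    qed
    then show ?thesis using w(1) by (simp add: A_def colon_def)
  qed
  have "A = carrier R"
  proof (rule ccontr)
    assume "A \<noteq> carrier R"
    then have "A \<subset> carrier R" using ideal_subset[OF A] by blast
    then obtain x where x: "x \<in> carrier R" "x \<notin> A" "primeideal (colon A {x}) R"
      using ex_associated_prime[OF A oneideal] by blast
    have "x \<otimes> y \<in> A" if y: "y \<in> p" for y
      using p_least[OF x(3)] y x(1) p_carr[OF y] by (auto simp: colon_def m_comm)
    then show False using A_sat x by blast
  qed
  then have "\<one> \<in> A" by simp
  then have "x \<in> N" if "x \<in> p" for x
    using that p_carr[OF that] by (auto simp: A_def colon_def)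
  then have "\<exists>u\<in>carrier R - p. u \<otimes> x \<in> {\<zero>}" if "x \<in> p" for x
    using that by (auto simp: N_def)
  then have "\<exists>s\<in>carrier R - p. \<forall>x\<in>p. s \<otimes> x \<in> {\<zero>}"
    by (rule uniform_multiplier[OF p_ideal zeroideal p_prime])
  then show ?thesis by blast
qed

text \<open>
  Let \<open>s\<close> be a nonunit modulo \<open>p\<close>, not in \<open>p\<close>, and consider the descending ideals \<open>I k = p + (s\<^sup>k)\<close>. The
  torsion part of \<open>I k / p (I k)\<close> over \<open>R/p\<close> is \<open>p / p (I k)\<close>, and \<open>s\<^sup>k\<close> kills it because
  \<open>s\<^sup>k p \<subseteq> p (I k)\<close>. An isomorphism between \<open>I (n + 1)\<close> and \<open>I n\<close> therefore makes \<open>s\<^sup>n\<close> kill the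
  torsion part for \<open>n + 1\<close> as well, that is, \<open>s\<^sup>n p \<subseteq> p (I (n + 1)) = p\<^sup>2 + s\<^sup>n\<^sup>+\<^sup>1 p\<close>. Nakayama's lemma for
  \<open>B = s\<^sup>n p\<close> modulo \<open>p\<^sup>2\<close> gives \<open>(1 - r s) s\<^sup>n p \<subseteq> p\<^sup>2\<close>.
\<close>

lemma p_killed_mod_square_if_iso_artinian:
  assumes "iso_artinian R"
  shows "\<exists>s\<in>carrier R - p. \<forall>x\<in>p. s \<otimes> x \<in> p \<cdot> p"
proof -
  have pp: "ideal (p \<cdot> p) R" using ideal_prod_is_ideal p_ideal by blast
  obtain s where s: "s \<in> carrier R - p" "\<And>r. r \<in> carrier R \<Longrightarrow> \<one> \<ominus> r \<otimes> s \<notin> p"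
    using ex_nonunit by blast
  have sc[simp]: "s \<in> carrier R" using s by simp
  define I where "I k = adjoin p (s [^] (k::nat))" for k
  have I: "ideal (I k) R" "p \<subseteq> I k" "s [^] k \<in> I k" for k
    unfolding I_def using adjoin_ideal[OF p_ideal, of "s [^] k"] by auto
  have "I (Suc k) \<subseteq> I k" for k
    unfolding I_def[of "Suc k"]
    using adjoin_subset[OF I(1) I(2)] ideal_smult'[OF I(1) sc I(3)[of k]] by simp
  then obtain n where "\<And>k. k \<ge> n \<Longrightarrow> module_isomorphic R (ideal_as_module R (I k)) (ideal_as_module R (I n))"
    using assms I(1) unfolding iso_artinian_def by blast
  then have "module_isomorphic R (ideal_as_module R (I (Suc n))) (ideal_as_module R (I n))" by simp
  then obtain f where f: "f \<in> module_hom R (ideal_as_module R (I (Suc n))) (ideal_as_module R (I n))"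
    and bij: "bij_betw f (I (Suc n)) (I n)"
    by (auto simp: module_isomorphic_def ideal_as_module_def)
  have f_smult: "f (r \<otimes> x) = r \<otimes> f x" if "r \<in> carrier R" "x \<in> I (Suc n)" for r x
    using f that by (simp add: module_hom_def ideal_as_module_def ring_as_module_def)
  define e where "e = s [^] n"
  have e: "e \<in> carrier R - p" "e \<in> I n" unfolding e_def using primeideal.pow_notin[OF p_prime s(1)] I(3) by auto
  have ec[simp]: "e \<in> carrier R" using e by simp
  have e': "e \<otimes> s \<in> I (Suc n)" "e \<otimes> s \<in> carrier R - p"
    unfolding e_def using I(3)[of "Suc n"] primeideal.pow_notin[OF p_prime s(1), of "Suc n"] by auto
  have ISuc: "I (Suc n) = adjoin p (e \<otimes> s)" by (simp add: I_def e_def)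
  \<comment> \<open>\<open>f y\<close> lies in \<open>p\<close> because \<open>s\<^sup>n\<^sup>+\<^sup>1 (f y)\<close> does; hence \<open>s\<^sup>n (f y) \<in> p (I n)\<close>, and \<open>f\<close> carries this back\<close>
  have key: "e \<otimes> y \<in> p \<cdot> I (Suc n)" if y: "y \<in> p" for y
  proof -
    have yI: "y \<in> I (Suc n)" and yc[simp]: "y \<in> carrier R" using y I(2) p_carr by auto
    have fyc: "f y \<in> I n" using bij yI by (auto simp: bij_betw_def)
    then have fyc': "f y \<in> carrier R" using ideal_carr[OF I(1)] by blast
    have "y \<otimes> (e \<otimes> s) \<in> p \<cdot> I (Suc n)" using ideal_prod.prod[OF y e'(1)] .
    then have "f (y \<otimes> (e \<otimes> s)) \<in> p \<cdot> I n" using hom_image_ideal_prod[OF I(1) p_ideal f] by blast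
    moreover have "f (y \<otimes> (e \<otimes> s)) = (e \<otimes> s) \<otimes> f y" using f_smult[of "e \<otimes> s" y] yI by (simp add: m_comm)
    ultimately have "(e \<otimes> s) \<otimes> f y \<in> p" using ideal_prod_inter[OF p_ideal I(1)] by auto
    then have fyp: "f y \<in> p" using primeideal.I_prime[OF p_prime _ fyc'] e'(2) by blast
    have "f y \<otimes> e \<in> p \<cdot> I n" using ideal_prod.prod[OF fyp e(2)] .
    moreover have "f y \<otimes> e = f (e \<otimes> y)" using f_smult[OF ec yI] fyc' by (simp add: m_comm)
    ultimately obtain w where w: "w \<in> p \<cdot> I (Suc n)" "f w = f (e \<otimes> y)"
      using surj_hom_ideal_prod_preimage[OF I(1) p_ideal f] bij by (metis bij_betw_imp_surj_on)
    moreover have "w \<in> I (Suc n)" "e \<otimes> y \<in> I (Suc n)"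
      using w ideal_prod_inter[OF p_ideal I(1)] ideal_smult[OF I(1) ec yI] by auto
    ultimately show ?thesis using bij by (metis bij_betw_def inj_onD)
  qed
  \<comment> \<open>\<open>e\<close> is \<open>s\<^sup>n\<close>, so \<open>key\<close> says that \<open>B\<close> is contained in \<open>p\<^sup>2 + s B\<close>\<close>
  define B where "B = (\<lambda>x. e \<otimes> x) ` p"
  have B: "ideal B R"
  proof (rule cring_idealI)
    show "B \<subseteq> carrier R" using p_carr by (auto simp: B_def)
    show "\<zero> \<in> B" using ideal_zero[OF p_ideal] by (force simp: B_def)
    fix a assume "a \<in> B"
    then obtain x where x: "x \<in> p" "a = e \<otimes> x" by (auto simp: B_def)
    show "r \<otimes> a \<in> B" if "r \<in> carrier R" for r
    proof -
      have "r \<otimes> a = e \<otimes> (r \<otimes> x)" using x that p_carr by (simp add: m_lcomm)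
      then show ?thesis using ideal_smult[OF p_ideal that x(1)] by (simp add: B_def)
    qed
    fix b assume "b \<in> B"
    then obtain y where y: "y \<in> p" "b = e \<otimes> y" by (auto simp: B_def)
    have "a \<oplus> b = e \<otimes> (x \<oplus> y)" using x y p_carr by (simp add: r_distr)
    then show "a \<oplus> b \<in> B" using ideal_add[OF p_ideal x(1) y(1)] by (simp add: B_def)
  qed
  have "\<exists>c\<in>B. b \<ominus> s \<otimes> c \<in> p \<cdot> p" if "b \<in> B" for b
  proof -
    obtain y where y: "y \<in> p" "b = e \<otimes> y" using \<open>b \<in> B\<close> by (auto simp: B_def)
    obtain a x where ax: "a \<in> p \<cdot> p" "x \<in> p" "b = a \<oplus> (e \<otimes> s) \<otimes> x"
      using ideal_prod_adjoin_decomp[OF p_ideal _ key[OF y(1), unfolded ISuc]] y(2) by auto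
    have c: "a \<in> carrier R" "x \<in> carrier R" using ax p_carr ideal_carr[OF pp] by auto
    have "b \<ominus> s \<otimes> (e \<otimes> x) = a" unfolding ax(3) using c sc ec by algebra
    then show ?thesis using ax(1,2) by (metis B_def imageI)
  qed
  then obtain r where r: "r \<in> carrier R" "\<And>b. b \<in> B \<Longrightarrow> (\<one> \<ominus> r \<otimes> s) \<otimes> b \<in> p \<cdot> p"
    using nakayama_multiplier[OF B pp sc] by blast
  have "((\<one> \<ominus> r \<otimes> s) \<otimes> e) \<otimes> x \<in> p \<cdot> p" if "x \<in> p" for x
    using r(2)[of "e \<otimes> x"] that p_carr[OF that] r(1) by (simp add: B_def m_assoc)
  moreover have "(\<one> \<ominus> r \<otimes> s) \<otimes> e \<in> carrier R - p"
    using notin_p_mult e(1) s(2)[OF r(1)] r(1) by simp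
  ultimately show ?thesis by blast
qed

end

section \<open>From finite length to the iso-Artinian property\<close>

lemma (in cring) module_isomorphic_refl:
  "module_isomorphic R M M"
  unfolding module_isomorphic_def
  by (intro bexI[of _ "\<lambda>x. x"]) (auto simp: module_hom_def bij_betw_def)

lemma (in cring) module_isomorphic_ideal_sym:
  assumes I: "ideal I R" and iso: "module_isomorphic R (ideal_as_module R I) (ideal_as_module R J)"
  shows "module_isomorphic R (ideal_as_module R J) (ideal_as_module R I)"
proof -
  obtain f where bij: "bij_betw f I J"
    and add: "\<And>x y. x \<in> I \<Longrightarrow> y \<in> I \<Longrightarrow> f (x \<oplus> y) = f x \<oplus> f y"
    and smult: "\<And>r x. r \<in> carrier R \<Longrightarrow> x \<in> I \<Longrightarrow> f (r \<otimes> x) = r \<otimes> f x"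
    using iso by (auto simp: module_isomorphic_def module_hom_def ideal_as_module_def ring_as_module_def)
  define g where "g = the_inv_into I f"
  have g: "g y \<in> I" "f (g y) = y" if "y \<in> J" for y
    using bij that by (auto simp: g_def bij_betw_def the_inv_into_into f_the_inv_into_f)
  have gf: "g (f x) = x" if "x \<in> I" for x
    using bij that by (auto simp: g_def bij_betw_def the_inv_into_f_f)
  have "g (x \<oplus> y) = g x \<oplus> g y" if "x \<in> J" "y \<in> J" for x y
    using gf[OF ideal_add[OF I g(1)[OF that(1)] g(1)[OF that(2)]]] add g that by simp
  moreover have "g (r \<otimes> x) = r \<otimes> g x" if "r \<in> carrier R" "x \<in> J" for r x
    using gf[OF ideal_smult[OF I that(1) g(1)[OF that(2)]]] smult g that by simp
  moreover have "bij_betw g J I" unfolding g_def by (rule bij_betw_the_inv_into[OF bij])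
  ultimately show ?thesis
    using g(1) unfolding module_isomorphic_def
    by (intro bexI[of _ g]) (auto simp: module_hom_def ideal_as_module_def ring_as_module_def)
qed

text \<open>
  If \<open>I = A + W\<close> and \<open>J = A + c W\<close> are direct sums and \<open>c\<close> is injective on \<open>W\<close>, then \<open>u + v \<mapsto> u + c v\<close> is
  an isomorphism from \<open>I\<close> to \<open>J\<close>. The last assumption expresses both the injectivity and the directness
  of the two sums: for \<open>d \<in> A \<inter> W\<close> apply it to \<open>c d + c (-d) = 0\<close>.
\<close>

lemma (in cring) module_isomorphic_scaled_summand:
  assumes I: "ideal I R" and J: "ideal J R" and A: "ideal A R" and W: "ideal W R"
    and c: "c \<in> carrier R"
    and sub: "A \<subseteq> I" "W \<subseteq> I" "A \<subseteq> J" "\<And>v. v \<in> W \<Longrightarrow> c \<otimes> v \<in> J"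
    and decomp: "\<And>x. x \<in> I \<Longrightarrow> \<exists>u\<in>A. \<exists>v\<in>W. x = u \<oplus> v"
    and decomp': "\<And>z. z \<in> J \<Longrightarrow> \<exists>u\<in>A. \<exists>v\<in>W. z = u \<oplus> c \<otimes> v"
    and indep: "\<And>u v. u \<in> A \<Longrightarrow> v \<in> W \<Longrightarrow> u \<oplus> c \<otimes> v = \<zero> \<Longrightarrow> u = \<zero> \<and> v = \<zero>"
  shows "module_isomorphic R (ideal_as_module R I) (ideal_as_module R J)"
proof -
  note Ac = ideal_carr[OF A] and Wc = ideal_carr[OF W]
  have int0: "d = \<zero>" if "d \<in> A" "d \<in> W" for d
  proof -
    have dc: "d \<in> carrier R" using Ac that by blast
    have "\<zero> \<ominus> d \<in> W" using ideal_minus[OF W ideal_zero[OF W] that(2)] .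
    moreover have "c \<otimes> d \<in> A" using ideal_smult[OF A c that(1)] .
    moreover have "c \<otimes> d \<oplus> c \<otimes> (\<zero> \<ominus> d) = \<zero>" using c dc by algebra
    ultimately have "\<zero> \<ominus> d = \<zero>" using indep by blast
    then show ?thesis using dc by (simp add: a_minus_def)
  qed
  have uniq: "u = u' \<and> v = v'" if "u \<in> A" "v \<in> W" "u' \<in> A" "v' \<in> W" "u \<oplus> v = u' \<oplus> v'" for u v u' v'
  proof -
    have cc: "u \<in> carrier R" "v \<in> carrier R" "u' \<in> carrier R" "v' \<in> carrier R" using that Ac Wc by auto
    have "u \<ominus> u' = (u \<oplus> v) \<ominus> (u' \<oplus> v)" using cc by algebra
    also have "\<dots> = v' \<ominus> v" unfolding that(5) using cc by algebra
    finally have "u \<ominus> u' = v' \<ominus> v" .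
    moreover have "u \<ominus> u' \<in> A" "v' \<ominus> v \<in> W" using ideal_minus[OF A] ideal_minus[OF W] that by auto
    ultimately have "u \<ominus> u' = \<zero>" "v' \<ominus> v = \<zero>" using int0 by metis+
    then show ?thesis using cc by simp
  qed
  define f where "f x = (THE z. \<exists>u\<in>A. \<exists>v\<in>W. x = u \<oplus> v \<and> z = u \<oplus> c \<otimes> v)" for x
  have f: "f (u \<oplus> v) = u \<oplus> c \<otimes> v" if "u \<in> A" "v \<in> W" for u v
    unfolding f_def using that uniq by (intro the_equality) blast+
  have f_in: "f x \<in> J" if "x \<in> I" for x
  proof -
    obtain u v where "u \<in> A" "v \<in> W" "x = u \<oplus> v" using decomp[OF \<open>x \<in> I\<close>] by blast
    then show ?thesis using f sub ideal_add[OF J] by auto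
  qed
  have f_add: "f (x \<oplus> y) = f x \<oplus> f y" if "x \<in> I" "y \<in> I" for x y
  proof -
    obtain u v where x: "u \<in> A" "v \<in> W" "x = u \<oplus> v" using decomp[OF \<open>x \<in> I\<close>] by blast
    obtain u' v' where y: "u' \<in> A" "v' \<in> W" "y = u' \<oplus> v'" using decomp[OF \<open>y \<in> I\<close>] by blast
    have cc: "u \<in> carrier R" "v \<in> carrier R" "u' \<in> carrier R" "v' \<in> carrier R" using x y Ac Wc by auto
    have "x \<oplus> y = (u \<oplus> u') \<oplus> (v \<oplus> v')" unfolding x(3) y(3) using cc by algebra
    then have "f (x \<oplus> y) = (u \<oplus> u') \<oplus> c \<otimes> (v \<oplus> v')"
      using f ideal_add[OF A x(1) y(1)] ideal_add[OF W x(2) y(2)] by simp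
    also have "\<dots> = (u \<oplus> c \<otimes> v) \<oplus> (u' \<oplus> c \<otimes> v')" using cc c by algebra
    finally show ?thesis using f x y by simp
  qed
  have f_smult: "f (r \<otimes> x) = r \<otimes> f x" if "r \<in> carrier R" "x \<in> I" for r x
  proof -
    obtain u v where x: "u \<in> A" "v \<in> W" "x = u \<oplus> v" using decomp[OF \<open>x \<in> I\<close>] by blast
    have cc: "u \<in> carrier R" "v \<in> carrier R" using x Ac Wc by auto
    have "r \<otimes> x = r \<otimes> u \<oplus> r \<otimes> v" using cc that(1) x(3) by (simp add: r_distr)
    then have "f (r \<otimes> x) = r \<otimes> u \<oplus> c \<otimes> (r \<otimes> v)"
      using f ideal_smult[OF A that(1) x(1)] ideal_smult[OF W that(1) x(2)] by simp
    also have "\<dots> = r \<otimes> (u \<oplus> c \<otimes> v)" using cc c that(1) by algebra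
    finally show ?thesis using f x by simp
  qed
  have "inj_on f I"
  proof (rule inj_onI)
    fix x y assume xy: "x \<in> I" "y \<in> I" "f x = f y"
    obtain u v where x: "u \<in> A" "v \<in> W" "x = u \<oplus> v" using decomp[OF \<open>x \<in> I\<close>] by blast
    obtain u' v' where y: "u' \<in> A" "v' \<in> W" "y = u' \<oplus> v'" using decomp[OF \<open>y \<in> I\<close>] by blast
    have cc: "u \<in> carrier R" "v \<in> carrier R" "u' \<in> carrier R" "v' \<in> carrier R" using x y Ac Wc by auto
    have eq: "u \<oplus> c \<otimes> v = u' \<oplus> c \<otimes> v'" using xy(3) f x y by simp
    have "(u \<ominus> u') \<oplus> c \<otimes> (v \<ominus> v') = (u \<oplus> c \<otimes> v) \<ominus> (u' \<oplus> c \<otimes> v')"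
      using cc c by algebra
    also have "\<dots> = \<zero>" unfolding eq using cc c by simp
    finally have "u \<ominus> u' = \<zero> \<and> v \<ominus> v' = \<zero>"
      using indep ideal_minus[OF A x(1) y(1)] ideal_minus[OF W x(2) y(2)] by blast
    then show "x = y" using x y cc by simp
  qed
  moreover have "f ` I = J"
  proof
    show "f ` I \<subseteq> J" using f_in by blast
    show "J \<subseteq> f ` I"
    proof
      fix z assume "z \<in> J"
      then obtain u v where z: "u \<in> A" "v \<in> W" "z = u \<oplus> c \<otimes> v" using decomp' by blast
      then have "u \<oplus> v \<in> I" using subsetD[OF sub(1)] subsetD[OF sub(2)] ideal_add[OF I] by blast
      moreover have "z = f (u \<oplus> v)" using f z by simp
      ultimately show "z \<in> f ` I" by blast
    qed
  qed
  ultimately show ?thesis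
    using f_in f_add f_smult unfolding module_isomorphic_def
    by (intro bexI[of _ f]) (auto simp: bij_betw_def module_hom_def ideal_as_module_def ring_as_module_def)
qed

lemma (in noetherian_cring) ascending_chain_stabilizes:
  assumes "\<And>k. ideal (J k) R" "\<And>k. J k \<subseteq> J (Suc k)"
  shows "\<exists>k0. \<forall>k\<ge>k0. J k = J k0"
proof -
  define F where "F = range J"
  have "F \<noteq> {}" "\<And>I. I \<in> F \<Longrightarrow> ideal I R" using assms(1) by (auto simp: F_def)
  then obtain M where M: "M \<in> F" "\<And>I. I \<in> F \<Longrightarrow> M \<subseteq> I \<Longrightarrow> I = M"
    using ex_maximal_ideal_in by blast
  then obtain k0 where k0: "M = J k0" by (auto simp: F_def)
  have "J k = J k0" if "k \<ge> k0" for k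
  proof -
    have "J k0 \<subseteq> J k" using lift_Suc_mono_le[of J, OF assms(2) that] .
    then show ?thesis using M(2)[of "J k"] unfolding k0 by (simp add: F_def)
  qed
  then show ?thesis by blast
qed

text \<open>
  Fitting's lemma for multiplication by \<open>c\<close> on an ideal \<open>L\<close> of finite length. For large \<open>N\<close> the kernel
  \<open>L0\<close> and the image \<open>L1\<close> of \<open>c\<^sup>N\<close> no longer change; then \<open>L\<close> is their direct sum and \<open>c\<close> is bijective on
  \<open>L1\<close>. A subset \<open>S\<close> with \<open>S \<subseteq> c S\<close> lies in every image \<open>c\<^sup>k L\<close>, hence in \<open>L1\<close>.
\<close>

lemma (in noetherian_cring) fitting_decomposition:
  assumes L: "ideal L R" and bd: "chains_bounded L n" and c[simp]: "c \<in> carrier R"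
  obtains L0 L1 where "ideal L0 R" "ideal L1 R" "L0 \<subseteq> L" "L1 \<subseteq> L"
    "\<And>x. x \<in> L \<Longrightarrow> \<exists>u\<in>L0. \<exists>v\<in>L1. x = u \<oplus> v" "L0 \<inter> L1 \<subseteq> {\<zero>}"
    "\<And>v. v \<in> L1 \<Longrightarrow> c \<otimes> v = \<zero> \<Longrightarrow> v = \<zero>" "\<And>v. v \<in> L1 \<Longrightarrow> \<exists>w\<in>L1. v = c \<otimes> w"
    "\<And>S. S \<subseteq> L \<Longrightarrow> (\<And>x. x \<in> S \<Longrightarrow> \<exists>y\<in>S. x = c \<otimes> y) \<Longrightarrow> S \<subseteq> L1"
proof -
  note Lc[simp] = ideal_carr[OF L]
  have p_carr[simp]: "c [^] (k::nat) \<in> carrier R" for k by simp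
  define J where "J k = (\<lambda>x. c [^] (k::nat) \<otimes> x) ` L" for k
  define Z where "Z k = {x \<in> L. c [^] (k::nat) \<otimes> x = \<zero>}" for k
  have J: "ideal (J k) R" for k
  proof (rule cring_idealI)
    show "J k \<subseteq> carrier R" by (auto simp: J_def)
    show "\<zero> \<in> J k" using ideal_zero[OF L] by (force simp: J_def)
    fix a assume "a \<in> J k"
    then obtain x where x: "x \<in> L" "a = c [^] k \<otimes> x" by (auto simp: J_def)
    show "r \<otimes> a \<in> J k" if "r \<in> carrier R" for r
    proof -
      have "r \<otimes> a = c [^] k \<otimes> (r \<otimes> x)" using x that by (simp add: m_lcomm)
      then show ?thesis using ideal_smult[OF L that x(1)] by (simp add: J_def)
    qed
    fix b assume "b \<in> J k"
    then obtain y where y: "y \<in> L" "b = c [^] k \<otimes> y" by (auto simp: J_def)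
    have "a \<oplus> b = c [^] k \<otimes> (x \<oplus> y)" using x y by (simp add: r_distr)
    then show "a \<oplus> b \<in> J k" using ideal_add[OF L x(1) y(1)] by (simp add: J_def)
  qed
  have Z: "ideal (Z k) R" for k
  proof (rule cring_idealI)
    show "Z k \<subseteq> carrier R" "\<zero> \<in> Z k" using ideal_zero[OF L] by (auto simp: Z_def)
    show "a \<oplus> b \<in> Z k" if "a \<in> Z k" "b \<in> Z k" for a b
      using that ideal_add[OF L] by (auto simp: Z_def r_distr)
    show "r \<otimes> a \<in> Z k" if "r \<in> carrier R" "a \<in> Z k" for r a
      using that ideal_smult[OF L] by (auto simp: Z_def m_lcomm[of "c [^] k" r])
  qed
  have JL: "J k \<subseteq> L" for k using ideal_smult[OF L] by (auto simp: J_def)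
  have "J (Suc k) \<subseteq> J k" for k
  proof
    fix x assume "x \<in> J (Suc k)"
    then obtain y where y: "y \<in> L" "x = c [^] k \<otimes> (c \<otimes> y)" by (auto simp: J_def m_assoc)
    then show "x \<in> J k" using ideal_smult[OF L c y(1)] by (simp add: J_def)
  qed
  then obtain n1 where n1: "\<And>k. k \<ge> n1 \<Longrightarrow> J k = J n1"
    using chains_bounded_dcc[OF bd, of J] J JL by blast
  have "Z k \<subseteq> Z (Suc k)" for k
  proof
    fix x assume x: "x \<in> Z k"
    then have xL: "x \<in> L" by (simp add: Z_def)
    have "c [^] Suc k \<otimes> x = c \<otimes> (c [^] k \<otimes> x)" using xL by (simp add: m_assoc m_lcomm)
    then show "x \<in> Z (Suc k)" using x by (simp add: Z_def)
  qed
  then obtain n2 where n2: "\<And>k. k \<ge> n2 \<Longrightarrow> Z k = Z n2"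
    using ascending_chain_stabilizes[of Z] Z by blast
  \<comment> \<open>from \<open>N\<close> on, both the images \<open>J k\<close> and the kernels \<open>Z k\<close> of \<open>c\<^sup>k\<close> are constant\<close>
  define N where "N = max n1 n2"
  have JN: "J k = J N" and ZN: "Z k = Z N" if "k \<ge> N" for k
    using n1[of k] n1[of N] n2[of k] n2[of N] that by (auto simp: N_def)
  have pow_add: "c [^] N \<otimes> (c [^] N \<otimes> x) = c [^] (N + N) \<otimes> x" if "x \<in> L" for x
    using that by (simp add: m_assoc[symmetric] nat_pow_mult)
  have pow_suc: "c \<otimes> (c [^] N \<otimes> x) = c [^] Suc N \<otimes> x" if "x \<in> L" for x
    using that by (simp add: m_assoc m_lcomm)
  show thesis
  proof (rule that[of "Z N" "J N"])
    show "ideal (Z N) R" "ideal (J N) R" "J N \<subseteq> L" using Z J JL by auto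
    show "Z N \<subseteq> L" by (auto simp: Z_def)
    show "Z N \<inter> J N \<subseteq> {\<zero>}"
    proof
      fix v assume v: "v \<in> Z N \<inter> J N"
      then obtain x where x: "x \<in> L" "v = c [^] N \<otimes> x" by (auto simp: J_def)
      have "c [^] N \<otimes> v = \<zero>" using v by (simp add: Z_def)
      then have "x \<in> Z (N + N)" using x pow_add by (simp add: Z_def)
      then have "x \<in> Z N" using ZN[of "N + N"] by simp
      then show "v \<in> {\<zero>}" using x by (simp add: Z_def)
    qed
    show "\<exists>u\<in>Z N. \<exists>v\<in>J N. x = u \<oplus> v" if x: "x \<in> L" for x
    proof -
      have "c [^] N \<otimes> x \<in> J (N + N)" using JN[of "N + N"] x by (simp add: J_def)
      then obtain y where y: "y \<in> L" "c [^] N \<otimes> x = c [^] (N + N) \<otimes> y" by (auto simp: J_def)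
      define v where "v = c [^] N \<otimes> y"
      have vL: "v \<in> L" unfolding v_def using ideal_smult[OF L p_carr y(1)] .
      have "c [^] N \<otimes> (x \<ominus> v) = c [^] N \<otimes> x \<ominus> c [^] N \<otimes> v" using Lc[OF x] Lc[OF vL] by (simp add: a_minus_def r_distr r_minus)
      also have "\<dots> = \<zero>" unfolding y(2) v_def using pow_add[OF y(1)] y(1) by (simp add: a_minus_def r_neg)
      finally have "x \<ominus> v \<in> Z N" using ideal_minus[OF L x vL] by (simp add: Z_def)
      moreover have "v \<in> J N" using y(1) by (simp add: v_def J_def)
      moreover have "x = (x \<ominus> v) \<oplus> v" using Lc[OF x] Lc[OF vL] by algebra
      ultimately show ?thesis by blast
    qed
    show "v = \<zero>" if "v \<in> J N" "c \<otimes> v = \<zero>" for v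
    proof -
      obtain x where x: "x \<in> L" "v = c [^] N \<otimes> x" using \<open>v \<in> J N\<close> by (auto simp: J_def)
      have "x \<in> Z (Suc N)" using that(2) x pow_suc by (simp add: Z_def)
      then have "x \<in> Z N" using ZN[of "Suc N"] by simp
      then show ?thesis using x by (simp add: Z_def)
    qed
    show "\<exists>w\<in>J N. v = c \<otimes> w" if "v \<in> J N" for v
    proof -
      have "v \<in> J (Suc N)" using that JN[of "Suc N"] by simp
      then obtain x where x: "x \<in> L" "v = c [^] Suc N \<otimes> x" by (auto simp: J_def)
      then have "v = c \<otimes> (c [^] N \<otimes> x)" using pow_suc by simp
      then show ?thesis using x(1) by (auto simp: J_def)
    qed
    show "S \<subseteq> J N" if S: "S \<subseteq> L" "\<And>x. x \<in> S \<Longrightarrow> \<exists>y\<in>S. x = c \<otimes> y" for S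
    proof -
      have "\<exists>y\<in>S. x = c [^] (k::nat) \<otimes> y" if "x \<in> S" for x k
      proof (induction k)
        case 0
        then show ?case using that S(1) by (intro bexI[of _ x]) (auto simp: subset_iff)
      next
        case (Suc k)
        then obtain y where y: "y \<in> S" "x = c [^] k \<otimes> y" by blast
        then obtain z where z: "z \<in> S" "y = c \<otimes> z" using S(2) by blast
        then have "z \<in> carrier R" using S(1) by auto
        then have "x = c [^] Suc k \<otimes> z" using y z by (simp add: m_assoc)
        then show ?case using z(1) by blast
      qed
      then show ?thesis using S(1) by (fastforce simp: J_def)
    qed
  qed
qed

locale one_dim_pid_quotient = one_dim_unique_minimal_prime +
  assumes pid: "principal_domain (R Quot p)"
begin

text \<open>
  The image of \<open>I\<close> in \<open>R/p\<close> is a principal ideal, and its generator lifts to an element of \<open>I\<close>.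
\<close>

lemma principal_mod_p:
  assumes I: "ideal I R"
  shows "\<exists>b\<in>I. \<forall>y\<in>I. \<exists>r\<in>carrier R. y \<ominus> r \<otimes> b \<in> p"
proof -
  interpret D: principal_domain "R Quot p" by (rule pid)
  note Ic = ideal_carr[OF I]
  have mult: "(p +> x) \<otimes>\<^bsub>R Quot p\<^esub> (p +> y) = p +> (x \<otimes> y)" if "x \<in> carrier R" "y \<in> carrier R" for x y
    using ideal.rcoset_mult_add[OF p_ideal that] by (simp add: FactRing_def)
  have add: "(p +> x) \<oplus>\<^bsub>R Quot p\<^esub> (p +> y) = p +> (x \<oplus> y)" if "x \<in> carrier R" "y \<in> carrier R" for x y
    using ideal.a_rcos_sum[OF p_ideal that] by (simp add: FactRing_def)
  have carr: "carrier (R Quot p) = (\<lambda>x. p +> x) ` carrier R"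
    by (auto simp: FactRing_def A_RCOSETS_def')
  have "ideal ((\<lambda>x. p +> x) ` I) (R Quot p)"
  proof (rule D.cring_idealI)
    show "(\<lambda>x. p +> x) ` I \<subseteq> carrier (R Quot p)" using Ic by (auto simp: carr)
    have "p +> \<zero> = p" using ideal_zero[OF p_ideal] a_rcos_zero[OF p_ideal] by simp
    then show "\<zero>\<^bsub>R Quot p\<^esub> \<in> (\<lambda>x. p +> x) ` I"
      using ideal_zero[OF I] by (auto simp: FactRing_def intro!: image_eqI[of _ _ \<zero>])
    show "a \<oplus>\<^bsub>R Quot p\<^esub> b \<in> (\<lambda>x. p +> x) ` I" if "a \<in> (\<lambda>x. p +> x) ` I" "b \<in> (\<lambda>x. p +> x) ` I" for a b
      using that add Ic ideal_add[OF I] by auto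
    show "r \<otimes>\<^bsub>R Quot p\<^esub> a \<in> (\<lambda>x. p +> x) ` I" if "r \<in> carrier (R Quot p)" "a \<in> (\<lambda>x. p +> x) ` I" for r a
      using that mult Ic ideal_smult[OF I] by (auto simp: carr)
  qed
  then obtain g where g: "g \<in> carrier (R Quot p)" "(\<lambda>x. p +> x) ` I = PIdl\<^bsub>R Quot p\<^esub> g"
    using D.exists_gen by blast
  then have "g \<in> (\<lambda>x. p +> x) ` I" using D.cgenideal_self[OF g(1)] by simp
  then obtain b where b: "b \<in> I" "g = p +> b" by blast
  have "\<exists>r\<in>carrier R. y \<ominus> r \<otimes> b \<in> p" if y: "y \<in> I" for y
  proof -
    have "p +> y \<in> PIdl\<^bsub>R Quot p\<^esub> g" using g(2) y by blast
    then obtain r where r: "r \<in> carrier R" "p +> y = (p +> r) \<otimes>\<^bsub>R Quot p\<^esub> g"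
      by (auto simp: cgenideal_def carr)
    then have "p +> y = p +> (r \<otimes> b)" using mult b Ic by simp
    then have "y \<ominus> r \<otimes> b \<in> p"
      using quotient_eq_iff_same_a_r_cos[OF p_ideal, of y "r \<otimes> b"] Ic b y r(1) by simp
    then show ?thesis using r(1) by blast
  qed
  then show ?thesis using b(1) by blast
qed

text \<open>
  Consider a descending chain of ideals. Its intersections with \<open>p\<close> stabilize at some ideal \<open>L\<close>, and
  only the case that no member \<open>J k\<close> lies in \<open>p\<close> is not immediate. Since \<open>R/p\<close> is a principal ideal
  domain, \<open>J k = L + (a k)\<close> for some \<open>a k\<close>, and changing \<open>a (k + 1)\<close> by an element of \<open>L\<close> one can arrange
  that \<open>a (k + 1)\<close> is a multiple of \<open>a k\<close>. The ideals \<open>p (a k) \<subseteq> L\<close> descend, so they are constant from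
  some \<open>k0\<close> on.

  For \<open>m \<ge> k0\<close> write \<open>a m = c (a k0)\<close> and decompose \<open>L = L0 + L1\<close> by Fitting's lemma for \<open>c\<close>. The ideal
  \<open>p (a k0)\<close> is mapped onto itself by \<open>c\<close> and so lies in \<open>L1\<close>. Put \<open>W = L1 + (a k0)\<close>. Then
  \<open>J k0 = L0 + W\<close>, and \<open>J m = L0 + c W\<close> because \<open>c L1 = L1\<close>. Moreover \<open>c\<close> is injective on \<open>W\<close> and both
  sums are direct: a relation involving \<open>r (a k0)\<close> forces \<open>r \<in> p\<close>, since the other terms lie in \<open>p\<close> while
  \<open>a m\<close> does not; then \<open>r (a k0) \<in> L1\<close>, and everything happens inside \<open>L0 + L1\<close>.
\<close>

lemma iso_artinian_if_chains_bounded: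
  assumes bd: "chains_bounded p n"
  shows "iso_artinian R"
  unfolding iso_artinian_def
proof (intro allI impI)
  fix I :: "nat \<Rightarrow> 'a set"
  assume "(\<forall>n. ideal (I n) R) \<and> (\<forall>n. I (Suc n) \<subseteq> I n)"
  then have I: "\<And>k. ideal (I k) R" and dec: "\<And>k. I (Suc k) \<subseteq> I k" by auto
  have bd_sub: "chains_bounded L n" if "L \<subseteq> p" for L
    unfolding chains_bounded_def
  proof (intro allI impI)
    fix m N assume "(\<forall>i\<le>m. ideal (N i) R \<and> N i \<subseteq> L) \<and> (\<forall>i<m. N i \<subset> N (Suc i))"
    then have "(\<forall>i\<le>m. ideal (N i) R \<and> N i \<subseteq> p) \<and> (\<forall>i<m. N i \<subset> N (Suc i))" using that by blast
    then show "m \<le> n" using bd[unfolded chains_bounded_def, rule_format, of m N] by blast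
  qed
  have "ideal (I k \<inter> p) R" for k using i_intersect[OF I p_ideal] .
  then obtain k1 where k1: "\<And>k. k \<ge> k1 \<Longrightarrow> I k \<inter> p = I k1 \<inter> p"
    using chains_bounded_dcc[OF bd, of "\<lambda>k. I k \<inter> p"] dec by blast
  define L where "L = I k1 \<inter> p"
  define J where "J k = I (k1 + k)" for k
  have J: "ideal (J k) R" "J (Suc k) \<subseteq> J k" "J k \<inter> p = L" for k
    using I dec[of "k1 + k"] k1[of "k1 + k"] by (auto simp: J_def L_def)
  have L: "ideal L R" unfolding L_def using i_intersect[OF I p_ideal] .
  have Lp: "L \<subseteq> p" and LJ: "L \<subseteq> J k" for k using J(3) by (auto simp: L_def)
  note Lc = ideal_carr[OF L] and Jc = ideal_carr[OF J(1)]
  have "\<exists>k0. \<forall>k\<ge>k0. module_isomorphic R (ideal_as_module R (J k)) (ideal_as_module R (J k0))"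
  proof (cases "\<exists>k0. J k0 \<subseteq> p")
    case True
    then obtain k0 where k0: "J k0 \<subseteq> p" by blast
    have "J k = J k0" if "k \<ge> k0" for k
    proof -
      have "J k \<subseteq> J k0" using lift_Suc_antimono_le[of J, OF J(2) that] .
      then show ?thesis using J(3)[of k] J(3)[of k0] k0 by blast
    qed
    then show ?thesis using module_isomorphic_refl by metis
  next
    case False
    \<comment> \<open>\<open>a\<close> generates \<open>J k\<close> together with \<open>L\<close>\<close>
    define P where "P k a \<longleftrightarrow> a \<in> J k \<and> (\<forall>y\<in>J k. \<exists>l\<in>L. \<exists>r\<in>carrier R. y = l \<oplus> r \<otimes> a)" for k a
    have P_I: "P k b" if b: "b \<in> J k" "\<And>y. y \<in> J k \<Longrightarrow> \<exists>r\<in>carrier R. y \<ominus> r \<otimes> b \<in> p" for k b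
      unfolding P_def
    proof (intro conjI ballI)
      fix y assume y: "y \<in> J k"
      then obtain r where r: "r \<in> carrier R" "y \<ominus> r \<otimes> b \<in> p" using b by blast
      have "y \<ominus> r \<otimes> b \<in> J k" using ideal_minus[OF J(1) y ideal_smult[OF J(1) r(1) b(1)]] .
      then have "y \<ominus> r \<otimes> b \<in> L" using r(2) J(3) by blast
      moreover have "y = (y \<ominus> r \<otimes> b) \<oplus> r \<otimes> b" using Jc[OF y] Jc[OF b(1)] r(1) by algebra
      ultimately show "\<exists>l\<in>L. \<exists>r\<in>carrier R. y = l \<oplus> r \<otimes> b" using r(1) by blast
    qed (rule b)
    have "\<exists>a. P 0 a" using principal_mod_p[OF J(1)[of 0]] P_I by blast
    moreover have "\<exists>a'. P (Suc k) a' \<and> (\<exists>c\<in>carrier R. a' = c \<otimes> a)" if a: "P k a" for a k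
    proof -
      obtain b where b: "b \<in> J (Suc k)" "\<And>y. y \<in> J (Suc k) \<Longrightarrow> \<exists>r\<in>carrier R. y \<ominus> r \<otimes> b \<in> p"
        using principal_mod_p[OF J(1)[of "Suc k"]] by blast
      then have "P (Suc k) b" using P_I by blast
      obtain l c where lc: "l \<in> L" "c \<in> carrier R" "b = l \<oplus> c \<otimes> a"
        using a b(1) J(2)[of k] unfolding P_def by blast
      have cc: "l \<in> carrier R" "a \<in> carrier R" using Lc[OF lc(1)] a Jc unfolding P_def by auto
      \<comment> \<open>replacing the generator \<open>b\<close> by \<open>b - l\<close> makes it a multiple of \<open>a\<close>\<close>
      have ca: "c \<otimes> a = b \<ominus> l" unfolding lc(3) using cc lc(2) by algebra
      have "P (Suc k) (c \<otimes> a)"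
      proof (rule P_I)
        show "c \<otimes> a \<in> J (Suc k)" unfolding ca using ideal_minus[OF J(1) b(1)] lc(1) LJ by blast
        fix y assume "y \<in> J (Suc k)"
        then obtain r where r: "r \<in> carrier R" "y \<ominus> r \<otimes> b \<in> p" "y \<in> carrier R" using b(2) Jc by blast
        have "y \<ominus> r \<otimes> (c \<otimes> a) = (y \<ominus> r \<otimes> b) \<oplus> r \<otimes> l"
          unfolding lc(3) using cc r(1,3) lc(2) by algebra
        moreover have "r \<otimes> l \<in> p" using ideal_smult[OF p_ideal r(1)] lc(1) Lp by blast
        ultimately have "y \<ominus> r \<otimes> (c \<otimes> a) \<in> p" using ideal_add[OF p_ideal r(2)] by simp
        then show "\<exists>r\<in>carrier R. y \<ominus> r \<otimes> (c \<otimes> a) \<in> p" using r(1) by blast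
      qed
      then show ?thesis using lc(2) by blast
    qed
    ultimately obtain a where Pa: "\<And>k. P k (a k)" and step: "\<And>k. \<exists>c\<in>carrier R. a (Suc k) = c \<otimes> a k"
      using dependent_nat_choice[of P "\<lambda>_ a a'. \<exists>c\<in>carrier R. a' = c \<otimes> a"] by metis
    have aJ: "a k \<in> J k" for k using Pa by (simp add: P_def)
    have ac[simp]: "a k \<in> carrier R" for k using Jc[OF aJ] .
    have a_span: "\<exists>l\<in>L. \<exists>r\<in>carrier R. y = l \<oplus> r \<otimes> a k" if "y \<in> J k" for y k
      using Pa that by (simp add: P_def)
    have a_notin: "a k \<notin> p" for k
    proof
      assume "a k \<in> p"
      then have "J k \<subseteq> p"
        using a_span[of _ k] ideal_add[OF p_ideal] ideal_smult[OF p_ideal] Lp by blast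
      then show False using False by blast
    qed
    define S where "S k = (\<lambda>r. r \<otimes> a k) ` p" for k
    have S: "ideal (S k) R" for k
    proof (rule cring_idealI)
      show "S k \<subseteq> carrier R" using p_carr by (auto simp: S_def)
      show "\<zero> \<in> S k" using ideal_zero[OF p_ideal] by (force simp: S_def)
      fix x assume "x \<in> S k"
      then obtain r where r: "r \<in> p" "x = r \<otimes> a k" by (auto simp: S_def)
      show "t \<otimes> x \<in> S k" if "t \<in> carrier R" for t
      proof -
        have "t \<otimes> x = (t \<otimes> r) \<otimes> a k" using r p_carr that by (simp add: m_assoc)
        then show ?thesis using ideal_smult[OF p_ideal that r(1)] by (simp add: S_def)
      qed
      fix y assume "y \<in> S k"
      then obtain r' where r': "r' \<in> p" "y = r' \<otimes> a k" by (auto simp: S_def)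
      have "x \<oplus> y = (r \<oplus> r') \<otimes> a k" using r r' p_carr by (simp add: l_distr)
      then show "x \<oplus> y \<in> S k" using ideal_add[OF p_ideal r(1) r'(1)] by (simp add: S_def)
    qed
    have SL: "S k \<subseteq> L" for k
    proof
      fix x assume "x \<in> S k"
      then obtain r where r: "r \<in> p" "x = r \<otimes> a k" by (auto simp: S_def)
      then have "x \<in> p" "x \<in> J k"
        using ideal_smult'[OF p_ideal ac r(1)] ideal_smult[OF J(1) p_carr[OF r(1)] aJ] by auto
      then show "x \<in> L" using J(3) by blast
    qed
    have "S (Suc k) \<subseteq> S k" for k
    proof
      fix x assume "x \<in> S (Suc k)"
      then obtain r where r: "r \<in> p" "x = r \<otimes> a (Suc k)" by (auto simp: S_def)
      obtain c where c: "c \<in> carrier R" "a (Suc k) = c \<otimes> a k" using step by blast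
      have "x = (r \<otimes> c) \<otimes> a k" using r c p_carr by (simp add: m_assoc)
      then show "x \<in> S k" using ideal_smult'[OF p_ideal c(1) r(1)] by (simp add: S_def)
    qed
    then obtain k0 where k0: "\<And>k. k \<ge> k0 \<Longrightarrow> S k = S k0"
      using chains_bounded_dcc[OF bd_sub[OF Lp], of S] S SL by blast
    have mult: "\<exists>c\<in>carrier R. a m = c \<otimes> a k0" if "m \<ge> k0" for m
      using that
    proof (induction m rule: dec_induct)
      case base
      then show ?case by (intro bexI[of _ \<one>]) auto
    next
      case (step m)
      then obtain c d where "c \<in> carrier R" "a m = c \<otimes> a k0" "d \<in> carrier R" "a (Suc m) = d \<otimes> a m"
        using \<open>\<And>k. \<exists>c\<in>carrier R. a (Suc k) = c \<otimes> a k\<close> by blast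
      then show ?case by (intro bexI[of _ "d \<otimes> c"]) (auto simp: m_assoc)
    qed
    have "module_isomorphic R (ideal_as_module R (J k0)) (ideal_as_module R (J m))" if m: "m \<ge> k0" for m
    proof -
      obtain c where c: "c \<in> carrier R" "a m = c \<otimes> a k0" using mult[OF m] by blast
      obtain L0 L1 where F: "ideal L0 R" "ideal L1 R" "L0 \<subseteq> L" "L1 \<subseteq> L"
        "\<And>x. x \<in> L \<Longrightarrow> \<exists>u\<in>L0. \<exists>v\<in>L1. x = u \<oplus> v" "L0 \<inter> L1 \<subseteq> {\<zero>}"
        "\<And>v. v \<in> L1 \<Longrightarrow> c \<otimes> v = \<zero> \<Longrightarrow> v = \<zero>" "\<And>v. v \<in> L1 \<Longrightarrow> \<exists>w\<in>L1. v = c \<otimes> w"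
        "\<And>S. S \<subseteq> L \<Longrightarrow> (\<And>x. x \<in> S \<Longrightarrow> \<exists>y\<in>S. x = c \<otimes> y) \<Longrightarrow> S \<subseteq> L1"
        using fitting_decomposition[OF L bd_sub[OF Lp] c(1)] by blast
      note L0c = ideal_carr[OF F(1)] and L1c = ideal_carr[OF F(2)]
      have "S k0 \<subseteq> L1"
      proof (rule F(9)[OF SL])
        fix x assume "x \<in> S k0"
        then have "x \<in> S m" using k0[OF m] by simp
        then obtain r where r: "r \<in> p" "x = r \<otimes> a m" by (auto simp: S_def)
        then have "x = c \<otimes> (r \<otimes> a k0)" using c p_carr by (simp add: m_lcomm)
        then show "\<exists>y\<in>S k0. x = c \<otimes> y" using r(1) by (auto simp: S_def)
      qed
      then have ra: "r \<otimes> a k0 \<in> L1" if "r \<in> p" for r using that by (auto simp: S_def)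
      define W where "W = adjoin L1 (a k0)"
      have W: "ideal W R" unfolding W_def using adjoin_ideal[OF F(2) ac] by blast
      have memW: "v \<oplus> r \<otimes> a k0 \<in> W" if "v \<in> L1" "r \<in> carrier R" for v r
        using that by (auto simp: W_def adjoin_def)
      have cW: "c \<otimes> (v \<oplus> r \<otimes> a k0) = c \<otimes> v \<oplus> r \<otimes> a m" if "v \<in> L1" "r \<in> carrier R" for v r
        unfolding c(2) using that L1c[OF that(1)] c(1) ac[of k0] by algebra
      show ?thesis
      proof (rule module_isomorphic_scaled_summand[OF J(1) J(1) F(1) W c(1)])
        show "L0 \<subseteq> J k0" "L0 \<subseteq> J m" using F(3) LJ by blast+
        show "W \<subseteq> J k0" unfolding W_def
          using adjoin_subset[OF J(1) _ aJ] F(4) LJ by blast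
        show "c \<otimes> v \<in> J m" if "v \<in> W" for v
        proof -
          obtain l r where v: "l \<in> L1" "r \<in> carrier R" "v = l \<oplus> r \<otimes> a k0"
            using \<open>v \<in> W\<close> by (auto simp: W_def adjoin_def)
          have "c \<otimes> l \<in> J m" using ideal_smult[OF F(2) c(1) v(1)] F(4) LJ by blast
          then show ?thesis unfolding v(3) cW[OF v(1,2)]
            using ideal_add[OF J(1)] ideal_smult[OF J(1) v(2) aJ] by blast
        qed
        show "\<exists>u\<in>L0. \<exists>v\<in>W. x = u \<oplus> v" if "x \<in> J k0" for x
        proof -
          obtain l r where x: "l \<in> L" "r \<in> carrier R" "x = l \<oplus> r \<otimes> a k0" using a_span[OF \<open>x \<in> J k0\<close>] by blast
          obtain u v where uv: "u \<in> L0" "v \<in> L1" "l = u \<oplus> v" using F(5)[OF x(1)] by blast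
          have "x = u \<oplus> (v \<oplus> r \<otimes> a k0)" using x uv L0c L1c by (simp add: a_assoc)
          then show ?thesis using uv(1) memW[OF uv(2) x(2)] by blast
        qed
        show "\<exists>u\<in>L0. \<exists>v\<in>W. z = u \<oplus> c \<otimes> v" if "z \<in> J m" for z
        proof -
          obtain l r where z: "l \<in> L" "r \<in> carrier R" "z = l \<oplus> r \<otimes> a m" using a_span[OF \<open>z \<in> J m\<close>] by blast
          obtain u v where uv: "u \<in> L0" "v \<in> L1" "l = u \<oplus> v" using F(5)[OF z(1)] by blast
          obtain w where w: "w \<in> L1" "v = c \<otimes> w" using F(8)[OF uv(2)] by blast
          have "z = u \<oplus> c \<otimes> (w \<oplus> r \<otimes> a k0)"
            unfolding cW[OF w(1) z(2)] using z uv w L0c L1c by (simp add: a_assoc)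
          then show ?thesis using uv(1) memW[OF w(1) z(2)] by blast
        qed
        show "u = \<zero> \<and> v = \<zero>" if uv: "u \<in> L0" "v \<in> W" "u \<oplus> c \<otimes> v = \<zero>" for u v
        proof -
          obtain l r where v: "l \<in> L1" "r \<in> carrier R" "v = l \<oplus> r \<otimes> a k0"
            using uv(2) by (auto simp: W_def adjoin_def)
          have cc: "u \<in> carrier R" "l \<in> carrier R" "v \<in> carrier R"
            using uv v L0c L1c ideal_carr[OF W] by auto
          have "r \<otimes> a m = (u \<oplus> (c \<otimes> l \<oplus> r \<otimes> a m)) \<ominus> (u \<oplus> c \<otimes> l)"
            using cc c(1) v(2) ac[of m] by algebra
          also have "u \<oplus> (c \<otimes> l \<oplus> r \<otimes> a m) = \<zero>" using uv(3) unfolding v(3) cW[OF v(1,2)] .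
          also have "\<zero> \<ominus> (u \<oplus> c \<otimes> l) \<in> p"
          proof -
            have "u \<in> p" "c \<otimes> l \<in> p" using uv(1) v(1) ideal_smult[OF F(2) c(1)] F(3,4) Lp by blast+
            then show ?thesis using ideal_minus[OF p_ideal ideal_zero[OF p_ideal]] ideal_add[OF p_ideal] by blast
          qed
          finally have "r \<in> p"
            using primeideal.I_prime[OF p_prime v(2) ac] a_notin by blast
          then have vL1: "v \<in> L1" unfolding v(3) using ideal_add[OF F(2) v(1) ra] by blast
          have "\<zero> \<ominus> c \<otimes> v \<in> L1" using ideal_minus[OF F(2) ideal_zero[OF F(2)] ideal_smult[OF F(2) c(1) vL1]] .
          moreover have "u = (u \<oplus> c \<otimes> v) \<ominus> c \<otimes> v" using cc c(1) by algebra
          ultimately have "u \<in> L1" unfolding uv(3) by simp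
          then have u0: "u = \<zero>" using F(6) uv(1) by blast
          then have "c \<otimes> v = \<zero>" using uv(3) cc c(1) by simp
          then show ?thesis using F(7)[OF vL1] u0 by blast
        qed
      qed
    qed
    then show ?thesis using module_isomorphic_ideal_sym[OF J(1)] by blast
  qed
  then obtain k0 where k0: "\<And>k. k \<ge> k0 \<Longrightarrow> module_isomorphic R (ideal_as_module R (J k)) (ideal_as_module R (J k0))" by blast
  have "module_isomorphic R (ideal_as_module R (I k)) (ideal_as_module R (I (k1 + k0)))" if "k \<ge> k1 + k0" for k
    using k0[of "k - k1"] that by (simp add: J_def)
  then show "\<exists>n0. \<forall>n\<ge>n0. module_isomorphic R (ideal_as_module R (I n)) (ideal_as_module R (I n0))" by blast
qed

end

section \<open>Localization\<close>

locale mult_subset = cring R for R (structure) +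
  fixes S
  assumes S_subset: "S \<subseteq> carrier R"
    and S_one: "\<one> \<in> S"
    and S_mult: "s \<in> S \<Longrightarrow> t \<in> S \<Longrightarrow> s \<otimes> t \<in> S"
begin

lemma S_carr[simp]: "s \<in> S \<Longrightarrow> s \<in> carrier R"
  using S_subset by blast

lemma fraction_rel_iff:
  "((a, s), (b, t)) \<in> fraction_rel R S \<longleftrightarrow>
     a \<in> carrier R \<and> s \<in> S \<and> b \<in> carrier R \<and> t \<in> S \<and> (\<exists>u\<in>S. u \<otimes> (t \<otimes> a) = u \<otimes> (s \<otimes> b))"
  by (auto simp: fraction_rel_def)

lemma equiv_fraction_rel: "equiv (carrier R \<times> S) (fraction_rel R S)"
proof (rule equivI)
  show "fraction_rel R S \<subseteq> (carrier R \<times> S) \<times> (carrier R \<times> S)" by (auto simp: fraction_rel_def)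
  show "refl_on (carrier R \<times> S) (fraction_rel R S)"
    using S_one by (auto simp: refl_on_def fraction_rel_iff)
  show "sym (fraction_rel R S)"
    by (auto simp: sym_def fraction_rel_iff) metis
  show "trans (fraction_rel R S)"
  proof (rule transI)
    fix x y z assume xy: "(x, y) \<in> fraction_rel R S" and yz: "(y, z) \<in> fraction_rel R S"
    obtain a s b t c r where x: "x = (a, s)" and y: "y = (b, t)" and z: "z = (c, r)"
      by (metis surj_pair)
    obtain u where u: "a \<in> carrier R" "s \<in> S" "b \<in> carrier R" "t \<in> S" "u \<in> S" "u \<otimes> (t \<otimes> a) = u \<otimes> (s \<otimes> b)"
      using xy unfolding x y fraction_rel_iff by blast
    obtain v where v: "c \<in> carrier R" "r \<in> S" "v \<in> S" "v \<otimes> (r \<otimes> b) = v \<otimes> (t \<otimes> c)"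
      using yz unfolding y z fraction_rel_iff by blast
    have cc: "s \<in> carrier R" "t \<in> carrier R" "r \<in> carrier R" "u \<in> carrier R" "v \<in> carrier R"
      using u v by auto
    have "(u \<otimes> v \<otimes> t) \<otimes> (r \<otimes> a) = (v \<otimes> r) \<otimes> (u \<otimes> (t \<otimes> a))" using cc u(1) by algebra
    also have "\<dots> = (u \<otimes> s) \<otimes> (v \<otimes> (r \<otimes> b))" unfolding u(6) using cc u(3) by algebra
    also have "\<dots> = (u \<otimes> v \<otimes> t) \<otimes> (s \<otimes> c)" unfolding v(4) using cc v(1) by algebra
    finally show "(x, z) \<in> fraction_rel R S"
      unfolding x z fraction_rel_iff using u v S_mult by blast
  qed
qed

abbreviation frac :: "'a \<Rightarrow> 'a \<Rightarrow> ('a \<times> 'a) set" where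
  "frac \<equiv> fraction R S"

lemma frac_eq_iff:
  assumes "a \<in> carrier R" "s \<in> S" "b \<in> carrier R" "t \<in> S"
  shows "frac a s = frac b t \<longleftrightarrow> (\<exists>u\<in>S. u \<otimes> (t \<otimes> a) = u \<otimes> (s \<otimes> b))"
  using eq_equiv_class_iff[OF equiv_fraction_rel, of "(a, s)" "(b, t)"] assms
  by (simp add: fraction_def fraction_rel_iff)

lemma frac_eqI:
  assumes "a \<in> carrier R" "s \<in> S" "b \<in> carrier R" "t \<in> S" "t \<otimes> a = s \<otimes> b"
  shows "frac a s = frac b t"
  using assms S_one by (subst frac_eq_iff) auto

lemma frac_cancel:
  assumes "a \<in> carrier R" "s \<in> S" "r \<in> S"
  shows "frac (r \<otimes> a) (r \<otimes> s) = frac a s"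
  using assms S_mult by (intro frac_eqI) (auto simp: m_assoc m_lcomm)

lemma carrier_loc: "carrier (localization R S) = {frac a s | a s. a \<in> carrier R \<and> s \<in> S}"
  by (auto simp: localization_def quotient_def fraction_def)

lemma frac_in_carrier[simp]: "a \<in> carrier R \<Longrightarrow> s \<in> S \<Longrightarrow> frac a s \<in> carrier (localization R S)"
  by (auto simp: carrier_loc)

lemma mem_frac_iff:
  assumes "a \<in> carrier R" "s \<in> S"
  shows "(b, t) \<in> frac a s \<longleftrightarrow> b \<in> carrier R \<and> t \<in> S \<and> frac a s = frac b t"
  using assms frac_eq_iff[OF assms, of b t] by (auto simp: fraction_def fraction_rel_iff)

text \<open>
  The operations of a localization are unions over all representatives. Such a union collapses once
  its members are shown to agree.
\<close>

lemma UN_frac2: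
  assumes "a \<in> carrier R" "s \<in> S" "b \<in> carrier R" "t \<in> S"
    and "\<And>a' s' b' t'. a' \<in> carrier R \<Longrightarrow> s' \<in> S \<Longrightarrow> frac a s = frac a' s' \<Longrightarrow>
           b' \<in> carrier R \<Longrightarrow> t' \<in> S \<Longrightarrow> frac b t = frac b' t' \<Longrightarrow> F (a', s') (b', t') = c"
  shows "(\<Union>x\<in>frac a s. \<Union>y\<in>frac b t. F x y) = c"
proof -
  have *: "F x y = c" if "x \<in> frac a s" "y \<in> frac b t" for x y
    using that assms by (cases x; cases y) (simp add: mem_frac_iff)
  have "(a, s) \<in> frac a s" "(b, t) \<in> frac b t" using assms by (simp_all add: mem_frac_iff)
  then show ?thesis using * by auto
qed

lemma loc_mult:
  "A \<otimes>\<^bsub>localization R S\<^esub> B = (\<Union>x\<in>A. \<Union>y\<in>B. frac (fst x \<otimes> fst y) (snd x \<otimes> snd y))"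
  and loc_add:
  "A \<oplus>\<^bsub>localization R S\<^esub> B =
    (\<Union>x\<in>A. \<Union>y\<in>B. frac (snd y \<otimes> fst x \<oplus> snd x \<otimes> fst y) (snd x \<otimes> snd y))"
  by (simp_all add: localization_def)

lemma mult_frac:
  assumes "a \<in> carrier R" "s \<in> S" "b \<in> carrier R" "t \<in> S"
  shows "frac a s \<otimes>\<^bsub>localization R S\<^esub> frac b t = frac (a \<otimes> b) (s \<otimes> t)"
proof -
  have "frac (a' \<otimes> b') (s' \<otimes> t') = frac (a \<otimes> b) (s \<otimes> t)"
    if h: "a' \<in> carrier R" "s' \<in> S" "frac a s = frac a' s'" "b' \<in> carrier R" "t' \<in> S" "frac b t = frac b' t'"
    for a' s' b' t'
  proof -
    obtain u where u: "u \<in> S" "u \<otimes> (s' \<otimes> a) = u \<otimes> (s \<otimes> a')" using h assms by (auto simp: frac_eq_iff)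
    obtain v where v: "v \<in> S" "v \<otimes> (t' \<otimes> b) = v \<otimes> (t \<otimes> b')" using h assms by (auto simp: frac_eq_iff)
    have cc: "s \<in> carrier R" "t \<in> carrier R" "s' \<in> carrier R" "t' \<in> carrier R" "u \<in> carrier R" "v \<in> carrier R"
      using assms h u v by auto
    have "(u \<otimes> v) \<otimes> ((s' \<otimes> t') \<otimes> (a \<otimes> b)) = (u \<otimes> (s' \<otimes> a)) \<otimes> (v \<otimes> (t' \<otimes> b))"
      using cc assms(1,3) by algebra
    also have "\<dots> = (u \<otimes> v) \<otimes> ((s \<otimes> t) \<otimes> (a' \<otimes> b'))"
      unfolding u(2) v(2) using cc h(1,4) by algebra
    finally have "frac (a \<otimes> b) (s \<otimes> t) = frac (a' \<otimes> b') (s' \<otimes> t')"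
      using assms h S_mult u(1) v(1) by (subst frac_eq_iff) auto
    then show ?thesis by simp
  qed
  then show ?thesis unfolding loc_mult by (intro UN_frac2[OF assms]) simp
qed

lemma add_frac:
  assumes "a \<in> carrier R" "s \<in> S" "b \<in> carrier R" "t \<in> S"
  shows "frac a s \<oplus>\<^bsub>localization R S\<^esub> frac b t = frac (t \<otimes> a \<oplus> s \<otimes> b) (s \<otimes> t)"
proof -
  have "frac (t' \<otimes> a' \<oplus> s' \<otimes> b') (s' \<otimes> t') = frac (t \<otimes> a \<oplus> s \<otimes> b) (s \<otimes> t)"
    if h: "a' \<in> carrier R" "s' \<in> S" "frac a s = frac a' s'" "b' \<in> carrier R" "t' \<in> S" "frac b t = frac b' t'"
    for a' s' b' t'
  proof -
    obtain u where u: "u \<in> S" "u \<otimes> (s' \<otimes> a) = u \<otimes> (s \<otimes> a')" using h assms by (auto simp: frac_eq_iff)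
    obtain v where v: "v \<in> S" "v \<otimes> (t' \<otimes> b) = v \<otimes> (t \<otimes> b')" using h assms by (auto simp: frac_eq_iff)
    have cc: "s \<in> carrier R" "t \<in> carrier R" "s' \<in> carrier R" "t' \<in> carrier R" "u \<in> carrier R" "v \<in> carrier R"
      using assms h u v by auto
    have "(u \<otimes> v) \<otimes> ((s' \<otimes> t') \<otimes> (t \<otimes> a \<oplus> s \<otimes> b)) =
        (v \<otimes> t \<otimes> t') \<otimes> (u \<otimes> (s' \<otimes> a)) \<oplus> (u \<otimes> s \<otimes> s') \<otimes> (v \<otimes> (t' \<otimes> b))"
      using cc assms(1,3) by algebra
    also have "\<dots> = (u \<otimes> v) \<otimes> ((s \<otimes> t) \<otimes> (t' \<otimes> a' \<oplus> s' \<otimes> b'))"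
      unfolding u(2) v(2) using cc h(1,4) by algebra
    finally have "frac (t \<otimes> a \<oplus> s \<otimes> b) (s \<otimes> t) = frac (t' \<otimes> a' \<oplus> s' \<otimes> b') (s' \<otimes> t')"
      using assms h S_mult u(1) v(1) by (subst frac_eq_iff) auto
    then show ?thesis by simp
  qed
  then show ?thesis unfolding loc_add by (intro UN_frac2[OF assms]) simp
qed

lemma add_frac_same_denom:
  assumes "a \<in> carrier R" "b \<in> carrier R" "s \<in> S"
  shows "frac a s \<oplus>\<^bsub>localization R S\<^esub> frac b s = frac (a \<oplus> b) s"
proof -
  have "frac (s \<otimes> a \<oplus> s \<otimes> b) (s \<otimes> s) = frac (s \<otimes> (a \<oplus> b)) (s \<otimes> s)" using assms by (simp add: r_distr)
  then show ?thesis using assms frac_cancel by (simp add: add_frac)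
qed

lemma one_loc: "\<one>\<^bsub>localization R S\<^esub> = frac \<one> \<one>" and zero_loc: "\<zero>\<^bsub>localization R S\<^esub> = frac \<zero> \<one>"
  by (simp_all add: localization_def)

lemma frac_eq_zero_iff:
  assumes "a \<in> carrier R" "s \<in> S"
  shows "frac a s = \<zero>\<^bsub>localization R S\<^esub> \<longleftrightarrow> (\<exists>u\<in>S. u \<otimes> a = \<zero>)"
  using assms S_one by (simp add: zero_loc frac_eq_iff)

lemma loc_cases:
  assumes "x \<in> carrier (localization R S)"
  obtains a s where "a \<in> carrier R" "s \<in> S" "x = frac a s"
  using assms by (auto simp: carrier_loc)

lemma localization_cring: "cring (localization R S)"
proof (rule cringI)
  let ?L = "localization R S"
  show "abelian_group ?L"
  proof (rule abelian_groupI)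
    show "\<zero>\<^bsub>?L\<^esub> \<in> carrier ?L" using S_one by (simp add: zero_loc)
    fix x assume "x \<in> carrier ?L"
    then obtain a s where x: "a \<in> carrier R" "s \<in> S" "x = frac a s" by (rule loc_cases)
    show "\<zero>\<^bsub>?L\<^esub> \<oplus>\<^bsub>?L\<^esub> x = x" using x S_one by (simp add: zero_loc add_frac)
    have "frac (\<ominus> a) s \<oplus>\<^bsub>?L\<^esub> x = \<zero>\<^bsub>?L\<^esub>"
      using x S_one by (simp add: add_frac_same_denom l_neg frac_eq_zero_iff) (metis S_carr r_null)
    then show "\<exists>y\<in>carrier ?L. y \<oplus>\<^bsub>?L\<^esub> x = \<zero>\<^bsub>?L\<^esub>" using x by (metis a_inv_closed frac_in_carrier)
    fix y assume "y \<in> carrier ?L"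
    then obtain b t where y: "b \<in> carrier R" "t \<in> S" "y = frac b t" by (rule loc_cases)
    show "x \<oplus>\<^bsub>?L\<^esub> y \<in> carrier ?L" using x y S_mult by (simp add: add_frac)
    show "x \<oplus>\<^bsub>?L\<^esub> y = y \<oplus>\<^bsub>?L\<^esub> x"
      using x y S_mult by (simp add: add_frac a_comm m_comm)
    fix z assume "z \<in> carrier ?L"
    then obtain c r where z: "c \<in> carrier R" "r \<in> S" "z = frac c r" by (rule loc_cases)
    have cc: "s \<in> carrier R" "t \<in> carrier R" "r \<in> carrier R" using x y z by auto
    have "r \<otimes> (t \<otimes> a \<oplus> s \<otimes> b) \<oplus> (s \<otimes> t) \<otimes> c = (t \<otimes> r) \<otimes> a \<oplus> s \<otimes> (r \<otimes> b \<oplus> t \<otimes> c)"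
      using cc x(1) y(1) z(1) by algebra
    then show "x \<oplus>\<^bsub>?L\<^esub> y \<oplus>\<^bsub>?L\<^esub> z = x \<oplus>\<^bsub>?L\<^esub> (y \<oplus>\<^bsub>?L\<^esub> z)"
      using x y z S_mult by (simp add: add_frac m_assoc)
  qed
  show "comm_monoid ?L"
  proof (rule comm_monoidI)
    show "\<one>\<^bsub>?L\<^esub> \<in> carrier ?L" using S_one by (simp add: one_loc)
    fix x assume "x \<in> carrier ?L"
    then obtain a s where x: "a \<in> carrier R" "s \<in> S" "x = frac a s" by (rule loc_cases)
    show "\<one>\<^bsub>?L\<^esub> \<otimes>\<^bsub>?L\<^esub> x = x" using x S_one by (simp add: one_loc mult_frac)
    fix y assume "y \<in> carrier ?L"
    then obtain b t where y: "b \<in> carrier R" "t \<in> S" "y = frac b t" by (rule loc_cases)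
    show "x \<otimes>\<^bsub>?L\<^esub> y \<in> carrier ?L" using x y S_mult by (simp add: mult_frac)
    show "x \<otimes>\<^bsub>?L\<^esub> y = y \<otimes>\<^bsub>?L\<^esub> x"
      using x y S_mult by (simp add: mult_frac m_comm)
    fix z assume "z \<in> carrier ?L"
    then obtain c r where z: "c \<in> carrier R" "r \<in> S" "z = frac c r" by (rule loc_cases)
    show "x \<otimes>\<^bsub>?L\<^esub> y \<otimes>\<^bsub>?L\<^esub> z = x \<otimes>\<^bsub>?L\<^esub> (y \<otimes>\<^bsub>?L\<^esub> z)"
      using x y z S_mult by (simp add: mult_frac m_assoc)
  qed
  fix x y z assume "x \<in> carrier ?L" "y \<in> carrier ?L" "z \<in> carrier ?L"
  obtain a s where x: "a \<in> carrier R" "s \<in> S" "x = frac a s" using \<open>x \<in> carrier ?L\<close> by (rule loc_cases)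
  obtain b t where y: "b \<in> carrier R" "t \<in> S" "y = frac b t" using \<open>y \<in> carrier ?L\<close> by (rule loc_cases)
  obtain c r where z: "c \<in> carrier R" "r \<in> S" "z = frac c r" using \<open>z \<in> carrier ?L\<close> by (rule loc_cases)
  have cc: "s \<in> carrier R" "t \<in> carrier R" "r \<in> carrier R" using x y z by auto
  have xz: "x \<otimes>\<^bsub>?L\<^esub> z = frac (t \<otimes> (a \<otimes> c)) (s \<otimes> t \<otimes> r)"
  proof -
    have "frac (t \<otimes> (a \<otimes> c)) (t \<otimes> (s \<otimes> r)) = frac (a \<otimes> c) (s \<otimes> r)"
      using x y z S_mult by (intro frac_cancel) auto
    moreover have "t \<otimes> (s \<otimes> r) = s \<otimes> t \<otimes> r" using cc by algebra
    ultimately show ?thesis using x z by (simp add: mult_frac)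
  qed
  have yz: "y \<otimes>\<^bsub>?L\<^esub> z = frac (s \<otimes> (b \<otimes> c)) (s \<otimes> t \<otimes> r)"
  proof -
    have "frac (s \<otimes> (b \<otimes> c)) (s \<otimes> (t \<otimes> r)) = frac (b \<otimes> c) (t \<otimes> r)"
      using x y z S_mult by (intro frac_cancel) auto
    then show ?thesis using y z cc by (simp add: mult_frac m_assoc)
  qed
  have "(t \<otimes> a \<oplus> s \<otimes> b) \<otimes> c = t \<otimes> (a \<otimes> c) \<oplus> s \<otimes> (b \<otimes> c)"
    using cc x(1) y(1) z(1) by algebra
  then show "(x \<oplus>\<^bsub>?L\<^esub> y) \<otimes>\<^bsub>?L\<^esub> z = x \<otimes>\<^bsub>?L\<^esub> z \<oplus>\<^bsub>?L\<^esub> y \<otimes>\<^bsub>?L\<^esub> z"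
    unfolding xz yz using x y z cc S_mult by (subst add_frac_same_denom) (auto simp: add_frac mult_frac)
qed

text \<open>
  The common reason for two fields: the fraction field of a domain, where every element outside \<open>S\<close> is
  zero, and the localization of \<open>R\<close> at a prime that is killed by a single element outside it.
\<close>

lemma localization_field:
  assumes inv_or_killed: "\<And>a. a \<in> carrier R \<Longrightarrow> a \<in> S \<or> (\<exists>u\<in>S. u \<otimes> a = \<zero>)"
    and "\<zero> \<notin> S"
  shows "field (localization R S)"
proof -
  let ?L = "localization R S"
  interpret L: cring ?L by (rule localization_cring)
  have one_ne: "\<one>\<^bsub>?L\<^esub> \<noteq> \<zero>\<^bsub>?L\<^esub>"
    using frac_eq_zero_iff[of \<one> \<one>] S_one assms(2) by (auto simp: one_loc)
  have "x \<in> Units ?L \<longleftrightarrow> x \<in> carrier ?L - {\<zero>\<^bsub>?L\<^esub>}" for x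
  proof
    assume x: "x \<in> Units ?L"
    have "x \<noteq> \<zero>\<^bsub>?L\<^esub>" using x one_ne by (metis L.Units_r_inv_ex L.l_null)
    then show "x \<in> carrier ?L - {\<zero>\<^bsub>?L\<^esub>}" using x L.Units_closed by blast
  next
    assume x: "x \<in> carrier ?L - {\<zero>\<^bsub>?L\<^esub>}"
    then have xc: "x \<in> carrier ?L" by blast
    then obtain a t where a: "a \<in> carrier R" "t \<in> S" "x = frac a t" by (rule loc_cases)
    then have aS: "a \<in> S" using inv_or_killed[of a] frac_eq_zero_iff[of a t] x by auto
    have "frac (a \<otimes> t) (a \<otimes> t) = frac \<one> \<one>"
      using aS a S_one S_mult by (intro frac_eqI) auto
    moreover have "a \<otimes> t = t \<otimes> a" using a by (simp add: m_comm)
    ultimately have "x \<otimes>\<^bsub>?L\<^esub> frac t a = \<one>\<^bsub>?L\<^esub>"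
      using a aS by (simp add: mult_frac one_loc)
    moreover have "frac t a \<in> carrier ?L" using a aS by auto
    ultimately show "x \<in> Units ?L" using xc L.m_comm[of x "frac t a"] unfolding Units_def by auto
  qed
  then show "field ?L" by (intro L.cring_fieldI) blast
qed

lemma localization_map_eq: "localization_map R S a = frac a \<one>"
  by (simp add: localization_map_def)

\<comment> \<open>for \<open>S\<close> of the form \<open>carrier R - p\<close> the premise of this rule simplifies to a conjunction with its conclusion, a loop\<close>
declare S_carr [simp del]

end

context one_dim_unique_minimal_prime begin

lemma complement_mult_subset: "mult_subset R (carrier R - p)"
  using one_notin_p notin_p_mult by unfold_locales auto

interpretation P: mult_subset R "carrier R - p"
  by (rule complement_mult_subset)

interpretation Rp: cring "localization R (carrier R - p)"
  by (rule P.localization_cring)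

text \<open>
  That \<open>x/1\<close> vanishes means that some element outside \<open>p\<close> kills \<open>x\<close>; finite generation of \<open>p\<close> makes this
  element independent of \<open>x\<close>.
\<close>

lemma localized_ideal_zero_iff_p_killed:
  "localized_ideal R p p = {\<zero>\<^bsub>localization_at R p\<^esub>} \<longleftrightarrow> (\<exists>s\<in>carrier R - p. \<forall>x\<in>p. s \<otimes> x = \<zero>)"
proof
  let ?im = "localization_map R (carrier R - p) ` p"
  have im: "?im \<subseteq> carrier (localization R (carrier R - p))"
    using p_carr one_notin_p by (auto simp: P.localization_map_eq)
  assume "localized_ideal R p p = {\<zero>\<^bsub>localization_at R p\<^esub>}"
  then have "?im \<subseteq> {\<zero>\<^bsub>localization R (carrier R - p)\<^esub>}"
    using Rp.genideal_self[OF im] by (simp add: localized_ideal_def localization_at_def)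
  then have "\<exists>s\<in>carrier R - p. s \<otimes> x \<in> {\<zero>}" if "x \<in> p" for x
    using that p_carr[OF that] one_notin_p P.frac_eq_zero_iff[of x \<one>] by (auto simp: P.localization_map_eq)
  then have "\<exists>s\<in>carrier R - p. \<forall>x\<in>p. s \<otimes> x \<in> {\<zero>}"
    by (rule uniform_multiplier[OF p_ideal zeroideal p_prime])
  then show "\<exists>s\<in>carrier R - p. \<forall>x\<in>p. s \<otimes> x = \<zero>" by blast
next
  assume "\<exists>s\<in>carrier R - p. \<forall>x\<in>p. s \<otimes> x = \<zero>"
  then have "P.frac x \<one> = \<zero>\<^bsub>localization R (carrier R - p)\<^esub>" if "x \<in> p" for x
    using that p_carr[OF that] one_notin_p P.frac_eq_zero_iff[of x \<one>] by auto
  then have "localization_map R (carrier R - p) ` p = {\<zero>\<^bsub>localization R (carrier R - p)\<^esub>}"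
    using ideal_zero[OF p_ideal] by (auto simp: P.localization_map_eq)
  then show "localized_ideal R p p = {\<zero>\<^bsub>localization_at R p\<^esub>}"
    using Rp.genideal_zero by (simp add: localized_ideal_def localization_at_def)
qed

text \<open>
  If the localization is a field and \<open>x \<in> p\<close> were not killed, then \<open>x/1\<close> would be a unit, and clearing
  denominators in \<open>(x/1) (b/t) = 1\<close> would put an element \<open>u t\<close> with \<open>u\<close> and \<open>t\<close> outside \<open>p\<close> into \<open>p\<close>.
\<close>

lemma field_localization_iff_p_killed:
  "field (localization_at R p) \<longleftrightarrow> (\<exists>s\<in>carrier R - p. \<forall>x\<in>p. s \<otimes> x = \<zero>)"
  unfolding localization_at_def
proof
  let ?L = "localization R (carrier R - p)"
  assume "field ?L"
  then interpret F: field ?L .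
  have "\<exists>s\<in>carrier R - p. s \<otimes> x \<in> {\<zero>}" if x: "x \<in> p" for x
  proof (rule ccontr)
    assume "\<not> ?thesis"
    then have "P.frac x \<one> \<in> Units ?L"
      using p_carr[OF x] one_notin_p P.frac_eq_zero_iff[of x \<one>] F.field_Units by auto
    then obtain y where "y \<in> carrier ?L" "P.frac x \<one> \<otimes>\<^bsub>?L\<^esub> y = \<one>\<^bsub>?L\<^esub>"
      using Rp.Units_r_inv_ex by blast
    then obtain b t where y: "b \<in> carrier R" "t \<in> carrier R - p" "P.frac (x \<otimes> b) t = P.frac \<one> \<one>"
      using p_carr[OF x] one_notin_p by (auto simp: P.carrier_loc P.mult_frac P.one_loc)
    then obtain u where u: "u \<in> carrier R - p" "u \<otimes> (\<one> \<otimes> (x \<otimes> b)) = u \<otimes> (t \<otimes> \<one>)"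
      using P.frac_eq_iff[of "x \<otimes> b" t \<one> \<one>] p_carr[OF x] one_notin_p by auto
    have "u \<otimes> t = u \<otimes> (x \<otimes> b)" using u y p_carr[OF x] by simp
    also have "\<dots> \<in> p" using ideal_smult[OF p_ideal _ ideal_smult'[OF p_ideal y(1) x]] u(1) by blast
    finally show False using notin_p_mult[OF u(1) y(2)] by blast
  qed
  then have "\<exists>s\<in>carrier R - p. \<forall>x\<in>p. s \<otimes> x \<in> {\<zero>}"
    by (rule uniform_multiplier[OF p_ideal zeroideal p_prime])
  then show "\<exists>s\<in>carrier R - p. \<forall>x\<in>p. s \<otimes> x = \<zero>" by blast
next
  assume "\<exists>s\<in>carrier R - p. \<forall>x\<in>p. s \<otimes> x = \<zero>"
  then show "field (localization R (carrier R - p))"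
    using ideal_zero[OF p_ideal] by (intro P.localization_field) auto
qed

end

section \<open>Base change of modules\<close>

text \<open>
  Closure of \<open>M\<close> under its operations and of \<open>K\<close> under \<open>\<phi>\<close> keeps the bilinear relations inside the free
  group. Then \<open>M \<otimes>\<^sub>D K\<close> is a module over \<open>K\<close>; see \<open>BC_module\<close>.
\<close>

locale base_change_setting = cring K for K (structure) +
  fixes D :: "('d, 'm) ring_scheme" and \<phi> :: "'d \<Rightarrow> 'a" and M :: "('d, 'e, 'n) module_scheme"
  assumes phi_closed: "d \<in> carrier D \<Longrightarrow> \<phi> d \<in> carrier K"
    and M_add_closed: "x \<in> carrier M \<Longrightarrow> y \<in> carrier M \<Longrightarrow> x \<oplus>\<^bsub>M\<^esub> y \<in> carrier M"
    and M_smult_closed: "d \<in> carrier D \<Longrightarrow> x \<in> carrier M \<Longrightarrow> d \<odot>\<^bsub>M\<^esub> x \<in> carrier M"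
begin

abbreviation "FG \<equiv> free_Abelian_group (carrier M \<times> carrier K)"
abbreviation "TK \<equiv> tensor_kernel D M (ring_as_module \<phi> K)"
abbreviation "act k \<equiv> frag_extend (\<lambda>(x, z). frag_of (x, k \<otimes> z))"
abbreviation "BC \<equiv> base_change D \<phi> K M"

lemma TK_def: "TK = generate FG (tensor_relations D M (ring_as_module \<phi> K))"
  by (simp add: tensor_kernel_def ring_as_module_def)

lemma relations_def: "tensor_relations D M (ring_as_module \<phi> K) =
     {frag_of (x \<oplus>\<^bsub>M\<^esub> y, z) - frag_of (x, z) - frag_of (y, z) | x y z.
        x \<in> carrier M \<and> y \<in> carrier M \<and> z \<in> carrier K} \<union>
     {frag_of (x, y \<oplus> z) - frag_of (x, y) - frag_of (x, z) | x y z.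
        x \<in> carrier M \<and> y \<in> carrier K \<and> z \<in> carrier K} \<union>
     {frag_of (d \<odot>\<^bsub>M\<^esub> x, z) - frag_of (x, \<phi> d \<otimes> z) | d x z.
        d \<in> carrier D \<and> x \<in> carrier M \<and> z \<in> carrier K}"
  by (simp add: tensor_relations_def ring_as_module_def)

lemma carrier_FG_diff: "a \<in> carrier FG \<Longrightarrow> b \<in> carrier FG \<Longrightarrow> a - b \<in> carrier FG"
  and carrier_FG_add: "a \<in> carrier FG \<Longrightarrow> b \<in> carrier FG \<Longrightarrow> a + b \<in> carrier FG"
  using keys_diff[of a b] keys_add[of a b] by auto

lemma FG_induct [consumes 1, case_names zero diff gen]:
  assumes "c \<in> carrier FG" "P 0"
    and "\<And>a b. a \<in> carrier FG \<Longrightarrow> b \<in> carrier FG \<Longrightarrow> P a \<Longrightarrow> P b \<Longrightarrow> P (a - b)"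
    and "\<And>x z. x \<in> carrier M \<Longrightarrow> z \<in> carrier K \<Longrightarrow> P (frag_of (x, z))"
  shows "P c"
proof (rule free_Abelian_group_induct[of c "carrier M \<times> carrier K"])
  show "Poly_Mapping.keys c \<subseteq> carrier M \<times> carrier K" using assms(1) by simp
  show "P (frag_of y)" if "y \<in> carrier M \<times> carrier K" for y using that assms(4) by auto
qed (use assms(2,3) in simp_all)

lemma relations_carrier: "tensor_relations D M (ring_as_module \<phi> K) \<subseteq> carrier FG"
  unfolding relations_def
  by (intro Un_least subsetI; elim CollectE exE conjE; hypsubst; intro carrier_FG_diff)
    (simp_all add: M_add_closed M_smult_closed phi_closed)

lemma TK_subgroup: "subgroup TK FG"
  unfolding TK_def by (rule group.generate_is_subgroup[OF group_free_Abelian_group relations_carrier])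

lemma TK_carrier: "TK \<subseteq> carrier FG"
  and TK_zero: "0 \<in> TK"
  and TK_add: "a \<in> TK \<Longrightarrow> b \<in> TK \<Longrightarrow> a + b \<in> TK"
  and TK_uminus: "a \<in> TK \<Longrightarrow> - a \<in> TK"
  and TK_diff: "a \<in> TK \<Longrightarrow> b \<in> TK \<Longrightarrow> a - b \<in> TK"
proof -
  note s = TK_subgroup
  show sub: "TK \<subseteq> carrier FG" using subgroup.subset[OF s] .
  show "0 \<in> TK" using subgroup.one_closed[OF s] by simp
  show add: "a + b \<in> TK" if "a \<in> TK" "b \<in> TK" for a b using subgroup.m_closed[OF s that] by simp
  show um: "- a \<in> TK" if "a \<in> TK" for a
    using subgroup.m_inv_closed[OF s that] subsetD[OF sub that] by simp
  show "a - b \<in> TK" if "a \<in> TK" "b \<in> TK" for a b using add[OF that(1) um[OF that(2)]] by simp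
qed

lemma TK_rel: "c \<in> tensor_relations D M (ring_as_module \<phi> K) \<Longrightarrow> c \<in> TK"
  unfolding TK_def by (rule generate.incl)

lemma TK_add_left: "x \<in> carrier M \<Longrightarrow> y \<in> carrier M \<Longrightarrow> z \<in> carrier K \<Longrightarrow>
    frag_of (x \<oplus>\<^bsub>M\<^esub> y, z) - frag_of (x, z) - frag_of (y, z) \<in> TK"
  by (rule TK_rel, unfold relations_def) blast

lemma TK_add_right: "x \<in> carrier M \<Longrightarrow> y \<in> carrier K \<Longrightarrow> z \<in> carrier K \<Longrightarrow>
    frag_of (x, y \<oplus> z) - frag_of (x, y) - frag_of (x, z) \<in> TK"
  by (rule TK_rel, unfold relations_def) blast

lemma TK_scalar: "d \<in> carrier D \<Longrightarrow> x \<in> carrier M \<Longrightarrow> z \<in> carrier K \<Longrightarrow>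
    frag_of (d \<odot>\<^bsub>M\<^esub> x, z) - frag_of (x, \<phi> d \<otimes> z) \<in> TK"
  by (rule TK_rel, unfold relations_def) blast

lemma act_carrier:
  assumes "k \<in> carrier K" "c \<in> carrier FG"
  shows "act k c \<in> carrier FG"
  using assms(2)
proof (induction c rule: FG_induct)
  case (diff a b)
  then show ?case unfolding frag_extend_diff by (intro carrier_FG_diff)
qed (use assms(1) in simp_all)

text \<open>
  A scalar of \<open>K\<close> multiplies second components and takes each bilinear relation to another one. This is
  why its action passes to \<open>M \<otimes>\<^sub>D K\<close>.
\<close>

lemma act_TK:
  assumes k: "k \<in> carrier K" and c: "c \<in> TK"
  shows "act k c \<in> TK"
proof -
  have rel: "act k h \<in> TK" if "h \<in> tensor_relations D M (ring_as_module \<phi> K)" for h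
    using that unfolding relations_def
  proof (elim UnE CollectE exE conjE)
    fix x y z assume "h = frag_of (x \<oplus>\<^bsub>M\<^esub> y, z) - frag_of (x, z) - frag_of (y, z)"
      "x \<in> carrier M" "y \<in> carrier M" "z \<in> carrier K"
    then show ?thesis using TK_add_left k by (simp add: frag_extend_diff)
  next
    fix x y z assume "h = frag_of (x, y \<oplus> z) - frag_of (x, y) - frag_of (x, z)"
      "x \<in> carrier M" "y \<in> carrier K" "z \<in> carrier K"
    then show ?thesis using TK_add_right[of x "k \<otimes> y" "k \<otimes> z"] k by (simp add: frag_extend_diff r_distr)
  next
    fix d x z assume h: "h = frag_of (d \<odot>\<^bsub>M\<^esub> x, z) - frag_of (x, \<phi> d \<otimes> z)"
      "d \<in> carrier D" "x \<in> carrier M" "z \<in> carrier K"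
    have "k \<otimes> (\<phi> d \<otimes> z) = \<phi> d \<otimes> (k \<otimes> z)" using h k phi_closed by (simp add: m_lcomm)
    then show ?thesis using TK_scalar[of d x "k \<otimes> z"] h k by (simp add: frag_extend_diff)
  qed
  show ?thesis
    using c unfolding TK_def
  proof (induction rule: generate.induct)
    case one
    then show ?case using TK_zero by (simp add: TK_def)
  next
    case (incl h)
    then show ?case using rel by (simp add: TK_def)
  next
    case (inv h)
    have "h \<in> carrier FG" using inv relations_carrier by blast
    then have "inv\<^bsub>FG\<^esub> h = - h" by simp
    then show ?case using TK_uminus[OF rel[OF inv]] unfolding TK_def by (simp add: frag_extend_minus)
  next
    case (eng h1 h2)
    then show ?case using TK_add unfolding TK_def by (simp add: frag_extend_add)
  qed
qed

lemma coset_eq_iff: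
  assumes "c \<in> carrier FG" "c' \<in> carrier FG"
  shows "TK #>\<^bsub>FG\<^esub> c = TK #>\<^bsub>FG\<^esub> c' \<longleftrightarrow> c - c' \<in> TK"
proof -
  have co: "TK #>\<^bsub>FG\<^esub> b = {h + b | h. h \<in> TK}" for b by (auto simp: r_coset_def)
  show ?thesis
  proof
    assume eq: "TK #>\<^bsub>FG\<^esub> c = TK #>\<^bsub>FG\<^esub> c'"
    have "0 + c \<in> TK #>\<^bsub>FG\<^esub> c" unfolding co using TK_zero by blast
    then obtain h where "h \<in> TK" "c = h + c'" using eq unfolding co by auto
    then show "c - c' \<in> TK" by simp
  next
    assume d: "c - c' \<in> TK"
    have "h + c = (h + (c - c')) + c'" "h + c' = (h - (c - c')) + c" for h by simp_all
    then show "TK #>\<^bsub>FG\<^esub> c = TK #>\<^bsub>FG\<^esub> c'" unfolding co using TK_add[OF _ d] TK_diff[OF _ d] by blast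
  qed
qed

lemma BC_simps:
  "carrier BC = (\<lambda>c. TK #>\<^bsub>FG\<^esub> c) ` carrier FG" "\<zero>\<^bsub>BC\<^esub> = TK" "add BC = set_mult FG"
  "k \<odot>\<^bsub>BC\<^esub> A = (\<Union>c\<in>A. TK #>\<^bsub>FG\<^esub> act k c)"
  by (auto simp: base_change_def Let_def RCOSETS_def)

lemma BC_smult:
  assumes k: "k \<in> carrier K" and c: "c \<in> carrier FG"
  shows "k \<odot>\<^bsub>BC\<^esub> (TK #>\<^bsub>FG\<^esub> c) = TK #>\<^bsub>FG\<^esub> act k c"
proof -
  have co: "TK #>\<^bsub>FG\<^esub> c = {h + c | h. h \<in> TK}" by (auto simp: r_coset_def)
  have "TK #>\<^bsub>FG\<^esub> act k b = TK #>\<^bsub>FG\<^esub> act k c" if b: "b \<in> TK #>\<^bsub>FG\<^esub> c" for b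
  proof -
    obtain h where h: "h \<in> TK" "b = h + c" using b co by blast
    have bc: "b \<in> carrier FG" unfolding h(2) using carrier_FG_add[OF subsetD[OF TK_carrier h(1)] c] .
    have "act k b - act k c = act k h" unfolding h(2) by (simp add: frag_extend_add)
    then show ?thesis
      using coset_eq_iff[OF act_carrier[OF k bc] act_carrier[OF k c]] act_TK[OF k h(1)] by simp
  qed
  moreover have "c \<in> TK #>\<^bsub>FG\<^esub> c" unfolding co using TK_zero by force
  ultimately show ?thesis unfolding BC_simps by blast
qed

lemma BC_add:
  assumes "c \<in> carrier FG" "c' \<in> carrier FG"
  shows "(TK #>\<^bsub>FG\<^esub> c) \<oplus>\<^bsub>BC\<^esub> (TK #>\<^bsub>FG\<^esub> c') = TK #>\<^bsub>FG\<^esub> (c + c')"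
proof -
  have "TK \<lhd> FG" using comm_group.subgroup_imp_normal[OF abelian_free_Abelian_group TK_subgroup] .
  from normal.rcos_sum[OF this assms] show ?thesis unfolding BC_simps by simp
qed

lemma BC_module: "module K BC"
proof (rule moduleI)
  show "cring K" by unfold_locales
  interpret Q: comm_group "FG Mod TK"
    using comm_group.abelian_FactGroup[OF abelian_free_Abelian_group TK_subgroup] .
  have Q_eq: "carrier BC = carrier (FG Mod TK)" "add BC = monoid.mult (FG Mod TK)" "\<zero>\<^bsub>BC\<^esub> = \<one>\<^bsub>FG Mod TK\<^esub>"
    by (simp_all add: base_change_def Let_def FactGroup_def)
  show "abelian_group BC"
    by (rule abelian_groupI; unfold Q_eq)
      (fact Q.m_closed Q.one_closed Q.m_assoc Q.m_comm Q.l_one Q.l_inv_ex)+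
  show "k \<odot>\<^bsub>BC\<^esub> A \<in> carrier BC" if "k \<in> carrier K" "A \<in> carrier BC" for k A
    using that BC_smult act_carrier unfolding BC_simps(1) by (auto simp del: carrier_free_Abelian_group_iff)
  show "k \<odot>\<^bsub>BC\<^esub> (A \<oplus>\<^bsub>BC\<^esub> B) = k \<odot>\<^bsub>BC\<^esub> A \<oplus>\<^bsub>BC\<^esub> k \<odot>\<^bsub>BC\<^esub> B"
    if k: "k \<in> carrier K" and A: "A \<in> carrier BC" "B \<in> carrier BC" for k A B
  proof -
    obtain a b where ab: "a \<in> carrier FG" "b \<in> carrier FG" "A = TK #>\<^bsub>FG\<^esub> a" "B = TK #>\<^bsub>FG\<^esub> b"
      using A unfolding BC_simps(1) by blast
    show ?thesis unfolding ab(3,4) BC_add[OF ab(1,2)] BC_smult[OF k ab(1)] BC_smult[OF k ab(2)]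
        BC_smult[OF k carrier_FG_add[OF ab(1,2)]]
        BC_add[OF act_carrier[OF k ab(1)] act_carrier[OF k ab(2)]] frag_extend_add ..
  qed
  show "(k \<oplus> l) \<odot>\<^bsub>BC\<^esub> A = k \<odot>\<^bsub>BC\<^esub> A \<oplus>\<^bsub>BC\<^esub> l \<odot>\<^bsub>BC\<^esub> A"
    if k: "k \<in> carrier K" "l \<in> carrier K" and A: "A \<in> carrier BC" for k l A
  proof -
    obtain a where a: "a \<in> carrier FG" "A = TK #>\<^bsub>FG\<^esub> a" using A unfolding BC_simps(1) by blast
    have kl: "k \<oplus> l \<in> carrier K" using k by simp
    have "act (k \<oplus> l) a - (act k a + act l a) \<in> TK" using a(1)
    proof (induction a rule: FG_induct)
      case (diff x y)
      have "act (k \<oplus> l) (x - y) - (act k (x - y) + act l (x - y)) =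
          (act (k \<oplus> l) x - (act k x + act l x)) - (act (k \<oplus> l) y - (act k y + act l y))"
        by (simp add: frag_extend_diff)
      then show ?case using TK_diff[OF diff(3,4)] by simp
    next
      case (gen x z)
      then show ?case using TK_add_right[of x "k \<otimes> z" "l \<otimes> z"] k by (simp add: l_distr diff_diff_eq)
    qed (simp add: TK_zero)
    then show ?thesis
      unfolding a(2) BC_smult[OF kl a(1)] BC_smult[OF k(1) a(1)] BC_smult[OF k(2) a(1)]
        BC_add[OF act_carrier[OF k(1) a(1)] act_carrier[OF k(2) a(1)]]
      by (subst coset_eq_iff[OF act_carrier[OF kl a(1)]
            carrier_FG_add[OF act_carrier[OF k(1) a(1)] act_carrier[OF k(2) a(1)]]])
  qed
  show "(k \<otimes> l) \<odot>\<^bsub>BC\<^esub> A = k \<odot>\<^bsub>BC\<^esub> (l \<odot>\<^bsub>BC\<^esub> A)"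
    if k: "k \<in> carrier K" "l \<in> carrier K" and A: "A \<in> carrier BC" for k l A
  proof -
    obtain a where a: "a \<in> carrier FG" "A = TK #>\<^bsub>FG\<^esub> a" using A unfolding BC_simps(1) by blast
    have kl: "k \<otimes> l \<in> carrier K" using k by simp
    have "act (k \<otimes> l) a = act k (act l a)" using a(1)
    proof (induction a rule: FG_induct)
      case (diff x y)
      then show ?case by (simp add: frag_extend_diff)
    next
      case (gen x z)
      then show ?case using k by (auto simp: m_assoc)
    qed simp
    then show ?thesis
      unfolding a(2) BC_smult[OF kl a(1)] BC_smult[OF k(2) a(1)]
        BC_smult[OF k(1) act_carrier[OF k(2) a(1)]] by simp
  qed
  show "\<one> \<odot>\<^bsub>BC\<^esub> A = A" if A: "A \<in> carrier BC" for A
  proof -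
    obtain a where a: "a \<in> carrier FG" "A = TK #>\<^bsub>FG\<^esub> a" using A unfolding BC_simps(1) by blast
    have "act \<one> a = a" using a(1)
    proof (induction a rule: FG_induct)
      case (diff x y)
      then show ?case by (simp add: frag_extend_diff)
    qed auto
    then show ?thesis unfolding a(2) BC_smult[OF one_closed a(1)] by simp
  qed
qed

lemma BC_trivial_iff: "carrier BC = {\<zero>\<^bsub>BC\<^esub>} \<longleftrightarrow> TK = carrier FG"
proof -
  have zero: "TK #>\<^bsub>FG\<^esub> 0 = TK" by (auto simp: r_coset_def)
  have "TK #>\<^bsub>FG\<^esub> c = TK \<longleftrightarrow> c \<in> TK" if "c \<in> carrier FG" for c
    using coset_eq_iff[OF that, of 0] zero by simp
  then have "(\<forall>A\<in>carrier BC. A = TK) \<longleftrightarrow> carrier FG \<subseteq> TK" unfolding BC_simps(1) by blast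
  moreover have "TK \<in> carrier BC"
    unfolding BC_simps(1) using zero by (intro image_eqI[of _ _ 0]) simp_all
  ultimately show ?thesis using TK_carrier unfolding BC_simps(2) by blast
qed

lemma TK_eq_carrier_iff:
  "TK = carrier FG \<longleftrightarrow> (\<forall>x\<in>carrier M. \<forall>z\<in>carrier K. frag_of (x, z) \<in> TK)"
proof
  assume all: "\<forall>x\<in>carrier M. \<forall>z\<in>carrier K. frag_of (x, z) \<in> TK"
  have "c \<in> TK" if "c \<in> carrier FG" for c
    using that
  proof (induction c rule: FG_induct)
    case (diff x y)
    then show ?case using TK_diff by blast
  qed (use all TK_zero in auto)
  then show "TK = carrier FG" using TK_carrier by blast
qed auto

end

text \<open>
  The dimension is the least size of a generating set, and the empty set generates only the zero space.
\<close>

lemma vs_dim_zero_iff: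
  assumes "vectorspace k V"
  shows "vs_dim k V = 0 \<longleftrightarrow> carrier V = {\<zero>\<^bsub>V\<^esub>}"
proof -
  interpret V: vectorspace k V by fact
  have span: "V.span {} = {\<zero>\<^bsub>V\<^esub>}" by (rule V.span_empty)
  show ?thesis
  proof
    assume "vs_dim k V = 0"
    then have fd: "V.fin_dim" and dim: "V.dim = 0"
      by (auto simp: vs_dim_def zero_enat_def split: if_splits)
    have "\<exists>n A. finite A \<and> card A = n \<and> A \<subseteq> carrier V \<and> V.gen_set A"
      using fd by (auto simp: V.fin_dim_def)
    from LeastI_ex[OF this] obtain A where "finite A" "card A = V.dim" "V.gen_set A"
      unfolding V.dim_def by blast
    then show "carrier V = {\<zero>\<^bsub>V\<^esub>}" using dim span by simp
  next
    assume c: "carrier V = {\<zero>\<^bsub>V\<^esub>}"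
    then have g: "V.gen_set {}" using span by simp
    have "V.fin_dim" unfolding V.fin_dim_def using g by (intro exI[of _ "{}"]) simp
    moreover have "V.dim = 0"
      unfolding V.dim_def using g by (intro Least_eq_0 exI[of _ "{}"]) simp
    ultimately show "vs_dim k V = 0" by (simp add: vs_dim_def zero_enat_def)
  qed
qed

section \<open>The conormal module and its rank\<close>

lemma (in cring) a_coset_eq_iff:
  assumes "ideal I R" "a \<in> carrier R" "b \<in> carrier R"
  shows "I +> a = I +> b \<longleftrightarrow> a \<ominus> b \<in> I"
  using quotient_eq_iff_same_a_r_cos[OF assms] by blast

lemma (in cring) a_coset_eq_self_iff:
  assumes "ideal I R" "a \<in> carrier R"
  shows "I +> a = I \<longleftrightarrow> a \<in> I"
proof -
  have "I +> \<zero> = I" using a_rcos_zero[OF assms(1) ideal_zero[OF assms(1)]] .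
  then show ?thesis using a_coset_eq_iff[OF assms zero_closed] assms(2) by (simp add: a_minus_def)
qed

lemma (in domain) nonzero_mult_subset: "mult_subset R (carrier R - {\<zero>})"
  by unfold_locales (auto simp: integral_iff)

lemma (in domain) fraction_field_is_field: "field (fraction_field R)"
proof -
  interpret N: mult_subset R "carrier R - {\<zero>}" by (rule nonzero_mult_subset)
  show ?thesis unfolding fraction_field_def by (rule N.localization_field) (use N.S_one in auto)
qed

context one_dim_unique_minimal_prime begin

abbreviation "D \<equiv> R Quot p"
abbreviation "CM \<equiv> conormal_module R p"

lemma p_square_ideal: "ideal (p \<cdot> p) R"
  by (rule ideal_prod_is_ideal[OF p_ideal p_ideal])

lemma D_simps:
  "carrier D = (\<lambda>x. p +> x) ` carrier R" "\<zero>\<^bsub>D\<^esub> = p" "\<one>\<^bsub>D\<^esub> = p +> \<one>"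
  "\<lbrakk>a \<in> carrier R; b \<in> carrier R\<rbrakk> \<Longrightarrow> (p +> a) \<otimes>\<^bsub>D\<^esub> (p +> b) = p +> (a \<otimes> b)"
  "\<lbrakk>a \<in> carrier R; b \<in> carrier R\<rbrakk> \<Longrightarrow> (p +> a) \<oplus>\<^bsub>D\<^esub> (p +> b) = p +> (a \<oplus> b)"
  using ideal.rcoset_mult_add[OF p_ideal] ideal.a_rcos_sum[OF p_ideal]
  by (auto simp: FactRing_def A_RCOSETS_def')

lemma D_nonzero_iff: "d \<in> carrier D - {\<zero>\<^bsub>D\<^esub>} \<longleftrightarrow> (\<exists>s\<in>carrier R - p. d = p +> s)"
  using a_coset_eq_self_iff[OF p_ideal] by (auto simp: D_simps(1,2))

lemma D_nonzero_eq: "carrier D - {\<zero>\<^bsub>D\<^esub>} = (\<lambda>s. p +> s) ` (carrier R - p)"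
  using D_nonzero_iff by blast

lemma CM_simps:
  "carrier CM = (\<lambda>x. p \<cdot> p +> x) ` p" "\<zero>\<^bsub>CM\<^esub> = p \<cdot> p"
  "\<lbrakk>x \<in> p; y \<in> p\<rbrakk> \<Longrightarrow> (p \<cdot> p +> x) \<oplus>\<^bsub>CM\<^esub> (p \<cdot> p +> y) = p \<cdot> p +> (x \<oplus> y)"
proof -
  show "carrier CM = (\<lambda>x. p \<cdot> p +> x) ` p" "\<zero>\<^bsub>CM\<^esub> = p \<cdot> p"
    by (auto simp: conormal_module_def A_RCOSETS_def' a_r_coset_def' )
  show "(p \<cdot> p +> x) \<oplus>\<^bsub>CM\<^esub> (p \<cdot> p +> y) = p \<cdot> p +> (x \<oplus> y)" if "x \<in> p" "y \<in> p" for x y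
    using ideal.a_rcos_sum[OF p_square_ideal p_carr[OF that(1)] p_carr[OF that(2)]] by (simp add: conormal_module_def)
qed

text \<open>
  The scalar product is a union over all representatives. It is a single coset because changing
  \<open>r\<close> by \<open>p\<close> or \<open>x\<close> by \<open>p\<^sup>2\<close> changes \<open>r x\<close> by an element of \<open>p\<^sup>2\<close>.
\<close>

lemma CM_smult:
  assumes r: "r \<in> carrier R" and x: "x \<in> p"
  shows "(p +> r) \<odot>\<^bsub>CM\<^esub> (p \<cdot> p +> x) = p \<cdot> p +> (r \<otimes> x)"
proof -
  have "p \<cdot> p +> (r' \<otimes> x') = p \<cdot> p +> (r \<otimes> x)" if h: "r' \<in> p +> r" "x' \<in> p \<cdot> p +> x" for r' x'
  proof -
    obtain q where q: "q \<in> p" "r' = q \<oplus> r" using h(1) by (auto simp: a_r_coset_def')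
    obtain w where w: "w \<in> p \<cdot> p" "x' = w \<oplus> x" using h(2) by (auto simp: a_r_coset_def')
    have c: "q \<in> carrier R" "w \<in> carrier R" "x \<in> carrier R" using q w x p_carr ideal_carr[OF p_square_ideal] by auto
    have "r' \<otimes> x' \<ominus> r \<otimes> x = (q \<oplus> r) \<otimes> w \<oplus> q \<otimes> x" unfolding q(2) w(2) using c r by algebra
    also have "\<dots> \<in> p \<cdot> p"
      using ideal_add[OF p_square_ideal ideal_smult[OF p_square_ideal _ w(1)] ideal_prod.prod[OF q(1) x]] c r by simp
    finally show ?thesis using a_coset_eq_iff[OF p_square_ideal] q w c r by simp
  qed
  moreover have "r \<in> p +> r" "x \<in> p \<cdot> p +> x"
    using ideal_zero[OF p_ideal] ideal_zero[OF p_square_ideal] r p_carr[OF x] by (force simp: a_r_coset_def')+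
  ultimately have "(\<Union>a\<in>p +> r. \<Union>b\<in>p \<cdot> p +> x. p \<cdot> p +> (a \<otimes> b)) = p \<cdot> p +> (r \<otimes> x)" by blast
  then show ?thesis by (simp add: conormal_module_def rcoset_mult_def)
qed

lemma torsion_conormal_iff_elementwise:
  "torsion_module D CM \<longleftrightarrow> (\<forall>x\<in>p. \<exists>s\<in>carrier R - p. s \<otimes> x \<in> p \<cdot> p)"
proof -
  have "(\<exists>d\<in>carrier D - {\<zero>\<^bsub>D\<^esub>}. d \<odot>\<^bsub>CM\<^esub> (p \<cdot> p +> x) = \<zero>\<^bsub>CM\<^esub>) \<longleftrightarrow> (\<exists>s\<in>carrier R - p. s \<otimes> x \<in> p \<cdot> p)"
    if x: "x \<in> p" for x
  proof -
    have "(\<exists>d\<in>carrier D - {\<zero>\<^bsub>D\<^esub>}. d \<odot>\<^bsub>CM\<^esub> (p \<cdot> p +> x) = \<zero>\<^bsub>CM\<^esub>) \<longleftrightarrow>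
      (\<exists>s\<in>carrier R - p. (p +> s) \<odot>\<^bsub>CM\<^esub> (p \<cdot> p +> x) = \<zero>\<^bsub>CM\<^esub>)"
      unfolding D_nonzero_eq by (rule bex_simps)
    also have "\<dots> \<longleftrightarrow> (\<exists>s\<in>carrier R - p. s \<otimes> x \<in> p \<cdot> p)"
      using CM_smult[OF _ x] a_coset_eq_self_iff[OF p_square_ideal] p_carr[OF x] by (simp add: CM_simps(2))
    finally show ?thesis .
  qed
  then have "(\<forall>x\<in>p. \<exists>d\<in>carrier D - {\<zero>\<^bsub>D\<^esub>}. d \<odot>\<^bsub>CM\<^esub> (p \<cdot> p +> x) = \<zero>\<^bsub>CM\<^esub>) \<longleftrightarrow>
      (\<forall>x\<in>p. \<exists>s\<in>carrier R - p. s \<otimes> x \<in> p \<cdot> p)"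
    by (rule ball_cong[OF refl])
  then show ?thesis unfolding torsion_module_def CM_simps(1) ball_simps .
qed

lemma torsion_conormal_iff:
  "torsion_module D CM \<longleftrightarrow> (\<exists>s\<in>carrier R - p. \<forall>x\<in>p. s \<otimes> x \<in> p \<cdot> p)"
  unfolding torsion_conormal_iff_elementwise
  using uniform_multiplier[OF p_ideal p_square_ideal p_prime] by blast

interpretation Dd: domain D
  by (rule primeideal.quotient_is_domain[OF p_prime])

interpretation N: mult_subset D "carrier D - {\<zero>\<^bsub>D\<^esub>}"
  by (rule Dd.nonzero_mult_subset)

interpretation P: mult_subset R "carrier R - p"
  by (rule complement_mult_subset)

lemma fraction_field_cases:
  assumes "z \<in> carrier (fraction_field D)"
  obtains a b where "a \<in> carrier R" "b \<in> carrier R - p" "z = N.frac (p +> a) (p +> b)"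
proof -
  obtain A B where "A \<in> carrier D" "B \<in> carrier D - {\<zero>\<^bsub>D\<^esub>}" "z = N.frac A B"
    using assms N.loc_cases unfolding fraction_field_def by metis
  moreover obtain a where "a \<in> carrier R" "A = p +> a" using \<open>A \<in> carrier D\<close> unfolding D_simps(1) by blast
  moreover obtain b where "b \<in> carrier R - p" "B = p +> b"
    using \<open>B \<in> carrier D - {\<zero>\<^bsub>D\<^esub>}\<close> unfolding D_nonzero_eq by blast
  ultimately show thesis using that by blast
qed

lemma coset_in_D: "a \<in> carrier R \<Longrightarrow> p +> a \<in> carrier D"
  and coset_nonzero_D: "b \<in> carrier R - p \<Longrightarrow> p +> b \<in> carrier D - {\<zero>\<^bsub>D\<^esub>}"
proof -
  show "a \<in> carrier R \<Longrightarrow> p +> a \<in> carrier D" unfolding D_simps(1) by (rule imageI)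
  show "b \<in> carrier R - p \<Longrightarrow> p +> b \<in> carrier D - {\<zero>\<^bsub>D\<^esub>}" using D_nonzero_iff by blast
qed

lemma D_frac_eq:
  assumes "a \<in> carrier R" "b \<in> carrier R - p" "a' \<in> carrier R" "b' \<in> carrier R - p"
    and "N.frac (p +> a) (p +> b) = N.frac (p +> a') (p +> b')"
  shows "b' \<otimes> a \<ominus> b \<otimes> a' \<in> p"
proof -
  obtain U where U: "U \<in> carrier D - {\<zero>\<^bsub>D\<^esub>}"
    "U \<otimes>\<^bsub>D\<^esub> ((p +> b') \<otimes>\<^bsub>D\<^esub> (p +> a)) = U \<otimes>\<^bsub>D\<^esub> ((p +> b) \<otimes>\<^bsub>D\<^esub> (p +> a'))"
    using assms coset_in_D coset_nonzero_D N.frac_eq_iff[of "p +> a" "p +> b" "p +> a'" "p +> b'"] by blast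
  have c: "b \<in> carrier R" "b' \<in> carrier R" using assms by auto
  have "U \<noteq> \<zero>\<^bsub>D\<^esub>" "U \<in> carrier D" using U(1) by auto
  moreover have "(p +> b') \<otimes>\<^bsub>D\<^esub> (p +> a) \<in> carrier D" "(p +> b) \<otimes>\<^bsub>D\<^esub> (p +> a') \<in> carrier D"
    using coset_in_D c assms(1,3) by (simp_all only: Dd.m_closed)
  ultimately have "(p +> b') \<otimes>\<^bsub>D\<^esub> (p +> a) = (p +> b) \<otimes>\<^bsub>D\<^esub> (p +> a')"
    using Dd.m_lcancel U(2) by blast
  then have "p +> (b' \<otimes> a) = p +> (b \<otimes> a')" using c assms(1,3) by (simp only: D_simps(4))
  then show ?thesis
    using a_coset_eq_iff[OF p_ideal, of "b' \<otimes> a" "b \<otimes> a'"] c assms(1,3) by simp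
qed

interpretation B: base_change_setting "fraction_field D" D "fraction_field_map D" CM
proof -
  interpret K: field "fraction_field D" by (rule Dd.fraction_field_is_field)
  show "base_change_setting (fraction_field D) D (fraction_field_map D) CM"
  proof (unfold_locales)
    show "fraction_field_map D d \<in> carrier (fraction_field D)" if "d \<in> carrier D" for d
      using that N.S_one by (simp add: fraction_field_map_def fraction_field_def N.localization_map_eq)
    show "x \<oplus>\<^bsub>CM\<^esub> y \<in> carrier CM" if "x \<in> carrier CM" "y \<in> carrier CM" for x y
      using that CM_simps(3) ideal_add[OF p_ideal] by (auto simp: CM_simps(1))
    show "d \<odot>\<^bsub>CM\<^esub> x \<in> carrier CM" if "d \<in> carrier D" "x \<in> carrier CM" for d x
      using that CM_smult ideal_smult[OF p_ideal] by (auto simp: CM_simps(1) D_simps(1))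
  qed
qed

text \<open>
  The rank is zero exactly if \<open>p/p\<^sup>2 \<otimes>\<^sub>D K\<close> is zero, that is, if all generators of the free group are
  consequences of the bilinear relations.
\<close>

lemma rank_zero_iff:
  "module_rank D CM = 0 \<longleftrightarrow> (\<forall>x\<in>carrier CM. \<forall>z\<in>carrier (fraction_field D). frag_of (x, z) \<in> B.TK)"
proof -
  have "vectorspace (fraction_field D) B.BC"
    using B.BC_module Dd.fraction_field_is_field by (simp add: vectorspace_def)
  from vs_dim_zero_iff[OF this] show ?thesis
    unfolding module_rank_def B.BC_trivial_iff B.TK_eq_carrier_iff .
qed

lemma phi_mult_frac:
  assumes "d \<in> carrier D" "u \<in> carrier D" "v \<in> carrier D - {\<zero>\<^bsub>D\<^esub>}"
  shows "fraction_field_map D d \<otimes>\<^bsub>fraction_field D\<^esub> N.frac u v = N.frac (d \<otimes>\<^bsub>D\<^esub> u) v"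
proof -
  have "fraction_field_map D d \<otimes>\<^bsub>fraction_field D\<^esub> N.frac u v = N.frac (d \<otimes>\<^bsub>D\<^esub> u) (\<one>\<^bsub>D\<^esub> \<otimes>\<^bsub>D\<^esub> v)"
    unfolding fraction_field_map_def fraction_field_def N.localization_map_eq
    using assms N.S_one by (intro N.mult_frac) auto
  then show ?thesis using assms by simp
qed

text \<open>
  If \<open>d\<close> kills \<open>m\<close>, then \<open>m \<otimes> u/v = m \<otimes> d (u/(d v)) = d m \<otimes> u/(d v) = 0\<close>.
\<close>

lemma rank_zero_if_torsion:
  assumes "torsion_module D CM"
  shows "module_rank D CM = 0"
  unfolding rank_zero_iff
proof (intro ballI)
  fix m z assume m: "m \<in> carrier CM" and z: "z \<in> carrier (fraction_field D)"
  obtain d where d: "d \<in> carrier D - {\<zero>\<^bsub>D\<^esub>}" "d \<odot>\<^bsub>CM\<^esub> m = \<zero>\<^bsub>CM\<^esub>"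
    using assms m unfolding torsion_module_def by blast
  obtain u v where uv: "u \<in> carrier D" "v \<in> carrier D - {\<zero>\<^bsub>D\<^esub>}" "z = N.frac u v"
    using z N.loc_cases unfolding fraction_field_def by metis
  have dv: "d \<otimes>\<^bsub>D\<^esub> v \<in> carrier D - {\<zero>\<^bsub>D\<^esub>}" using N.S_mult d(1) uv(2) by blast
  define z' where "z' = N.frac u (d \<otimes>\<^bsub>D\<^esub> v)"
  have z': "z' \<in> carrier (fraction_field D)"
    unfolding z'_def fraction_field_def using uv(1) dv by (rule N.frac_in_carrier)
  have "fraction_field_map D d \<otimes>\<^bsub>fraction_field D\<^esub> z' = z"
    unfolding z'_def uv(3) using phi_mult_frac[of d u] d(1) uv dv N.frac_cancel[OF uv(1,2) d(1)] by simp
  then have 1: "frag_of (\<zero>\<^bsub>CM\<^esub>, z') - frag_of (m, z) \<in> B.TK"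
    using B.TK_scalar[of d m z'] d m z' by simp
  have zero: "\<zero>\<^bsub>CM\<^esub> \<in> carrier CM" "\<zero>\<^bsub>CM\<^esub> \<oplus>\<^bsub>CM\<^esub> \<zero>\<^bsub>CM\<^esub> = \<zero>\<^bsub>CM\<^esub>"
  proof -
    have e: "\<zero>\<^bsub>CM\<^esub> = p \<cdot> p +> \<zero>" unfolding CM_simps(2)
      using a_coset_eq_self_iff[OF p_square_ideal zero_closed] ideal_zero[OF p_square_ideal] by simp
    show "\<zero>\<^bsub>CM\<^esub> \<in> carrier CM" unfolding e CM_simps(1) using ideal_zero[OF p_ideal] by blast
    show "\<zero>\<^bsub>CM\<^esub> \<oplus>\<^bsub>CM\<^esub> \<zero>\<^bsub>CM\<^esub> = \<zero>\<^bsub>CM\<^esub>"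
      unfolding e using CM_simps(3)[of \<zero> \<zero>] ideal_zero[OF p_ideal] by simp
  qed
  have "- frag_of (\<zero>\<^bsub>CM\<^esub>, z') \<in> B.TK" using B.TK_add_left[OF zero(1) zero(1) z'] zero(2) by simp
  then have "- (frag_of (\<zero>\<^bsub>CM\<^esub>, z') - frag_of (m, z)) - (- frag_of (\<zero>\<^bsub>CM\<^esub>, z')) \<in> B.TK"
    using B.TK_diff[OF B.TK_uminus[OF 1]] by blast
  then show "frag_of (m, z) \<in> B.TK" by simp
qed

text \<open>
  The extension of \<open>p\<^sup>2\<close> to the local ring at \<open>p\<close>. The quotient of the local ring by this ideal
  receives \<open>p/p\<^sup>2 \<otimes>\<^sub>D K\<close> by \<open>x \<otimes> a/b \<mapsto> (a x)/b\<close>.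
\<close>

definition localized_square :: "('a \<times> 'a) set set" where
  "localized_square = {P.frac y s | y s. y \<in> p \<cdot> p \<and> s \<in> carrier R - p}"

lemma localized_square_ideal: "ideal localized_square (localization R (carrier R - p))"
proof -
  interpret L: cring "localization R (carrier R - p)" by (rule P.localization_cring)
  note sq_carr = ideal_carr[OF p_square_ideal]
  show ?thesis
  proof (rule L.cring_idealI)
    show "localized_square \<subseteq> carrier (localization R (carrier R - p))"
      unfolding localized_square_def using sq_carr P.frac_in_carrier by blast
    show "\<zero>\<^bsub>localization R (carrier R - p)\<^esub> \<in> localized_square"
      unfolding localized_square_def P.zero_loc using ideal_zero[OF p_square_ideal] one_notin_p by blast
    fix g assume "g \<in> localized_square"
    then obtain y s where g: "y \<in> p \<cdot> p" "s \<in> carrier R - p" "g = P.frac y s" unfolding localized_square_def by blast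
    show "h \<otimes>\<^bsub>localization R (carrier R - p)\<^esub> g \<in> localized_square" if hL: "h \<in> carrier (localization R (carrier R - p))" for h
    proof -
      obtain a b where h: "a \<in> carrier R" "b \<in> carrier R - p" "h = P.frac a b"
        using hL by (rule P.loc_cases)
      have "h \<otimes>\<^bsub>localization R (carrier R - p)\<^esub> g = P.frac (a \<otimes> y) (b \<otimes> s)"
        unfolding h(3) g(3) using h g sq_carr by (intro P.mult_frac) auto
      then show ?thesis
        unfolding localized_square_def using ideal_smult[OF p_square_ideal h(1) g(1)] notin_p_mult[OF h(2) g(2)] by blast
    qed
    fix h assume "h \<in> localized_square"
    then obtain z t where h: "z \<in> p \<cdot> p" "t \<in> carrier R - p" "h = P.frac z t" unfolding localized_square_def by blast
    have "g \<oplus>\<^bsub>localization R (carrier R - p)\<^esub> h = P.frac (t \<otimes> y \<oplus> s \<otimes> z) (s \<otimes> t)"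
      unfolding h(3) g(3) using h g sq_carr by (intro P.add_frac) auto
    moreover have "t \<otimes> y \<oplus> s \<otimes> z \<in> p \<cdot> p"
      using ideal_add[OF p_square_ideal ideal_smult[OF p_square_ideal _ g(1)] ideal_smult[OF p_square_ideal _ h(1)]] g(2) h(2) by blast
    ultimately show "g \<oplus>\<^bsub>localization R (carrier R - p)\<^esub> h \<in> localized_square"
      unfolding localized_square_def using notin_p_mult[OF g(2) h(2)] by blast
  qed
qed

lemma frac_in_localized_square:
  assumes x: "x \<in> carrier R" and "P.frac x \<one> \<in> localized_square"
  shows "\<exists>s\<in>carrier R - p. s \<otimes> x \<in> p \<cdot> p"
proof -
  obtain y s where y: "y \<in> p \<cdot> p" "s \<in> carrier R - p" "P.frac x \<one> = P.frac y s"
    using assms(2) unfolding localized_square_def by blast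
  have yc: "y \<in> carrier R" using ideal_carr[OF p_square_ideal y(1)] .
  obtain u where u: "u \<in> carrier R - p" "u \<otimes> (s \<otimes> x) = u \<otimes> (\<one> \<otimes> y)"
    using y(3) P.frac_eq_iff[OF x one_notin_p yc y(2)] by blast
  have "(u \<otimes> s) \<otimes> x = u \<otimes> y" using u y(2) x yc by (simp add: m_assoc)
  also have "\<dots> \<in> p \<cdot> p" using ideal_smult[OF p_square_ideal _ y(1)] u(1) by blast
  finally show ?thesis using notin_p_mult[OF u(1) y(2)] by blast
qed

text \<open>
  It has to be shown that \<open>x \<otimes> 1 = 0\<close> forces \<open>x\<close> to be torsion. For this the tensor product is mapped to a
  group in which the vanishing can be read off, the additive group of the local ring at \<open>p\<close> modulo
  the extension of \<open>p\<^sup>2\<close>, by \<open>x \<otimes> a/b \<mapsto> (a x)/b\<close>. This value depends only on the class of \<open>x\<close> modulo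
  \<open>p\<^sup>2\<close> and on the fraction \<open>a/b\<close> over \<open>R/p\<close>, because \<open>x \<in> p\<close>. The universal property of the free
  Abelian group extends it to a homomorphism that vanishes on the bilinear relations, hence on the whole
  tensor kernel. So \<open>x/1\<close> lies in the extension of \<open>p\<^sup>2\<close>, which means that \<open>u x \<in> p\<^sup>2\<close> for some \<open>u\<close> outside \<open>p\<close>.
\<close>

lemma torsion_if_rank_zero:
  assumes "module_rank D CM = 0"
  shows "torsion_module D CM"
  unfolding torsion_conormal_iff_elementwise
proof
  fix x0 assume x0: "x0 \<in> p"
  let ?L = "localization R (carrier R - p)"
  interpret L: cring ?L by (rule P.localization_cring)
  interpret J: ideal localized_square ?L by (rule localized_square_ideal)
  interpret Q: ring "?L Quot localized_square" by (rule J.quotient_is_ring)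
  define cs where "cs g = localized_square +>\<^bsub>?L\<^esub> g" for g
  have cs_carrier: "cs g \<in> carrier (?L Quot localized_square)" if "g \<in> carrier ?L" for g
    using that by (auto simp: cs_def FactRing_def A_RCOSETS_def')
  have cs_add: "cs g \<oplus>\<^bsub>?L Quot localized_square\<^esub> cs h = cs (g \<oplus>\<^bsub>?L\<^esub> h)" if "g \<in> carrier ?L" "h \<in> carrier ?L" for g h
    using J.a_rcos_sum[OF that] by (simp add: cs_def FactRing_def)
  have zero_Q: "\<zero>\<^bsub>?L Quot localized_square\<^esub> = localized_square" by (simp add: FactRing_def)
  have cs_zero: "cs g = \<zero>\<^bsub>?L Quot localized_square\<^esub> \<longleftrightarrow> g \<in> localized_square" if "g \<in> carrier ?L" for g
    unfolding cs_def zero_Q by (rule L.a_coset_eq_self_iff[OF localized_square_ideal that])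
  have wd: "cs (P.frac (a \<otimes> x) b) = cs (P.frac (a' \<otimes> x') b')"
    if x: "x \<in> p" "x' \<in> p" "x \<ominus> x' \<in> p \<cdot> p" and a: "a \<in> carrier R" "a' \<in> carrier R"
      and b: "b \<in> carrier R - p" "b' \<in> carrier R - p"
      and eq: "N.frac (p +> a) (p +> b) = N.frac (p +> a') (p +> b')" for x x' a a' b b'
  proof -
    have c: "x \<in> carrier R" "x' \<in> carrier R" "b \<in> carrier R" "b' \<in> carrier R" using x b p_carr by auto
    \<comment> \<open>the numerator of the difference of the two fractions; it lies in \<open>p\<^sup>2\<close>\<close>
    define w where "w = b' \<otimes> (a \<otimes> x) \<ominus> b \<otimes> (a' \<otimes> x')"
    have wc: "w \<in> carrier R" unfolding w_def using c a by simp
    have "w = (b' \<otimes> a \<ominus> b \<otimes> a') \<otimes> x \<oplus> (b \<otimes> a') \<otimes> (x \<ominus> x')"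
      unfolding w_def using c a by algebra
    then have w: "w \<in> p \<cdot> p"
      using ideal_add[OF p_square_ideal ideal_prod.prod[OF D_frac_eq[OF a(1) b(1) a(2) b(2) eq] x(1)]
          ideal_smult[OF p_square_ideal _ x(3)]] c a by simp
    have bb: "b \<otimes> b' \<in> carrier R - p" "b' \<otimes> (b \<otimes> b') \<in> carrier R - p"
      using notin_p_mult b by blast+
    have j: "P.frac w (b \<otimes> b') \<in> localized_square" unfolding localized_square_def using w bb(1) by blast
    have "P.frac (a' \<otimes> x') b' \<oplus>\<^bsub>?L\<^esub> P.frac w (b \<otimes> b') =
        P.frac ((b \<otimes> b') \<otimes> (a' \<otimes> x') \<oplus> b' \<otimes> w) (b' \<otimes> (b \<otimes> b'))"
      using c a wc b bb by (intro P.add_frac) auto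
    also have "(b \<otimes> b') \<otimes> (a' \<otimes> x') \<oplus> b' \<otimes> w = (b' \<otimes> b') \<otimes> (a \<otimes> x)"
      unfolding w_def using c a by algebra
    also have "P.frac ((b' \<otimes> b') \<otimes> (a \<otimes> x)) (b' \<otimes> (b \<otimes> b')) = P.frac ((b' \<otimes> b') \<otimes> (a \<otimes> x)) ((b' \<otimes> b') \<otimes> b)"
    proof -
      have "b' \<otimes> (b \<otimes> b') = (b' \<otimes> b') \<otimes> b" using c by algebra
      then show ?thesis by simp
    qed
    also have "\<dots> = P.frac (a \<otimes> x) b"
      using c a b notin_p_mult[OF b(2) b(2)] by (intro P.frac_cancel) auto
    finally have eq': "P.frac (a \<otimes> x) b = P.frac (a' \<otimes> x') b' \<oplus>\<^bsub>?L\<^esub> P.frac w (b \<otimes> b')" by simp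
    have in_L: "P.frac (a' \<otimes> x') b' \<in> carrier ?L" "P.frac w (b \<otimes> b') \<in> carrier ?L"
      using c a wc b bb by (auto intro!: P.frac_in_carrier)
    have "cs (P.frac (a \<otimes> x) b) = cs (P.frac (a' \<otimes> x') b') \<oplus>\<^bsub>?L Quot localized_square\<^esub> cs (P.frac w (b \<otimes> b'))"
      unfolding eq' cs_add[OF in_L] ..
    also have "cs (P.frac w (b \<otimes> b')) = \<zero>\<^bsub>?L Quot localized_square\<^esub>" using cs_zero[OF in_L(2)] j by blast
    also have "cs (P.frac (a' \<otimes> x') b') \<oplus>\<^bsub>?L Quot localized_square\<^esub> \<zero>\<^bsub>?L Quot localized_square\<^esub> = cs (P.frac (a' \<otimes> x') b')"
      by (rule Q.r_zero[OF cs_carrier[OF in_L(1)]])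
    finally show ?thesis .
  qed
  \<comment> \<open>arbitrary representatives, of a class modulo \<open>p\<^sup>2\<close> and of a fraction over \<open>R/p\<close>\<close>
  define rep where "rep m = (SOME x. x \<in> p \<and> m = p \<cdot> p +> x)" for m
  define nd where "nd z = (SOME ab. fst ab \<in> carrier R \<and> snd ab \<in> carrier R - p \<and>
      z = N.frac (p +> fst ab) (p +> snd ab))" for z
  define f where "f mz = cs (P.frac (fst (nd (snd mz)) \<otimes> rep (fst mz)) (snd (nd (snd mz))))" for mz
  have rep: "rep m \<in> p \<and> m = p \<cdot> p +> rep m" if "m \<in> carrier CM" for m
  proof -
    have "\<exists>x. x \<in> p \<and> m = p \<cdot> p +> x" using that unfolding CM_simps(1) by blast
    then show ?thesis unfolding rep_def by (rule someI_ex)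
  qed
  have nd: "fst (nd z) \<in> carrier R \<and> snd (nd z) \<in> carrier R - p \<and> z = N.frac (p +> fst (nd z)) (p +> snd (nd z))"
    if z: "z \<in> carrier (fraction_field D)" for z
  proof -
    obtain a b where "a \<in> carrier R" "b \<in> carrier R - p" "z = N.frac (p +> a) (p +> b)"
      using fraction_field_cases[OF z] .
    then have "\<exists>ab. fst ab \<in> carrier R \<and> snd ab \<in> carrier R - p \<and> z = N.frac (p +> fst ab) (p +> snd ab)"
      by (intro exI[of _ "(a, b)"]) simp
    then show ?thesis unfolding nd_def by (rule someI_ex)
  qed
  have N_in: "N.frac (p +> a) (p +> b) \<in> carrier (fraction_field D)"
    if "a \<in> carrier R" "b \<in> carrier R - p" for a b
    unfolding fraction_field_def using coset_in_D[OF that(1)] coset_nonzero_D[OF that(2)] by (rule N.frac_in_carrier)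
  have f_eq: "f (p \<cdot> p +> x, N.frac (p +> a) (p +> b)) = cs (P.frac (a \<otimes> x) b)"
    if x: "x \<in> p" and a: "a \<in> carrier R" and b: "b \<in> carrier R - p" for x a b
  proof -
    let ?m = "p \<cdot> p +> x" and ?z = "N.frac (p +> a) (p +> b)"
    have m: "?m \<in> carrier CM" unfolding CM_simps(1) using x by blast
    note r = rep[OF m] and n = nd[OF N_in[OF a b]]
    have "rep ?m \<ominus> x \<in> p \<cdot> p"
      using a_coset_eq_iff[OF p_square_ideal, of "rep ?m" x] r p_carr x by metis
    then show ?thesis unfolding f_def fst_conv snd_conv
      using wd[of "rep ?m" x "fst (nd ?z)" a "snd (nd ?z)" b] r n x a b by metis
  qed
  have f_in: "f ` (carrier CM \<times> carrier (fraction_field D)) \<subseteq> carrier (?L Quot localized_square)"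
  proof
    fix y assume "y \<in> f ` (carrier CM \<times> carrier (fraction_field D))"
    then obtain m z where mz: "m \<in> carrier CM" "z \<in> carrier (fraction_field D)" "y = f (m, z)" by blast
    have "rep m \<in> carrier R" using rep[OF mz(1)] p_carr by blast
    then show "y \<in> carrier (?L Quot localized_square)"
      unfolding mz(3) f_def using nd[OF mz(2)] by (intro cs_carrier P.frac_in_carrier) auto
  qed
  obtain h where h: "h \<in> hom B.FG (add_monoid (?L Quot localized_square))"
    "\<And>w. w \<in> carrier CM \<times> carrier (fraction_field D) \<Longrightarrow> h (frag_of w) = f w"
    using comm_group.free_Abelian_group_universal[OF Q.a_comm_group, of f "carrier CM \<times> carrier (fraction_field D)"] f_in
    by (metis partial_object.select_convs(1))
  interpret gh: group_hom B.FG "add_monoid (?L Quot localized_square)" h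
    using h(1) comm_group.axioms(2)[OF Q.a_comm_group] unfolding group_hom_def group_hom_axioms_def by simp
  have h_add: "h (c + c') = h c \<oplus>\<^bsub>?L Quot localized_square\<^esub> h c'" if "c \<in> carrier B.FG" "c' \<in> carrier B.FG" for c c'
    using gh.hom_mult[OF that] by simp
  have h_in: "h c \<in> carrier (?L Quot localized_square)" if "c \<in> carrier B.FG" for c
    using gh.hom_closed[OF that] by simp
  have h_diff: "h (c - c') = \<zero>\<^bsub>?L Quot localized_square\<^esub>" if "c \<in> carrier B.FG" "c' \<in> carrier B.FG" "h c = h c'" for c c'
  proof -
    have d: "c - c' \<in> carrier B.FG" using B.carrier_FG_diff that by blast
    have "h c = h (c - c') \<oplus>\<^bsub>?L Quot localized_square\<^esub> h c'" using h_add[OF d that(2)] by simp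
    then show ?thesis using Q.add.r_cancel_one'[OF h_in[OF that(2)] h_in[OF d]] that(3) by simp
  qed
  have frag_in: "frag_of (m, z) \<in> carrier B.FG" if "m \<in> carrier CM" "z \<in> carrier (fraction_field D)" for m z
    using that by simp
  have h_TK: "h c = \<zero>\<^bsub>?L Quot localized_square\<^esub>" if "c \<in> B.TK" for c
  proof -
    have rel: "h r = \<zero>\<^bsub>?L Quot localized_square\<^esub>"
      if "r \<in> tensor_relations D CM (ring_as_module (fraction_field_map D) (fraction_field D))" for r
      using that unfolding B.relations_def
    proof (elim UnE CollectE exE conjE)
      fix m m' z assume r: "r = frag_of (m \<oplus>\<^bsub>CM\<^esub> m', z) - frag_of (m, z) - frag_of (m', z)"
        and mz: "m \<in> carrier CM" "m' \<in> carrier CM" "z \<in> carrier (fraction_field D)"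
      obtain x where x: "x \<in> p" "m = p \<cdot> p +> x" using mz(1) unfolding CM_simps(1) by blast
      obtain x' where x': "x' \<in> p" "m' = p \<cdot> p +> x'" using mz(2) unfolding CM_simps(1) by blast
      obtain a b where ab: "a \<in> carrier R" "b \<in> carrier R - p" "z = N.frac (p +> a) (p +> b)"
        using fraction_field_cases[OF mz(3)] .
      have c: "x \<in> carrier R" "x' \<in> carrier R" using x x' p_carr by auto
      have "f (m \<oplus>\<^bsub>CM\<^esub> m', z) = cs (P.frac (a \<otimes> (x \<oplus> x')) b)"
        unfolding x(2) x'(2) ab(3) CM_simps(3)[OF x(1) x'(1)]
        using f_eq[OF ideal_add[OF p_ideal x(1) x'(1)] ab(1,2)] .
      also have "P.frac (a \<otimes> (x \<oplus> x')) b = P.frac (a \<otimes> x) b \<oplus>\<^bsub>?L\<^esub> P.frac (a \<otimes> x') b"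
        using c ab by (simp add: P.add_frac_same_denom r_distr)
      also have "cs \<dots> = f (m, z) \<oplus>\<^bsub>?L Quot localized_square\<^esub> f (m', z)"
        unfolding x(2) x'(2) ab(3) f_eq[OF x(1) ab(1,2)] f_eq[OF x'(1) ab(1,2)]
        using c ab by (intro cs_add[symmetric] P.frac_in_carrier) auto
      finally have "h (frag_of (m \<oplus>\<^bsub>CM\<^esub> m', z)) = h (frag_of (m, z) + frag_of (m', z))"
        using h(2) mz B.M_add_closed h_add frag_in by simp
      then show ?thesis
        unfolding r diff_diff_eq using mz B.M_add_closed
        by (intro h_diff B.carrier_FG_add frag_in) auto
    next
      fix m z z' assume r: "r = frag_of (m, z \<oplus>\<^bsub>fraction_field D\<^esub> z') - frag_of (m, z) - frag_of (m, z')"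
        and mz: "m \<in> carrier CM" "z \<in> carrier (fraction_field D)" "z' \<in> carrier (fraction_field D)"
      obtain x where x: "x \<in> p" "m = p \<cdot> p +> x" using mz(1) unfolding CM_simps(1) by blast
      obtain a b where ab: "a \<in> carrier R" "b \<in> carrier R - p" "z = N.frac (p +> a) (p +> b)"
        using fraction_field_cases[OF mz(2)] .
      obtain a' b' where ab': "a' \<in> carrier R" "b' \<in> carrier R - p" "z' = N.frac (p +> a') (p +> b')"
        using fraction_field_cases[OF mz(3)] .
      have c: "x \<in> carrier R" "b \<in> carrier R" "b' \<in> carrier R" using x p_carr ab ab' by auto
      have "z \<oplus>\<^bsub>fraction_field D\<^esub> z' = N.frac ((p +> b') \<otimes>\<^bsub>D\<^esub> (p +> a) \<oplus>\<^bsub>D\<^esub> (p +> b) \<otimes>\<^bsub>D\<^esub> (p +> a')) ((p +> b) \<otimes>\<^bsub>D\<^esub> (p +> b'))"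
        unfolding ab(3) ab'(3) fraction_field_def
        using coset_in_D[OF ab(1)] coset_nonzero_D[OF ab(2)] coset_in_D[OF ab'(1)] coset_nonzero_D[OF ab'(2)]
        by (rule N.add_frac)
      also have "\<dots> = N.frac (p +> (b' \<otimes> a \<oplus> b \<otimes> a')) (p +> (b \<otimes> b'))"
        using c ab(1) ab'(1) by (simp only: D_simps(4,5) m_closed)
      finally have zz: "z \<oplus>\<^bsub>fraction_field D\<^esub> z' = N.frac (p +> (b' \<otimes> a \<oplus> b \<otimes> a')) (p +> (b \<otimes> b'))" .
      have "f (m, z \<oplus>\<^bsub>fraction_field D\<^esub> z') = cs (P.frac ((b' \<otimes> a \<oplus> b \<otimes> a') \<otimes> x) (b \<otimes> b'))"
        unfolding x(2) zz using c ab(1) ab'(1) by (intro f_eq x(1) notin_p_mult ab ab') simp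
      also have "(b' \<otimes> a \<oplus> b \<otimes> a') \<otimes> x = b' \<otimes> (a \<otimes> x) \<oplus> b \<otimes> (a' \<otimes> x)"
        using c ab(1) ab'(1) by algebra
      also have "P.frac (b' \<otimes> (a \<otimes> x) \<oplus> b \<otimes> (a' \<otimes> x)) (b \<otimes> b') = P.frac (a \<otimes> x) b \<oplus>\<^bsub>?L\<^esub> P.frac (a' \<otimes> x) b'"
        using c ab ab' by (intro P.add_frac[symmetric]) auto
      also have "cs \<dots> = f (m, z) \<oplus>\<^bsub>?L Quot localized_square\<^esub> f (m, z')"
        unfolding x(2) ab(3) ab'(3) f_eq[OF x(1) ab(1,2)] f_eq[OF x(1) ab'(1,2)]
        using c ab ab' by (intro cs_add[symmetric] P.frac_in_carrier) auto
      finally have "h (frag_of (m, z \<oplus>\<^bsub>fraction_field D\<^esub> z')) = h (frag_of (m, z) + frag_of (m, z'))"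
        using h(2) mz B.a_closed h_add frag_in by simp
      then show ?thesis
        unfolding r diff_diff_eq using mz B.a_closed
        by (intro h_diff B.carrier_FG_add frag_in) auto
    next
      fix d m z assume r: "r = frag_of (d \<odot>\<^bsub>CM\<^esub> m, z) - frag_of (m, fraction_field_map D d \<otimes>\<^bsub>fraction_field D\<^esub> z)"
        and mz: "d \<in> carrier D" "m \<in> carrier CM" "z \<in> carrier (fraction_field D)"
      obtain x where x: "x \<in> p" "m = p \<cdot> p +> x" using mz(2) unfolding CM_simps(1) by blast
      obtain t where t: "t \<in> carrier R" "d = p +> t" using mz(1) unfolding D_simps(1) by blast
      obtain a b where ab: "a \<in> carrier R" "b \<in> carrier R - p" "z = N.frac (p +> a) (p +> b)"
        using fraction_field_cases[OF mz(3)] .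
      have c: "x \<in> carrier R" using x p_carr by auto
      have dz: "fraction_field_map D d \<otimes>\<^bsub>fraction_field D\<^esub> z = N.frac (p +> (t \<otimes> a)) (p +> b)"
        unfolding ab(3) phi_mult_frac[OF mz(1) coset_in_D[OF ab(1)] coset_nonzero_D[OF ab(2)]]
        unfolding t(2) D_simps(4)[OF t(1) ab(1)] ..
      have "f (d \<odot>\<^bsub>CM\<^esub> m, z) = cs (P.frac (a \<otimes> (t \<otimes> x)) b)"
        unfolding t(2) x(2) ab(3) CM_smult[OF t(1) x(1)]
        using f_eq[OF ideal_smult[OF p_ideal t(1) x(1)] ab(1,2)] .
      also have "a \<otimes> (t \<otimes> x) = (t \<otimes> a) \<otimes> x" using c t(1) ab(1) by algebra
      also have "cs (P.frac ((t \<otimes> a) \<otimes> x) b) = f (m, fraction_field_map D d \<otimes>\<^bsub>fraction_field D\<^esub> z)"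
        unfolding dz x(2) using t(1) ab by (intro f_eq[symmetric] x(1)) auto
      finally have "h (frag_of (d \<odot>\<^bsub>CM\<^esub> m, z)) = h (frag_of (m, fraction_field_map D d \<otimes>\<^bsub>fraction_field D\<^esub> z))"
        using h(2) mz B.M_smult_closed B.phi_closed by simp
      then show ?thesis
        unfolding r using mz B.M_smult_closed B.phi_closed by (intro h_diff frag_in) auto
    qed
    have ker: "kernel B.FG (add_monoid (?L Quot localized_square)) h = {c \<in> carrier B.FG. h c = \<zero>\<^bsub>?L Quot localized_square\<^esub>}"
      by (simp add: kernel_def)
    have "tensor_relations D CM (ring_as_module (fraction_field_map D) (fraction_field D)) \<subseteq>
        kernel B.FG (add_monoid (?L Quot localized_square)) h"
      unfolding ker using rel B.relations_carrier by blast
    then have "B.TK \<subseteq> kernel B.FG (add_monoid (?L Quot localized_square)) h"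
      unfolding B.TK_def using gh.subgroup_kernel by (intro gh.generate_subgroup_incl)
    then show ?thesis using \<open>c \<in> B.TK\<close> unfolding ker by blast
  qed
  have m0: "p \<cdot> p +> x0 \<in> carrier CM" unfolding CM_simps(1) using x0 by blast
  have "frag_of (p \<cdot> p +> x0, N.frac (p +> \<one>) (p +> \<one>)) \<in> B.TK"
    using assms m0 N_in[of \<one> \<one>] one_notin_p unfolding rank_zero_iff by blast
  from h_TK[OF this] have "f (p \<cdot> p +> x0, N.frac (p +> \<one>) (p +> \<one>)) = \<zero>\<^bsub>?L Quot localized_square\<^esub>"
    using h(2) m0 N_in[of \<one> \<one>] one_notin_p by simp
  then have "cs (P.frac x0 \<one>) = \<zero>\<^bsub>?L Quot localized_square\<^esub>"
    using f_eq[OF x0 one_closed one_notin_p] p_carr[OF x0] by simp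
  then have "P.frac x0 \<one> \<in> localized_square" using cs_zero[of "P.frac x0 \<one>"] p_carr[OF x0] one_notin_p by auto
  then show "\<exists>s\<in>carrier R - p. s \<otimes> x0 \<in> p \<cdot> p" using frac_in_localized_square p_carr[OF x0] by blast
qed

end

section \<open>Krull dimension one and the equivalences\<close>

lemma no_prime_chain_of_length_two:
  assumes "krull_dim R = 1" "primeideal a R" "primeideal b R" "primeideal c R"
  shows "\<not> (a \<subset> b \<and> b \<subset> c)"
proof
  assume chain: "a \<subset> b \<and> b \<subset> c"
  define P where "P i = (if i = 0 then a else if i = 1 then b else c)" for i :: nat
  have "(\<forall>i\<le>2. primeideal (P i) R) \<and> (\<forall>i<2. P i \<subset> P (Suc i))"
    using assms chain by (auto simp: P_def less_2_cases_iff)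
  then have "enat 2 \<in> {enat n | n. \<exists>P. (\<forall>i\<le>n. primeideal (P i) R) \<and> (\<forall>i<n. P i \<subset> P (Suc i))}"
    by blast
  then have "enat 2 \<le> krull_dim R" unfolding krull_dim_def by (rule Sup_upper)
  then show False using assms(1) by (simp add: one_enat_def)
qed

lemma ex_strict_prime_chain:
  assumes "krull_dim R = 1"
  obtains a b where "primeideal a R" "primeideal b R" "a \<subset> b"
proof -
  have "\<exists>n>0. \<exists>P. (\<forall>i\<le>n. primeideal (P i) R) \<and> (\<forall>i<n. P i \<subset> P (Suc i))"
  proof (rule ccontr)
    assume no: "\<not> ?thesis"
    have "krull_dim R \<le> 0"
      unfolding krull_dim_def
    proof (rule Sup_least)
      fix x assume "x \<in> {enat n | n. \<exists>P. (\<forall>i\<le>n. primeideal (P i) R) \<and> (\<forall>i<n. P i \<subset> P (Suc i))}"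
      then obtain n where "x = enat n" "n = 0" using no by blast
      then show "x \<le> 0" by (simp add: zero_enat_def)
    qed
    then show False using assms by simp
  qed
  then obtain n P where "n > 0" "\<forall>i\<le>n. primeideal (P i) R" "\<forall>i<n. P i \<subset> P (Suc i)" by blast
  then have "primeideal (P 0) R" "primeideal (P 1) R" "P 0 \<subset> P 1" by auto
  then show thesis using that by blast
qed

text \<open>
  Descending twice from a prime without finding a minimal one would give a chain of length two.
\<close>

lemma minimal_primeideal_below:
  assumes "krull_dim R = 1" "primeideal q R"
  obtains q' where "minimal_primeideal q' R" "q' \<subseteq> q"
proof -
  have "\<exists>q'. minimal_primeideal q' R \<and> q' \<subseteq> q"
  proof (rule ccontr)
    assume no: "\<not> ?thesis"
    then obtain q1 where q1: "primeideal q1 R" "q1 \<subset> q"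
      using assms(2) unfolding minimal_primeideal_def by blast
    then obtain q2 where "primeideal q2 R" "q2 \<subset> q1"
      using no unfolding minimal_primeideal_def by blast
    then show False using no_prime_chain_of_length_two[OF assms(1)] q1 assms(2) by blast
  qed
  then show thesis using that by blast
qed

lemma (in noetherian_cring) ex_maximalideal_above:
  assumes "ideal I R" "I \<noteq> carrier R"
  obtains M where "maximalideal M R" "I \<subseteq> M"
proof -
  define F where "F = {J. ideal J R \<and> I \<subseteq> J \<and> J \<noteq> carrier R}"
  have "F \<noteq> {}" "\<And>J. J \<in> F \<Longrightarrow> ideal J R" using assms by (auto simp: F_def)
  then obtain M where M: "M \<in> F" "\<And>J. J \<in> F \<Longrightarrow> M \<subseteq> J \<Longrightarrow> J = M"
    using ex_maximal_ideal_in by blast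
  have "maximalideal M R"
  proof (rule maximalidealI)
    show "ideal M R" "carrier R \<noteq> M" using M(1) by (auto simp: F_def)
    show "J = M \<or> J = carrier R" if "ideal J R" "M \<subseteq> J" "J \<subseteq> carrier R" for J
    proof (rule disjCI)
      assume "J \<noteq> carrier R"
      then have "J \<in> F" using that M(1) unfolding F_def by blast
      then show "J = M" using M(2) that(2) by blast
    qed
  qed
  then show thesis using that M(1) by (auto simp: F_def)
qed

text \<open>
  A maximal ideal above a prime \<open>q \<noteq> p\<close> equals \<open>q\<close>, since otherwise there would be a chain of length two
  starting at \<open>p\<close>. A chain \<open>a \<subset> b\<close> of length one supplies the nonunit modulo \<open>p\<close>: any element of \<open>b\<close> that
  is not in \<open>a\<close>.
\<close>

lemma one_dim_unique_minimal_primeI: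
  fixes R (structure)
  assumes "cring R" "noetherian_ring R" and dim: "krull_dim R = 1"
    and min: "minimal_primeideal p R" and uniq: "\<And>q. minimal_primeideal q R \<Longrightarrow> q = p"
  shows "one_dim_unique_minimal_prime R p"
proof -
  interpret noetherian_cring R using assms by (simp add: noetherian_cring_def)
  have prime: "primeideal p R" using min by (simp add: minimal_primeideal_def)
  have least: "p \<subseteq> q" if "primeideal q R" for q
    using minimal_primeideal_below[OF dim that] uniq by metis
  show ?thesis
  proof (intro one_dim_unique_minimal_prime.intro one_dim_unique_minimal_prime_axioms.intro
      noetherian_cring_axioms prime)
    show "p \<subseteq> q" if "primeideal q R" for q using least that .
    show "maximalideal q R" if q: "primeideal q R" "q \<noteq> p" for q
    proof -
      obtain M where M: "maximalideal M R" "q \<subseteq> M"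
        using ex_maximalideal_above[OF primeideal.axioms(1)[OF q(1)]] primeideal.I_notcarr[OF q(1)] by metis
      have "\<not> (p \<subset> q \<and> q \<subset> M)"
        using no_prime_chain_of_length_two[OF dim prime q(1) maximalideal_prime[OF M(1)]] .
      then have "q = M" using least[OF q(1)] q(2) M(2) by blast
      then show ?thesis using M(1) by simp
    qed
    obtain a b where ab: "primeideal a R" "primeideal b R" "a \<subset> b"
      using ex_strict_prime_chain[OF dim] .
    note b = primeideal.axioms(1)[OF ab(2)]
    obtain s where s: "s \<in> b" "s \<notin> a" using ab(3) by blast
    have sc: "s \<in> carrier R" using ideal_carr[OF b s(1)] .
    have "\<one> \<ominus> r \<otimes> s \<notin> p" if r: "r \<in> carrier R" for r
    proof
      assume "\<one> \<ominus> r \<otimes> s \<in> p"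
      then have "(\<one> \<ominus> r \<otimes> s) \<oplus> r \<otimes> s \<in> b"
        using ideal_add[OF b _ ideal_smult[OF b r s(1)]] least[OF ab(2)] by blast
      moreover have "(\<one> \<ominus> r \<otimes> s) \<oplus> r \<otimes> s = \<one>" using r sc by algebra
      ultimately show False
        using ideal.one_imp_carrier[OF b] primeideal.I_notcarr[OF ab(2)] by simp
    qed
    moreover have "s \<in> carrier R - p" using s sc least[OF ab(1)] by blast
    ultimately show "\<exists>s\<in>carrier R - p. \<forall>r\<in>carrier R. \<one> \<ominus> r \<otimes> s \<notin> p" by blast
  qed
qed

theorem theorem5p1:
  fixes R :: "('a, 'm) ring_scheme" (structure) and p :: "'a set"
  assumes "cring R"
    and "noetherian_ring R"
    and "krull_dim R = 1"
    and "minimal_primeideal p R"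
    and "\<And>q. minimal_primeideal q R \<Longrightarrow> q = p"
    and "principal_domain (R Quot p)"
  shows
    "(iso_artinian R \<longleftrightarrow> field (localization_at R p)) \<and>
     (field (localization_at R p) \<longleftrightarrow>
        localized_ideal R p p = {\<zero>\<^bsub>localization_at R p\<^esub>}) \<and>
     (localized_ideal R p p = {\<zero>\<^bsub>localization_at R p\<^esub>} \<longleftrightarrow>
        finite_length R (ideal_as_module R p)) \<and>
     (finite_length R (ideal_as_module R p) \<longleftrightarrow>
        torsion_module (R Quot p) (conormal_module R p)) \<and>
     (torsion_module (R Quot p) (conormal_module R p) \<longleftrightarrow>
        module_rank (R Quot p) (conormal_module R p) = 0) \<and>
     (module_rank (R Quot p) (conormal_module R p) = 0 \<longleftrightarrow>
        (\<exists>s \<in> carrier R - p. \<forall>x \<in> p. s \<otimes> x = \<zero>))"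
proof -
  interpret one_dim_unique_minimal_prime R p
    using one_dim_unique_minimal_primeI assms(1-5) by blast
  interpret one_dim_pid_quotient R p
    by (intro one_dim_pid_quotient.intro one_dim_pid_quotient_axioms.intro
        one_dim_unique_minimal_prime_axioms assms(6))
  let ?killed = "\<exists>s\<in>carrier R - p. \<forall>x\<in>p. s \<otimes> x = \<zero>"
  have fin: "finite_length R (ideal_as_module R p) \<longleftrightarrow> ?killed"
    unfolding finite_length_ideal_iff[OF p_ideal]
    using p_killed_if_chains_bounded chains_bounded_if_p_killed by blast
  have sq: "(\<exists>s\<in>carrier R - p. \<forall>x\<in>p. s \<otimes> x \<in> p \<cdot> p) \<longleftrightarrow> ?killed"
  proof
    show ?killed if "\<exists>s\<in>carrier R - p. \<forall>x\<in>p. s \<otimes> x \<in> p \<cdot> p"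
      using that p_killed_if_killed_mod_square by blast
    assume ?killed
    then obtain s where "s \<in> carrier R - p" "\<forall>x\<in>p. s \<otimes> x = \<zero>" by blast
    moreover from this have "\<forall>x\<in>p. s \<otimes> x \<in> p \<cdot> p" using ideal_zero[OF p_square_ideal] by simp
    ultimately show "\<exists>s\<in>carrier R - p. \<forall>x\<in>p. s \<otimes> x \<in> p \<cdot> p" by blast
  qed
  have iso: "iso_artinian R \<longleftrightarrow> ?killed"
    using p_killed_mod_square_if_iso_artinian sq iso_artinian_if_chains_bounded chains_bounded_if_p_killed by blast
  have tor: "torsion_module (R Quot p) (conormal_module R p) \<longleftrightarrow> ?killed"
    unfolding torsion_conormal_iff by (rule sq)
  have rank: "module_rank (R Quot p) (conormal_module R p) = 0 \<longleftrightarrow> ?killed"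
    using rank_zero_if_torsion torsion_if_rank_zero tor by blast
  show ?thesis
    unfolding iso field_localization_iff_p_killed localized_ideal_zero_iff_p_killed fin tor rank by simp
qed

end
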